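(* Let $N\ge 1$, let $\Omega\subset\mathbb{R}^N$ be a bounded domain, and let $1<q<p<\infty$. Let $m,a,f\in L^\gamma(\Omega)$, where $\gamma>N/p$ (for some such $\gamma$) if $N\ge p$ and $\gamma=1$ if $N<p$, with $m_+\not\equiv 0$, $a\not\equiv 0$, $f\not\equiv 0$. Assume that $f\ge 0$ a.e. in $\Omega$. For $b\in\{a,-a\}$ put $$\Theta(b)=\left\{u\in W_0^{1,p}(\Omega):\ u\ge 0,\ \int_\Omega b\,u^q\,dx>0\right\}$$ and $$\eta^*_\lambda(b)=\frac{p-1}{(p-q)^{\frac{p-q}{p-1}}(q-1)^{\frac{q-1}{p-1}}}\ \inf_{u\in\Theta(b)}\frac{\left(\int_\Omega|\nabla u|^p\,dx-\lambda\int_\Omega m u^p\,dx\right)^{\frac{q-1}{p-1}}\left(\int_\Omega f u\,dx\right)^{\frac{p-q}{p-1}}}{\int_\Omega b\,u^q\,dx},$$ with $\eta^*_\lambda(b)=+\infty$ if $\Theta(b)=\emptyset$. Then any solution of $$-\Delta_p u=\lambda\,m(x)|u|^{p-2}u+\eta\,a(x)|u|^{q-2}u+f(x)\ \text{ in }\Omega,\qquad u=0\ \text{ on }\partial\Omega,$$ is nonnegative provided $0\le\lambda\le\lambda_1(m)$ and either $-\eta^*_\lambda(-a)<\eta\le 0$ or $0\le\eta<\eta^*_\lambda(a)$.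
   Context: Notation: $w_\pm=\max\{\pm w,0\}$; $\Delta_p u=\mathrm{div}(|\nabla u|^{p-2}\nabla u)$. A solution is a function $u\in W_0^{1,p}(\Omega)$ with $\int_\Omega|\nabla u|^{p-2}\nabla u\cdot\nabla\xi\,dx=\lambda\int_\Omega m|u|^{p-2}u\xi\,dx+\eta\int_\Omega a|u|^{q-2}u\xi\,dx+\int_\Omega f\xi\,dx$ for all $\xi\in W_0^{1,p}(\Omega)$. The first positive eigenvalue is $$\lambda_1(m)=\inf\left\{\frac{\int_\Omega|\nabla u|^p\,dx}{\int_\Omega m|u|^p\,dx}:\ u\in W_0^{1,p}(\Omega),\ \int_\Omega m|u|^p\,dx>0\right\}.$$ *)

theory Defs
  imports "HOL-Analysis.Analysis"
begin

text \<open>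
  Throughout, an element of a Lebesgue or Sobolev space on \<open>\<Omega>\<close> is represented by a function on the
  whole space; its values outside \<open>\<Omega>\<close> are irrelevant, and (in)equalities hold almost everywhere
  with respect to \<^term>\<open>lebesgue_on \<Omega>\<close>.
\<close>

definition Lebesgue_space ::
    "real \<Rightarrow> 'a::euclidean_space set \<Rightarrow> ('a \<Rightarrow> 'b::euclidean_space) set" where
  "Lebesgue_space p \<Omega> = {u \<in> borel_measurable (lebesgue_on \<Omega>).
     integrable (lebesgue_on \<Omega>) (\<lambda>x. norm (u x) powr p)}"

definition locally_integrable ::
    "'a::euclidean_space set \<Rightarrow> ('a \<Rightarrow> 'b::euclidean_space) \<Rightarrow> bool" where
  "locally_integrable \<Omega> u \<longleftrightarrow> u \<in> borel_measurable (lebesgue_on \<Omega>) \<and>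
     (\<forall>K. compact K \<and> K \<subseteq> \<Omega> \<longrightarrow> integrable (lebesgue_on K) u)"

primrec continuously_differentiable :: "nat \<Rightarrow> ('a::euclidean_space \<Rightarrow> real) \<Rightarrow> bool" where
  "continuously_differentiable 0 \<phi> \<longleftrightarrow> continuous_on UNIV \<phi>"
| "continuously_differentiable (Suc k) \<phi> \<longleftrightarrow> (\<forall>x. \<phi> differentiable (at x)) \<and>
     (\<forall>v. continuously_differentiable k (\<lambda>x. frechet_derivative \<phi> (at x) v))"

definition test_functions :: "'a::euclidean_space set \<Rightarrow> ('a \<Rightarrow> real) set" where
  "test_functions \<Omega> = {\<phi>. (\<forall>k. continuously_differentiable k \<phi>) \<and>
     compact (closure {x. \<phi> x \<noteq> 0}) \<and> closure {x. \<phi> x \<noteq> 0} \<subseteq> \<Omega>}"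

definition has_weak_gradient ::
    "'a::euclidean_space set \<Rightarrow> ('a \<Rightarrow> real) \<Rightarrow> ('a \<Rightarrow> 'a) \<Rightarrow> bool" where
  "has_weak_gradient \<Omega> u g \<longleftrightarrow> locally_integrable \<Omega> u \<and> locally_integrable \<Omega> g \<and>
     (\<forall>\<phi>\<in>test_functions \<Omega>. \<forall>i\<in>Basis.
        (\<integral>x. u x * frechet_derivative \<phi> (at x) i \<partial>lebesgue_on \<Omega>) =
        - (\<integral>x. (g x \<bullet> i) * \<phi> x \<partial>lebesgue_on \<Omega>))"

text \<open>The weak gradient is unique almost everywhere, so the choice below does not affect integrals.\<close>

definition weak_gradient :: "'a::euclidean_space set \<Rightarrow> ('a \<Rightarrow> real) \<Rightarrow> 'a \<Rightarrow> 'a" where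
  "weak_gradient \<Omega> u = (SOME g. has_weak_gradient \<Omega> u g)"

definition Sobolev_space :: "real \<Rightarrow> 'a::euclidean_space set \<Rightarrow> ('a \<Rightarrow> real) set" where
  "Sobolev_space p \<Omega> =
     {u \<in> Lebesgue_space p \<Omega>. \<exists>g \<in> Lebesgue_space p \<Omega>. has_weak_gradient \<Omega> u g}"

definition Sobolev_norm :: "real \<Rightarrow> 'a::euclidean_space set \<Rightarrow> ('a \<Rightarrow> real) \<Rightarrow> real" where
  "Sobolev_norm p \<Omega> u =
     ((\<integral>x. \<bar>u x\<bar> powr p \<partial>lebesgue_on \<Omega>) +
      (\<integral>x. norm (weak_gradient \<Omega> u x) powr p \<partial>lebesgue_on \<Omega>)) powr (1 / p)"

text \<open>The space $W_0^{1,p}(\Omega)$: the closure of $C_c^\infty(\Omega)$ in $W^{1,p}(\Omega)$.\<close>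

definition Sobolev_space0 :: "real \<Rightarrow> 'a::euclidean_space set \<Rightarrow> ('a \<Rightarrow> real) set" where
  "Sobolev_space0 p \<Omega> = {u \<in> Sobolev_space p \<Omega>.
     \<forall>\<epsilon>>0. \<exists>\<phi>\<in>test_functions \<Omega>. Sobolev_norm p \<Omega> (\<lambda>x. u x - \<phi> x) < \<epsilon>}"

text \<open>
  Where \<open>\<bar>u\<bar>\<^sup>p\<^sup>-\<^sup>2 u\<close> or \<open>\<bar>\<nabla>u\<bar>\<^sup>p\<^sup>-\<^sup>2 \<nabla>u\<close> is evaluated at a zero, \<open>powr\<close> gives \<open>0\<close>, which is the
  usual convention for \<open>1 < p < 2\<close>.
\<close>

definition is_solution ::
    "real \<Rightarrow> real \<Rightarrow> 'a::euclidean_space set \<Rightarrow> ('a \<Rightarrow> real) \<Rightarrow> ('a \<Rightarrow> real) \<Rightarrow> ('a \<Rightarrow> real) \<Rightarrow>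
     real \<Rightarrow> real \<Rightarrow> ('a \<Rightarrow> real) \<Rightarrow> bool" where
  "is_solution p q \<Omega> m a f lam \<eta> u \<longleftrightarrow> u \<in> Sobolev_space0 p \<Omega> \<and>
     (\<forall>\<xi>\<in>Sobolev_space0 p \<Omega>.
        (\<integral>x. norm (weak_gradient \<Omega> u x) powr (p - 2) *
              (weak_gradient \<Omega> u x \<bullet> weak_gradient \<Omega> \<xi> x) \<partial>lebesgue_on \<Omega>) =
        lam * (\<integral>x. m x * \<bar>u x\<bar> powr (p - 2) * u x * \<xi> x \<partial>lebesgue_on \<Omega>) +
        \<eta> * (\<integral>x. a x * \<bar>u x\<bar> powr (q - 2) * u x * \<xi> x \<partial>lebesgue_on \<Omega>) +
        (\<integral>x. f x * \<xi> x \<partial>lebesgue_on \<Omega>))"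

definition lambda1 ::
    "real \<Rightarrow> 'a::euclidean_space set \<Rightarrow> ('a \<Rightarrow> real) \<Rightarrow> ereal" where
  "lambda1 p \<Omega> m =
     (INF u \<in> {u \<in> Sobolev_space0 p \<Omega>. (\<integral>x. m x * \<bar>u x\<bar> powr p \<partial>lebesgue_on \<Omega>) > 0}.
        ereal ((\<integral>x. norm (weak_gradient \<Omega> u x) powr p \<partial>lebesgue_on \<Omega>) /
               (\<integral>x. m x * \<bar>u x\<bar> powr p \<partial>lebesgue_on \<Omega>)))"

definition Theta ::
    "real \<Rightarrow> real \<Rightarrow> 'a::euclidean_space set \<Rightarrow> ('a \<Rightarrow> real) \<Rightarrow> ('a \<Rightarrow> real) set" where
  "Theta p q \<Omega> b = {u \<in> Sobolev_space0 p \<Omega>.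
     (AE x in lebesgue_on \<Omega>. u x \<ge> 0) \<and> (\<integral>x. b x * u x powr q \<partial>lebesgue_on \<Omega>) > 0}"

text \<open>
  For \<open>lam \<le> lambda1 p \<Omega> m\<close> the base of the first power below is nonnegative, so that \<open>powr\<close> is
  the real power intended there.
\<close>

definition eta_star ::
    "real \<Rightarrow> real \<Rightarrow> 'a::euclidean_space set \<Rightarrow> ('a \<Rightarrow> real) \<Rightarrow> ('a \<Rightarrow> real) \<Rightarrow> real \<Rightarrow>
     ('a \<Rightarrow> real) \<Rightarrow> ereal" where
  "eta_star p q \<Omega> m f lam b =
     (if Theta p q \<Omega> b = {} then \<infinity>
      else ereal ((p - 1) /
             ((p - q) powr ((p - q) / (p - 1)) * (q - 1) powr ((q - 1) / (p - 1)))) *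
           (INF u \<in> Theta p q \<Omega> b.
              ereal (((\<integral>x. norm (weak_gradient \<Omega> u x) powr p \<partial>lebesgue_on \<Omega>)
                        - lam * (\<integral>x. m x * u x powr p \<partial>lebesgue_on \<Omega>)) powr ((q - 1) / (p - 1)) *
                     (\<integral>x. f x * u x \<partial>lebesgue_on \<Omega>) powr ((p - q) / (p - 1)) /
                     (\<integral>x. b x * u x powr q \<partial>lebesgue_on \<Omega>))))"

end

theory Submission
  imports Defs
begin

text \<open>
  Let \<open>w = u\<^sub>-\<close> and write \<open>E(v)\<close> for the integral of \<open>\<bar>\<nabla>v\<bar>\<^sup>p - \<lambda> m \<bar>v\<bar>\<^sup>p\<close>, \<open>F(v)\<close> for that of \<open>f v\<close> and
  \<open>A(v)\<close> for that of \<open>b v\<^sup>q\<close>, where \<open>\<eta> a = \<eta>' b\<close> with \<open>b = a\<close> or \<open>b = -a\<close> and \<open>\<eta>' \<ge> 0\<close>.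
  Testing the equation with \<open>w\<close> gives \<open>E(w) + F(w) = \<eta>' A(w)\<close>. Both terms on the left are nonnegative,
  the first because \<open>\<lambda> \<le> \<lambda>\<^sub>1(m)\<close>. If the right-hand side were positive, then \<open>w\<close> would lie in
  \<open>\<Theta>(b)\<close>, and the bound on \<open>\<eta>'\<close> would give \<open>\<eta>' A(w) < C E(w)\<^sup>\<alpha> F(w)\<^sup>1\<^sup>-\<^sup>\<alpha>\<close> with
  \<open>\<alpha> = (q-1)/(p-1)\<close>; the constant \<open>C\<close> is the one for which the weighted inequality of arithmetic and
  geometric means bounds this by \<open>E(w) + F(w)\<close>, a contradiction. Hence \<open>E(w) = 0\<close>, that is, \<open>w\<close>
  minimizes the nonnegative functional \<open>E\<close>.

  A nonnegative minimizer with zero energy either vanishes almost everywhere or is positive almost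
  everywhere (\<open>strong_maximum_principle\<close>). With a cutoff \<open>\<Phi>\<close>, the competitor
  \<open>w + t \<Phi> (w + \<epsilon>)\<^sup>1\<^sup>-\<^sup>p\<close> bounds the gradient of \<open>ln (w + \<epsilon>)\<close> in \<open>L\<^sup>p\<close> on balls, uniformly in \<open>\<epsilon>\<close>
  (\<open>log_gradient_estimate\<close>). If \<open>w\<close> vanished on a part of positive measure of a ball, the Poincare
  inequality would bound \<open>ln (1 + w / \<epsilon>)\<close> in \<open>L\<^sup>1\<close> of the ball, which is only possible as \<open>\<epsilon> \<rightarrow> 0\<close> if
  \<open>w\<close> vanishes on the whole ball. Connectedness of \<open>\<Omega>\<close> does the rest.

  It remains to exclude that \<open>w\<close> is positive almost everywhere (\<open>no_positive_null_energy\<close>). If \<open>f w\<close>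
  is integrable, this is clear: bounded truncations \<open>v \<rightarrow> w\<close> satisfy \<open>E(v) \<rightarrow> 0\<close>, and testing the
  equation with functions close to \<open>w\<close> shows that \<open>\<eta>' A(v)\<close> tends to \<open>F(w) > 0\<close>, so that
  \<open>\<eta>' A(v) < C E(v)\<^sup>\<alpha> F(v)\<^sup>1\<^sup>-\<^sup>\<alpha>\<close> fails in the limit. In general only the truncations \<open>f v\<close> are known to be
  integrable. The same inequality then says that the integral of \<open>f w\<close> over \<open>{w \<le> k}\<close> is small
  compared with the power \<open>1 - \<alpha>\<close> of the integral of \<open>f min(w, k)\<close>. Comparing dyadic levels,
  the mass of \<open>f\<close> over \<open>{w > k}\<close> would have to decay like \<open>k\<^sup>-\<^sup>\<alpha>\<close> and also more slowly than that
  (\<open>tail_growth_contradiction\<close>).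

  The Sobolev space is handled through the relation \<open>W0 u g\<close>: the pair \<open>(u, g)\<close> is a limit in \<open>L\<^sup>p\<close> of
  pairs of a test function and its gradient. It is closed under limits and carries the chain rule for
  smooth functions, and it determines the weak gradient up to null sets by the fundamental lemma of
  the calculus of variations.
\<close>

section \<open>Smooth functions\<close>

abbreviation smooth :: "('a::euclidean_space \<Rightarrow> real) \<Rightarrow> bool" where
  "smooth \<phi> \<equiv> \<forall>k. continuously_differentiable k \<phi>"

lemma frechet_derivative_eqI: "(f has_derivative f') (at x) \<Longrightarrow> frechet_derivative f (at x) = f'"
  using frechet_derivative_at by metis

lemma continuously_differentiable_antimono:
  "continuously_differentiable (Suc k) f \<Longrightarrow> continuously_differentiable k f"
proof (induction k arbitrary: f)
  case 0
  then show ?case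
    by (simp add: continuous_on_eq_continuous_at differentiable_imp_continuous_within)
next
  case (Suc k)
  then show ?case by (metis continuously_differentiable.simps(2))
qed

lemma continuously_differentiable_SucI:
  assumes "\<And>x. (f has_derivative f' x) (at x)"
    and "\<And>v. continuously_differentiable k (\<lambda>x. f' x v)"
  shows "continuously_differentiable (Suc k) f"
proof -
  have "frechet_derivative f (at x) = f' x" for x
    using assms(1) by (rule frechet_derivative_eqI)
  then show ?thesis
    using assms by (auto simp: differentiable_def)
qed

lemma continuously_differentiable_SucE:
  assumes "continuously_differentiable (Suc k) f"
  shows "(f has_derivative frechet_derivative f (at x)) (at x)"
    and "continuously_differentiable k (\<lambda>x. frechet_derivative f (at x) v)"
  using assms by (auto simp: frechet_derivative_works)

lemma continuously_differentiable_const: "continuously_differentiable k (\<lambda>x. c)"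
proof (induction k arbitrary: c)
  case (Suc k)
  show ?case
    by (rule continuously_differentiable_SucI[where f' = "\<lambda>x v. 0"]) (use Suc in auto)
qed auto

lemma continuously_differentiable_add:
  "continuously_differentiable k f \<Longrightarrow> continuously_differentiable k g \<Longrightarrow>
   continuously_differentiable k (\<lambda>x. f x + g x)"
proof (induction k arbitrary: f g)
  case 0
  then show ?case by (auto intro!: continuous_intros)
next
  case (Suc k)
  note f = continuously_differentiable_SucE[OF Suc.prems(1)]
    and g = continuously_differentiable_SucE[OF Suc.prems(2)]
  show ?case
    by (rule continuously_differentiable_SucI[OF has_derivative_add[OF f(1) g(1)]])
       (intro Suc.IH f(2) g(2))
qed

lemma continuously_differentiable_mult:
  "continuously_differentiable k f \<Longrightarrow> continuously_differentiable k g \<Longrightarrow>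
   continuously_differentiable k (\<lambda>x. f x * g x)"
proof (induction k arbitrary: f g)
  case 0
  then show ?case by (auto intro!: continuous_intros)
next
  case (Suc k)
  note f = continuously_differentiable_SucE[OF Suc.prems(1)]
    and g = continuously_differentiable_SucE[OF Suc.prems(2)]
  note f' = continuously_differentiable_antimono[OF Suc.prems(1)]
    and g' = continuously_differentiable_antimono[OF Suc.prems(2)]
  show ?case
    by (rule continuously_differentiable_SucI[OF has_derivative_mult[OF f(1) g(1)]])
       (intro continuously_differentiable_add Suc.IH f(2) g(2) f' g')
qed

lemma continuously_differentiable_bounded_linear:
  assumes "bounded_linear f"
  shows "continuously_differentiable k f"
proof (cases k)
  case 0
  then show ?thesis using assms linear_continuous_on by auto
next
  case (Suc j)
  show ?thesis unfolding Suc
    by (rule continuously_differentiable_SucI[where f' = "\<lambda>x. f"])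
       (auto intro: bounded_linear_imp_has_derivative assms continuously_differentiable_const)
qed

lemma continuously_differentiable_real_SucI:
  fixes G :: "real \<Rightarrow> real"
  assumes "\<And>x. (G has_real_derivative G' x) (at x)" and "continuously_differentiable k G'"
  shows "continuously_differentiable (Suc k) G"
proof (rule continuously_differentiable_SucI)
  show "(G has_derivative (\<lambda>v. G' x * v)) (at x)" for x
    using assms(1)[of x] by (simp add: has_field_derivative_def)
  show "continuously_differentiable k (\<lambda>x. G' x * v)" for v
    by (intro continuously_differentiable_mult assms(2) continuously_differentiable_const)
qed

lemma continuously_differentiable_compose:
  fixes G :: "real \<Rightarrow> real"
  shows "continuously_differentiable k G \<Longrightarrow> continuously_differentiable k f \<Longrightarrow>
   continuously_differentiable k (\<lambda>x. G (f x))"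
proof (induction k arbitrary: f G)
  case 0
  then show ?case using continuous_on_compose2[of UNIV G UNIV f] by auto
next
  case (Suc k)
  note f = continuously_differentiable_SucE[OF Suc.prems(2)]
    and G = continuously_differentiable_SucE[OF Suc.prems(1)]
  note f' = continuously_differentiable_antimono[OF Suc.prems(2)]
  let ?G' = "\<lambda>y. frechet_derivative G (at y) 1"
  have G': "frechet_derivative G (at y) v = v * ?G' y" for y v
    using linear_scale[OF linear_frechet_derivative, of G "at y" v 1] Suc.prems(1) by simp
  then have "((\<lambda>x. G (f x)) has_derivative
      (\<lambda>v. frechet_derivative f (at x) v * ?G' (f x))) (at x)" for x
    using has_derivative_compose[OF f(1) G(1)] by (subst (asm) G')
  moreover have "continuously_differentiable k
      (\<lambda>x. frechet_derivative f (at x) v * ?G' (f x))" for v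
    by (rule continuously_differentiable_mult[OF f(2) Suc.IH[OF G(2) f']])
  ultimately show ?case
    by (rule continuously_differentiable_SucI)
qed

text \<open>The derivative of a power of \<open>f\<close> is a multiple of another power of \<open>f\<close>, so the induction on the order of
  differentiability must run over all exponents at once.\<close>

lemma continuously_differentiable_powr:
  fixes f f' :: "real \<Rightarrow> real"
  assumes "\<And>x. (f has_real_derivative f' x) (at x)" "\<And>x. f x > 0" "smooth f'"
  shows "continuously_differentiable k (\<lambda>x. f x powr r)"
proof (induction k arbitrary: r)
  case 0
  have "continuous_on UNIV f"
    using assms(1) by (meson DERIV_isCont continuous_at_imp_continuous_on)
  then show ?case by (simp, intro continuous_on_powr continuous_on_const) (auto simp: assms(2) less_imp_neq[symmetric])
next
  case (Suc k)
  have "((\<lambda>x. f x powr r) has_real_derivative r * f x powr (r - 1) * f' x) (at x)" for x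
    by (rule derivative_eq_intros assms(1,2) refl | simp)+
  then show ?case
    using assms(3)
    by (intro continuously_differentiable_real_SucI[where G' = "\<lambda>x. r * f x powr (r - 1) * f' x"])
       (auto intro!: continuously_differentiable_mult continuously_differentiable_const Suc.IH)
qed

lemma smooth_real_antiderivative:
  fixes G :: "real \<Rightarrow> real"
  assumes "\<And>x. (G has_real_derivative G' x) (at x)" and "smooth G'"
  shows "smooth G"
  using assms continuously_differentiable_real_SucI continuously_differentiable_antimono by blast

definition logistic :: "real \<Rightarrow> real" where
  "logistic s = 1 / (1 + exp (- s))"

lemma logistic_pos: "0 < logistic s" and logistic_less_one: "logistic s < 1"
  by (auto simp: logistic_def field_simps add_pos_pos)

lemma logistic_ge_half: "0 \<le> s \<Longrightarrow> 1 / 2 \<le> logistic s"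
  by (auto simp: logistic_def field_simps add_pos_pos)

lemma has_derivative_logistic:
  "(logistic has_real_derivative logistic s * (1 + - logistic s)) (at s)"
  unfolding logistic_def
  by (rule derivative_eq_intros refl | simp add: add_pos_pos less_imp_neq[symmetric])+
     (simp add: divide_simps add_pos_pos less_imp_neq[symmetric] power2_eq_square; algebra)

text \<open>The derivative of the logistic function is a polynomial in the function itself.\<close>

lemma smooth_logistic: "smooth logistic"
proof
  fix k show "continuously_differentiable k logistic"
  proof (induction k)
    case 0
    show ?case using has_derivative_logistic
      by (auto simp: continuous_on_eq_continuous_at intro: DERIV_isCont)
  next
    case (Suc k)
    have "continuously_differentiable k (\<lambda>s. (-1) * logistic s)"
      by (intro continuously_differentiable_mult continuously_differentiable_const Suc.IH)
    then have "continuously_differentiable k (\<lambda>s. - logistic s)" by simp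
    then show ?case
      by (intro continuously_differentiable_real_SucI[OF has_derivative_logistic]
          continuously_differentiable_mult continuously_differentiable_add
          continuously_differentiable_const Suc.IH)
  qed
qed

definition softplus :: "real \<Rightarrow> real" where
  "softplus s = ln (1 + exp s)"

lemma softplus_pos: "0 < softplus s" by (simp add: softplus_def ln_gt_zero)

lemma softplus_ge: "max s 0 \<le> softplus s"
proof -
  have "ln (exp s) \<le> softplus s" unfolding softplus_def by (subst ln_le_cancel_iff) (auto simp: add_pos_pos)
  then show ?thesis using softplus_pos[of s] by simp
qed

lemma softplus_le: "softplus s \<le> max s 0 + ln 2"
proof -
  have "1 + exp s \<le> exp (max s 0) * 2"
    by (smt (verit) exp_le_cancel_iff one_le_exp_iff)
  then have "softplus s \<le> ln (exp (max s 0) * 2)"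
    unfolding softplus_def by (subst ln_le_cancel_iff) (auto simp: add_pos_pos)
  then show ?thesis by (simp add: ln_mult)
qed

lemma has_derivative_softplus: "(softplus has_real_derivative logistic s) (at s)"
  unfolding softplus_def logistic_def
  by (rule derivative_eq_intros refl | simp add: add_pos_pos less_imp_neq[symmetric])+
     (simp add: divide_simps add_pos_pos less_imp_neq[symmetric] exp_minus)

section \<open>Bump functions\<close>

text \<open>The derivative of \<open>flat n\<close> is a combination of two other functions of this family, and all of them
  vanish to every order at the origin; their smoothness follows in one induction.\<close>

definition flat :: "nat \<Rightarrow> real \<Rightarrow> real" where
  "flat n s = (if s > 0 then exp (- 1 / s) / s ^ n else 0)"

lemma has_derivative_flat:
  "(flat n has_real_derivative flat (n + 2) s - real n * flat (n + 1) s) (at s)"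
proof -
  consider "s > 0" | "s < 0" | "s = 0" by linarith
  then show ?thesis
  proof cases
    case 1
    have "((\<lambda>s. exp (- 1 / s) / s ^ n) has_real_derivative
        flat (n + 2) s - real n * flat (n + 1) s) (at s)"
      using 1 unfolding flat_def
      apply (cases n)
      by (rule derivative_eq_intros refl | simp)+ (simp_all add: field_simps power2_eq_square)
    moreover have "eventually (\<lambda>t. flat n t = exp (- 1 / t) / t ^ n) (nhds s)"
      using eventually_nhds_in_open[of "{0<..}" s] 1
      by (auto simp: flat_def elim!: eventually_mono)
    ultimately show ?thesis by (subst DERIV_cong_ev[OF refl _ refl])
  next
    case 2
    have "eventually (\<lambda>t. flat n t = 0) (nhds s)"
      using eventually_nhds_in_open[of "{..<0}" s] 2
      by (auto simp: flat_def elim!: eventually_mono)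
    moreover have "((\<lambda>t. 0) has_real_derivative flat (n + 2) s - real n * flat (n + 1) s) (at s)"
      using 2 by (auto simp: flat_def)
    ultimately show ?thesis by (subst DERIV_cong_ev[OF refl _ refl])
  next
    case 3
    have "((\<lambda>h. (inverse h) ^ Suc n / exp (inverse h)) \<longlongrightarrow> 0) (at_right (0::real))"
      by (rule filterlim_compose[OF tendsto_power_div_exp_0 filterlim_inverse_at_top_right])
    then have "((\<lambda>h. exp (- 1 / h) / h ^ n / h) \<longlongrightarrow> 0) (at_right (0::real))"
      by (simp add: field_simps exp_minus)
    moreover have "eventually (\<lambda>h. exp (- 1 / h) / h ^ n / h = flat n h / h) (at_right 0)"
      by (auto simp: flat_def eventually_at_filter)
    ultimately have "((\<lambda>h. flat n h / h) \<longlongrightarrow> 0) (at_right 0)"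
      using tendsto_cong by fastforce
    moreover have "((\<lambda>h. flat n h / h) \<longlongrightarrow> 0) (at_left 0)"
      by (rule tendsto_eventually) (auto simp: flat_def eventually_at_filter)
    ultimately have "((\<lambda>h. flat n h / h) \<longlongrightarrow> 0) (at 0)"
      by (simp add: filterlim_split_at)
    then show ?thesis
      using 3 by (simp add: DERIV_def flat_def)
  qed
qed

lemma smooth_flat: "smooth (flat n)"
proof
  fix k show "continuously_differentiable k (flat n)"
  proof (induction k arbitrary: n)
    case 0
    show ?case using has_derivative_flat
      by (auto simp: continuous_on_eq_continuous_at intro: DERIV_isCont)
  next
    case (Suc k)
    have "continuously_differentiable k (\<lambda>s. flat (n + 2) s + (- real n) * flat (n + 1) s)"
      by (intro continuously_differentiable_mult continuously_differentiable_add
          continuously_differentiable_const Suc.IH)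
    then show ?case
      by (intro continuously_differentiable_real_SucI[OF has_derivative_flat]) simp
  qed
qed

definition ball_bump :: "'a::euclidean_space \<Rightarrow> real \<Rightarrow> 'a \<Rightarrow> real" where
  "ball_bump x0 r x = flat 0 (r\<^sup>2 - (x - x0) \<bullet> (x - x0))"

lemma smooth_ball_bump: "smooth (ball_bump x0 r)"
proof -
  have i: "continuously_differentiable k (\<lambda>x. (x - x0) \<bullet> b)" for k b
    using continuously_differentiable_add[OF
        continuously_differentiable_bounded_linear[OF bounded_linear_inner_left[of b]]
        continuously_differentiable_const[of k "- (x0 \<bullet> b)"]]
    by (simp add: inner_diff_left)
  have "continuously_differentiable k (\<lambda>x. \<Sum>b\<in>B. (-1) * ((x - x0) \<bullet> b) * ((x - x0) \<bullet> b))"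
    if "finite B" for B k using that
  proof (induction B)
    case (insert b B)
    show ?case unfolding sum.insert[OF insert(1,2)]
      by (intro continuously_differentiable_add insert.IH i
        continuously_differentiable_mult continuously_differentiable_const)
  qed (simp add: continuously_differentiable_const)
  then have "continuously_differentiable k (\<lambda>x. r\<^sup>2 + (\<Sum>b\<in>Basis. (-1) * ((x - x0) \<bullet> b) * ((x - x0) \<bullet> b)))" for k
    by (intro continuously_differentiable_add continuously_differentiable_const) simp
  moreover have "r\<^sup>2 + (\<Sum>b\<in>Basis. (-1) * ((x - x0) \<bullet> b) * ((x - x0) \<bullet> b)) = r\<^sup>2 - (x - x0) \<bullet> (x - x0)" for x
    
    unfolding euclidean_inner[of "x - x0" "x - x0"] by (simp add: sum_negf)
  ultimately have "continuously_differentiable k (\<lambda>x. r\<^sup>2 - (x - x0) \<bullet> (x - x0))" for k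
    by (simp only:)
  then have "continuously_differentiable k (\<lambda>x. flat 0 (r\<^sup>2 - (x - x0) \<bullet> (x - x0)))" for k
    by (rule continuously_differentiable_compose[OF smooth_flat[rule_format, of k 0]])
  then show ?thesis unfolding ball_bump_def by blast
qed

lemma ball_bump_nonneg: "0 \<le> ball_bump x0 r x" and ball_bump_le_one: "ball_bump x0 r x \<le> 1"
  by (auto simp: ball_bump_def flat_def)

lemma ball_bump_pos_iff: "r > 0 \<Longrightarrow> 0 < ball_bump x0 r x \<longleftrightarrow> x \<in> ball x0 r"
proof -
  assume "r > 0"
  have "0 < ball_bump x0 r x \<longleftrightarrow> (norm (x - x0))\<^sup>2 < r\<^sup>2"
    by (auto simp: ball_bump_def flat_def simp flip: power2_norm_eq_inner)
  also have "\<dots> \<longleftrightarrow> norm (x - x0) < r"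
    using \<open>r > 0\<close>
    by (metis less_imp_le norm_ge_zero power2_less_imp_less power_strict_mono zero_less_numeral)
  finally show ?thesis by (simp add: dist_norm norm_minus_commute)
qed

section \<open>Gradients and test functions\<close>

definition grad :: "('a::euclidean_space \<Rightarrow> real) \<Rightarrow> 'a \<Rightarrow> 'a" where
  "grad \<phi> x = (\<Sum>i\<in>Basis. frechet_derivative \<phi> (at x) i *\<^sub>R i)"

lemma grad_eqI:
  assumes "(\<phi> has_derivative (\<lambda>v. g \<bullet> v)) (at x)"
  shows "grad \<phi> x = g"
  by (simp add: grad_def frechet_derivative_eqI[OF assms] euclidean_representation)

lemma has_derivative_grad:
  assumes "smooth \<phi>"
  shows "(\<phi> has_derivative (\<lambda>v. grad \<phi> x \<bullet> v)) (at x)"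
proof -
  have d: "(\<phi> has_derivative frechet_derivative \<phi> (at x)) (at x)"
    using assms continuously_differentiable_SucE(1) by blast
  then have l: "linear (frechet_derivative \<phi> (at x))"
    by (rule has_derivative_linear)
  have "frechet_derivative \<phi> (at x) v = grad \<phi> x \<bullet> v" for v
  proof -
    have "frechet_derivative \<phi> (at x) v = frechet_derivative \<phi> (at x) (\<Sum>i\<in>Basis. (v \<bullet> i) *\<^sub>R i)"
      by (simp add: euclidean_representation)
    also have "\<dots> = (\<Sum>i\<in>Basis. (v \<bullet> i) * frechet_derivative \<phi> (at x) i)"
      by (simp add: linear_sum[OF l] linear_scale[OF l])
    finally show ?thesis
      by (simp add: grad_def inner_sum_left mult.commute) (simp add: inner_commute)
  qed
  then show ?thesis using d by presburger
qed

lemma frechet_derivative_grad: "smooth \<phi> \<Longrightarrow> frechet_derivative \<phi> (at x) v = grad \<phi> x \<bullet> v"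
  using frechet_derivative_eqI[OF has_derivative_grad] by metis

lemma smooth_continuous: "smooth \<phi> \<Longrightarrow> continuous_on S \<phi>"
  using continuous_on_subset[of UNIV \<phi> S] by (metis continuously_differentiable.simps(1) subset_UNIV)

lemma continuous_grad:
  assumes "smooth \<phi>"
  shows "continuous_on S (grad \<phi>)"
proof -
  have "continuous_on UNIV (\<lambda>x. frechet_derivative \<phi> (at x) i)" for i
    using assms continuously_differentiable_SucE(2)[of 0] by fastforce
  then have "continuous_on UNIV (grad \<phi>)"
    unfolding grad_def[abs_def] by (intro continuous_intros)
  then show ?thesis using continuous_on_subset by blast
qed

lemma grad_add: "smooth \<phi> \<Longrightarrow> smooth \<psi> \<Longrightarrow> grad (\<lambda>x. \<phi> x + \<psi> x) x = grad \<phi> x + grad \<psi> x"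
  using has_derivative_add[OF has_derivative_grad[of \<phi> x] has_derivative_grad[of \<psi> x]]
  by (intro grad_eqI) (simp add: inner_add_left)

lemma grad_mult: "smooth \<phi> \<Longrightarrow> smooth \<psi> \<Longrightarrow>
    grad (\<lambda>x. \<phi> x * \<psi> x) x = \<phi> x *\<^sub>R grad \<psi> x + \<psi> x *\<^sub>R grad \<phi> x"
  using has_derivative_mult[OF has_derivative_grad[of \<phi> x] has_derivative_grad[of \<psi> x]]
  by (intro grad_eqI) (simp add: inner_add_left mult.commute)

lemma grad_scale: "smooth \<phi> \<Longrightarrow> grad (\<lambda>x. c * \<phi> x) x = c *\<^sub>R grad \<phi> x"
  using has_derivative_mult_right[OF has_derivative_grad[of \<phi> x], of c]
  by (intro grad_eqI) simp

lemma grad_compose: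
  fixes G :: "real \<Rightarrow> real"
  assumes "smooth \<phi>" and "\<And>s. (G has_real_derivative G' s) (at s)"
  shows "grad (\<lambda>x. G (\<phi> x)) x = G' (\<phi> x) *\<^sub>R grad \<phi> x"
  using has_derivative_compose[OF has_derivative_grad[OF assms(1)]
      assms(2)[unfolded has_field_derivative_def]]
  by (intro grad_eqI) (simp add: mult.commute)

lemma test_functions_smooth: "\<phi> \<in> test_functions \<Omega> \<Longrightarrow> smooth \<phi>"
  by (simp add: test_functions_def)

lemma test_functionsI:
  assumes "smooth \<psi>" "compact K" "K \<subseteq> \<Omega>" "\<And>x. x \<notin> K \<Longrightarrow> \<psi> x = 0"
  shows "\<psi> \<in> test_functions \<Omega>"
proof -
  have "closure {x. \<psi> x \<noteq> 0} \<subseteq> K"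
    using assms by (intro closure_minimal) (auto intro: compact_imp_closed)
  moreover have "compact (closure {x. \<psi> x \<noteq> 0})"
    using calculation assms(2) by (metis closed_closure compact_Int_closed inf.absorb_iff2)
  ultimately show ?thesis
    using assms by (auto simp: test_functions_def)
qed

lemma test_functions_support:
  assumes "\<phi> \<in> test_functions \<Omega>"
  obtains K where "compact K" "K \<subseteq> \<Omega>" "\<And>x. x \<notin> K \<Longrightarrow> \<phi> x = 0" "\<And>x. x \<notin> K \<Longrightarrow> grad \<phi> x = 0"
proof
  let ?K = "closure {x. \<phi> x \<noteq> 0}"
  show "compact ?K" "?K \<subseteq> \<Omega>" using assms by (auto simp: test_functions_def)
  show z: "\<phi> x = 0" if "x \<notin> ?K" for x using that closure_subset[of "{x. \<phi> x \<noteq> 0}"] by blast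
  show "grad \<phi> x = 0" if "x \<notin> ?K" for x
  proof -
    have "((\<lambda>y. 0::real) has_derivative (\<lambda>v. 0 \<bullet> v)) (at x)" by simp
    moreover have "open (- ?K)" by (rule open_Compl[OF closed_closure])
    moreover have "x \<in> - ?K" using that by simp
    ultimately have "(\<phi> has_derivative (\<lambda>v. 0 \<bullet> v)) (at x)"
      by (rule has_derivative_transform_within_open) (rule z[symmetric], erule ComplD)
    then show ?thesis by (rule grad_eqI)
  qed
qed

lemma test_functions_outside:
  assumes "\<phi> \<in> test_functions \<Omega>" "x \<notin> \<Omega>"
  shows "\<phi> x = 0" and "grad \<phi> x = 0"
proof -
  obtain K where K: "compact K" "K \<subseteq> \<Omega>"
      "\<And>x. x \<notin> K \<Longrightarrow> \<phi> x = 0" "\<And>x. x \<notin> K \<Longrightarrow> grad \<phi> x = 0"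
    by (rule test_functions_support[OF assms(1)], rule that)
  have "x \<notin> K" using K(2) assms(2) by auto
  show "\<phi> x = 0" using \<open>x \<notin> K\<close> by (rule K(3))
  show "grad \<phi> x = 0" using \<open>x \<notin> K\<close> by (rule K(4))
qed

lemma test_functions_add:
  assumes "\<phi> \<in> test_functions \<Omega>" "\<psi> \<in> test_functions \<Omega>"
  shows "(\<lambda>x. \<phi> x + \<psi> x) \<in> test_functions \<Omega>"
proof -
  obtain K where K: "compact K" "K \<subseteq> \<Omega>" "\<And>x. x \<notin> K \<Longrightarrow> \<phi> x = 0"
    using test_functions_support[OF assms(1)] by metis
  obtain L where L: "compact L" "L \<subseteq> \<Omega>" "\<And>x. x \<notin> L \<Longrightarrow> \<psi> x = 0"
    using test_functions_support[OF assms(2)] by metis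
  show ?thesis
    by (rule test_functionsI[of _ "K \<union> L"])
       (use K L assms in \<open>auto intro!: continuously_differentiable_add simp: test_functions_def\<close>)
qed

lemma test_functions_mult:
  assumes "\<phi> \<in> test_functions \<Omega>" "smooth \<psi>"
  shows "(\<lambda>x. \<phi> x * \<psi> x) \<in> test_functions \<Omega>"
proof -
  obtain K where K: "compact K" "K \<subseteq> \<Omega>" "\<And>x. x \<notin> K \<Longrightarrow> \<phi> x = 0"
    using test_functions_support[OF assms(1)] by metis
  show ?thesis
    by (rule test_functionsI[of _ K])
       (use K assms in \<open>auto intro!: continuously_differentiable_mult simp: test_functions_def\<close>)
qed

lemma test_functions_scale:
  assumes "\<phi> \<in> test_functions \<Omega>"
  shows "(\<lambda>x. c * \<phi> x) \<in> test_functions \<Omega>"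
  using test_functions_mult[OF assms, of "\<lambda>x. c"]
  by (simp add: continuously_differentiable_const mult.commute)

lemma test_functions_compose:
  fixes G :: "real \<Rightarrow> real"
  assumes "\<phi> \<in> test_functions \<Omega>" "smooth G" "G 0 = 0"
  shows "(\<lambda>x. G (\<phi> x)) \<in> test_functions \<Omega>"
proof -
  obtain K where K: "compact K" "K \<subseteq> \<Omega>" "\<And>x. x \<notin> K \<Longrightarrow> \<phi> x = 0"
    using test_functions_support[OF assms(1)] by metis
  show ?thesis
  proof (rule test_functionsI)
    show "compact K" "K \<subseteq> \<Omega>" by fact+
    show "smooth (\<lambda>x. G (\<phi> x))"
      by (intro allI continuously_differentiable_compose[OF assms(2)[rule_format]]
          test_functions_smooth[OF assms(1), rule_format])
    show "G (\<phi> x) = 0" if "x \<notin> K" for x using K(3)[OF that] assms(3) by simp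
  qed
qed

lemma test_functions_bounded:
  assumes "\<phi> \<in> test_functions \<Omega>"
  obtains B where "\<And>x. \<bar>\<phi> x\<bar> \<le> B" "\<And>x. norm (grad \<phi> x) \<le> B" "0 < B"
proof -
  obtain K where K: "compact K" "K \<subseteq> \<Omega>" "\<And>x. x \<notin> K \<Longrightarrow> \<phi> x = 0" "\<And>x. x \<notin> K \<Longrightarrow> grad \<phi> x = 0"
    using test_functions_support[OF assms] by metis
  note s = test_functions_smooth[OF assms]
  obtain A where A: "\<And>x. x \<in> K \<Longrightarrow> norm (\<phi> x) \<le> A"
    using compact_imp_bounded[OF compact_continuous_image[OF smooth_continuous[OF s] K(1)]]
    by (auto simp: bounded_iff)
  obtain C where C: "\<And>x. x \<in> K \<Longrightarrow> norm (grad \<phi> x) \<le> C"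
    using compact_imp_bounded[OF compact_continuous_image[OF continuous_grad[OF s] K(1)]]
    by (auto simp: bounded_iff)
  show ?thesis
  proof
    show "\<bar>\<phi> x\<bar> \<le> \<bar>A\<bar> + \<bar>C\<bar> + 1" "norm (grad \<phi> x) \<le> \<bar>A\<bar> + \<bar>C\<bar> + 1" for x
      using A[of x] C[of x] K(3,4)[of x] by (cases "x \<in> K"; force)+
  qed simp
qed

lemma ball_bump_test_function:
  assumes "cball x0 r \<subseteq> \<Omega>" "r > 0"
  shows "ball_bump x0 r \<in> test_functions \<Omega>"
proof (rule test_functionsI[OF smooth_ball_bump _ assms(1)])
  show "ball_bump x0 r x = 0" if "x \<notin> cball x0 r" for x
    using that ball_bump_pos_iff[OF assms(2), of x0 x] ball_bump_nonneg[of x0 r x] by auto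
qed simp

lemma exp_neg_mult_powr_le:
  fixes a y :: real
  assumes "a > 0" "y > 0"
  shows "exp (- y) * y powr a \<le> a powr a"
proof -
  have "y / a \<le> exp (y / a)" using exp_ge_add_one_self[of "y / a"] by linarith
  then have "(y / a) powr a \<le> exp (y / a) powr a" using assms by (intro powr_mono2) auto
  also have "\<dots> = exp y" using assms by (simp add: powr_def)
  finally have "y powr a \<le> a powr a * exp y" using assms by (simp add: powr_divide field_simps)
  then show ?thesis by (simp add: exp_minus field_simps)
qed

text \<open>The logarithmic estimate needs a cutoff whose gradient is controlled by the cutoff itself, a
  property that \<open>p\<close>-th powers of nonnegative functions have. The bump has it because \<open>exp (-1/s)\<close>
  beats every power of \<open>1/s\<close>.\<close>

lemma ball_bump_grad_bound:
  assumes "r > 0" "p > 1"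
  obtains K where "0 \<le> K"
    "\<And>x. norm (grad (ball_bump x0 r) x) powr p \<le> K * ball_bump x0 r x powr (p - 1)"
proof
  let ?K = "(2 * r) powr p * (2 * p) powr (2 * p)"
  show "0 \<le> ?K" by simp
  fix x
  define s where "s = r\<^sup>2 - (x - x0) \<bullet> (x - x0)"
  have d: "((\<lambda>x. r\<^sup>2 - (x - x0) \<bullet> (x - x0)) has_derivative (\<lambda>v. ((- 2) *\<^sub>R (x - x0)) \<bullet> v)) (at x)"
    by (rule derivative_eq_intros refl | simp add: inner_commute inner_diff_left)+
  have d': "(flat 0 has_derivative (\<lambda>t. flat 2 s * t)) (at s)"
    using has_derivative_flat[of 0 s]
    by (simp add: has_field_derivative_def numeral_2_eq_2)
  have g: "grad (ball_bump x0 r) x = (- 2 * flat 2 s) *\<^sub>R (x - x0)"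
    using has_derivative_compose[OF d d'[unfolded s_def]]
    by (intro grad_eqI) (simp add: ball_bump_def[abs_def] s_def algebra_simps)
  show "norm (grad (ball_bump x0 r) x) powr p \<le> ?K * ball_bump x0 r x powr (p - 1)"
  proof (cases "s > 0")
    case False
    then have "flat 2 s = 0" by (simp add: flat_def)
    then show ?thesis using g by simp
  next
    case True
    then have "(norm (x - x0))\<^sup>2 \<le> r\<^sup>2" by (simp add: s_def power2_norm_eq_inner)
    then have n: "norm (x - x0) \<le> r" using assms(1) power2_le_imp_le by fastforce
    define b where "b = exp (- 1 / s)"
    have b: "ball_bump x0 r x = b" "flat 2 s = b / s\<^sup>2" "b > 0"
      using True by (auto simp: ball_bump_def flat_def s_def b_def)
    have "norm (grad (ball_bump x0 r) x) = 2 * norm (x - x0) * (b * (1 / s)\<^sup>2)"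
      using b by (simp add: g abs_mult power_divide)
    also have "\<dots> \<le> 2 * r * (b * (1 / s)\<^sup>2)"
      using n b by (intro mult_right_mono) auto
    finally have "norm (grad (ball_bump x0 r) x) powr p \<le> (2 * r * (b * (1 / s)\<^sup>2)) powr p"
      using assms by (intro powr_mono2) auto
    also have "\<dots> = (2 * r) powr p * (b powr (p - 1) * (b * (1 / s) powr (2 * p)))"
    proof -
      have "((1 / s)\<^sup>2) powr p = (1 / s) powr (2 * p)"
        using True by (simp add: powr_powr flip: powr_numeral)
      moreover have "b powr p = b powr (p - 1) * b" using b(3) by (simp add: powr_diff)
      ultimately show ?thesis
        using assms b True by (simp add: powr_mult mult.assoc)
    qed
    also have "\<dots> \<le> (2 * r) powr p * (b powr (p - 1) * (2 * p) powr (2 * p))"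
      using exp_neg_mult_powr_le[of "2 * p" "1 / s"] assms True
      by (intro mult_left_mono) (auto simp: b_def)
    finally show ?thesis using b by (simp add: mult_ac)
  qed
qed

section \<open>Integration by parts\<close>

lemma integral_lebesgue_on_eq_lborel:
  fixes f :: "'a::euclidean_space \<Rightarrow> real"
  assumes "\<Omega> \<in> sets lebesgue" "f \<in> borel_measurable borel" "\<And>x. x \<notin> \<Omega> \<Longrightarrow> f x = 0"
  shows "(\<integral>x. f x \<partial>lebesgue_on \<Omega>) = (\<integral>x. f x \<partial>lborel)"
proof -
  have "(\<integral>x. f x \<partial>lebesgue_on \<Omega>) = (\<integral>x. indicator \<Omega> x *\<^sub>R f x \<partial>lebesgue)"
    using assms(1) by (intro integral_restrict_space) auto
  also have "\<dots> = (\<integral>x. f x \<partial>lebesgue)"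
    by (rule Bochner_Integration.integral_cong) (use assms(3) in \<open>auto simp: indicator_def\<close>)
  also have "\<dots> = (\<integral>x. f x \<partial>lborel)" using assms(2) by (intro integral_completion) simp
  finally show ?thesis .
qed

text \<open>The integral of \<open>\<theta>\<close> is invariant under translation, so its difference quotients integrate
  to zero; they converge boundedly to the derivative.\<close>

lemma integral_grad_eq_0:
  assumes "\<theta> \<in> test_functions UNIV"
  shows "(\<integral>x. grad \<theta> x \<bullet> i \<partial>lborel) = 0"
proof -
  obtain K where K: "compact K" "\<And>x. x \<notin> K \<Longrightarrow> \<theta> x = 0"
    using test_functions_support[OF assms] by metis
  obtain B where B: "\<And>x. \<bar>\<theta> x\<bar> \<le> B" "\<And>x. norm (grad \<theta> x) \<le> B" "0 < B"
    using test_functions_bounded[OF assms] by metis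
  note s = test_functions_smooth[OF assms]
  have [measurable]: "\<theta> \<in> borel_measurable borel" "grad \<theta> \<in> borel_measurable borel"
    using smooth_continuous[OF s] continuous_grad[OF s] borel_measurable_continuous_onI by blast+
  have lip: "\<bar>\<theta> y - \<theta> x\<bar> \<le> B * norm (y - x)" for x y
  proof -
    have "norm (\<theta> y - \<theta> x) \<le> B * norm (y - x)"
    proof (rule differentiable_bound[OF convex_UNIV])
      show "(\<theta> has_derivative (\<lambda>v. grad \<theta> z \<bullet> v)) (at z within UNIV)" for z
        using has_derivative_grad[OF s] by simp
      show "onorm (\<lambda>v. grad \<theta> z \<bullet> v) \<le> B" for z
      proof (rule onorm_le)
        fix v
        have "\<bar>grad \<theta> z \<bullet> v\<bar> \<le> norm (grad \<theta> z) * norm v" by (rule Cauchy_Schwarz_ineq2)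
        also have "\<dots> \<le> B * norm v" using B(2)[of z] by (rule mult_right_mono) simp
        finally show "norm (grad \<theta> z \<bullet> v) \<le> B * norm v" by simp
      qed
    qed auto
    then show ?thesis by simp
  qed
  obtain R where "\<forall>x\<in>K. norm x \<le> R"
    using compact_imp_bounded[OF K(1)] bounded_iff by metis
  then have R: "K \<subseteq> cball 0 R" by auto
  have supp: "\<theta> x = 0" if "x \<notin> cball 0 R" for x using that R K(2) by blast
  have int: "integrable lborel \<theta>"
  proof (rule integrableI_bounded_set[where A = "cball 0 R" and B = B])
    show "emeasure lborel (cball (0::'a) R) < \<infinity>" by (rule emeasure_bounded_finite) simp
  qed (use B supp in \<open>auto intro!: AE_I2\<close>)
  define h where "h n = inverse (real (Suc n))" for n
  have h: "0 < h n" "h n \<le> 1" for n by (auto simp: h_def field_simps)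
  have h0: "h \<longlonglongrightarrow> 0" unfolding h_def by (rule LIMSEQ_inverse_real_of_nat)
  have int2: "integrable lborel (\<lambda>x. \<theta> (x + h n *\<^sub>R i))" for n
  proof -
    have "integrable (distr lborel borel (\<lambda>x. h n *\<^sub>R i + x)) \<theta>"
      using int lborel_distr_plus[of "h n *\<^sub>R i"] by simp
    then show ?thesis by (subst (asm) integrable_distr_eq) (auto simp: add.commute)
  qed
  have eq: "(\<integral>x. \<theta> (x + h n *\<^sub>R i) \<partial>lborel) = (\<integral>x. \<theta> x \<partial>lborel)" for n
  proof -
    have "(\<integral>x. \<theta> x \<partial>lborel) = (\<integral>x. \<theta> x \<partial>(distr lborel borel (\<lambda>x. h n *\<^sub>R i + x)))"
      using lborel_distr_plus[of "h n *\<^sub>R i"] by simp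
    also have "\<dots> = (\<integral>x. \<theta> (x + h n *\<^sub>R i) \<partial>lborel)"
      by (subst integral_distr) (auto simp: add.commute)
    finally show ?thesis ..
  qed
  have z: "(\<integral>x. (\<theta> (x + h n *\<^sub>R i) - \<theta> x) / h n \<partial>lborel) = 0" for n
    using int int2[of n] eq[of n] by (simp add: Bochner_Integration.integral_diff)
  let ?w = "\<lambda>x::'a. B * norm i * indicator (cball 0 (R + norm i)) x"
  have "(\<lambda>n. \<integral>x. (\<theta> (x + h n *\<^sub>R i) - \<theta> x) / h n \<partial>lborel) \<longlonglongrightarrow> (\<integral>x. grad \<theta> x \<bullet> i \<partial>lborel)"
  proof (rule integral_dominated_convergence[where w = ?w])
    show "integrable lborel ?w"
      by (intro integrable_mult_right integrable_real_indicator)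
         (use emeasure_bounded_finite[OF bounded_cball] in auto)
    show "AE x in lborel. (\<lambda>n. (\<theta> (x + h n *\<^sub>R i) - \<theta> x) / h n) \<longlonglongrightarrow> grad \<theta> x \<bullet> i"
    proof (rule AE_I2)
      fix x
      have l: "((\<lambda>t. x + t *\<^sub>R i) has_derivative (\<lambda>t. t *\<^sub>R i)) (at (0::real))"
        by (auto intro!: derivative_eq_intros)
      have "((\<lambda>t. \<theta> (x + t *\<^sub>R i)) has_derivative (\<lambda>t. (grad \<theta> x \<bullet> i) * t)) (at 0)"
        using has_derivative_compose[OF l, of \<theta> "\<lambda>v. grad \<theta> x \<bullet> v"] has_derivative_grad[OF s, of x]
        by (simp add: mult.commute)
      then have "((\<lambda>t. (\<theta> (x + t *\<^sub>R i) - \<theta> x) / t) \<longlongrightarrow> grad \<theta> x \<bullet> i) (at 0)"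
        by (simp add: has_field_derivative_def[symmetric] DERIV_def)
      moreover have "filterlim h (at 0) sequentially"
        unfolding filterlim_at using h0 h(1) by (auto intro!: always_eventually simp: less_imp_neq[symmetric])
      ultimately show "(\<lambda>n. (\<theta> (x + h n *\<^sub>R i) - \<theta> x) / h n) \<longlonglongrightarrow> grad \<theta> x \<bullet> i"
        by (rule filterlim_compose)
    qed
    show "AE x in lborel. norm ((\<theta> (x + h n *\<^sub>R i) - \<theta> x) / h n) \<le> ?w x" for n
    proof (rule AE_I2)
      fix x
      show "norm ((\<theta> (x + h n *\<^sub>R i) - \<theta> x) / h n) \<le> ?w x"
      proof (cases "x \<in> cball 0 (R + norm i)")
        case True
        have "\<bar>\<theta> (x + h n *\<^sub>R i) - \<theta> x\<bar> \<le> B * (h n * norm i)"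
          using lip[of "x + h n *\<^sub>R i" x] h(1)[of n] by simp
        then show ?thesis using True h(1)[of n] by (simp add: field_simps)
      next
        case False
        have "norm (h n *\<^sub>R i) \<le> norm i" using h[of n] by (simp add: mult_left_le_one_le)
        then have "x + h n *\<^sub>R i \<notin> cball 0 R"
          using False norm_triangle_ineq2[of x "- (h n *\<^sub>R i)"] by auto
        moreover have "x \<notin> cball 0 R"
          using False norm_ge_zero[of i] unfolding mem_cball dist_0_norm by linarith
        ultimately show ?thesis using supp False by simp
      qed
    qed
  qed auto
  then show ?thesis unfolding z by (simp add: LIMSEQ_const_iff)
qed

section \<open>Weak gradients\<close>

lemma AE_lebesgue_on_iff:
  "\<Omega> \<in> sets lebesgue \<Longrightarrow> (AE x in lebesgue_on \<Omega>. P x) \<longleftrightarrow> (AE x in lebesgue. x \<in> \<Omega> \<longrightarrow> P x)"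
  by (simp add: AE_restrict_space_iff)

text \<open>By the Lindelof property, countably many of the balls cover \<open>\<Omega>\<close>.\<close>

lemma AE_locally:
  fixes \<Omega> :: "'a::euclidean_space set"
  assumes "\<And>x. x \<in> \<Omega> \<Longrightarrow> \<exists>r>0. AE y in lebesgue. y \<in> ball x r \<longrightarrow> P y"
  shows "AE y in lebesgue. y \<in> \<Omega> \<longrightarrow> P y"
proof -
  obtain r where r: "\<And>x. x \<in> \<Omega> \<Longrightarrow> 0 < r x"
      "\<And>x. x \<in> \<Omega> \<Longrightarrow> AE y in lebesgue. y \<in> ball x (r x) \<longrightarrow> P y"
    using assms by metis
  obtain F where F: "F \<subseteq> (\<lambda>x. ball x (r x)) ` \<Omega>" "countable F" "\<Union>F = \<Union>((\<lambda>x. ball x (r x)) ` \<Omega>)"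
    using Lindelof[of "(\<lambda>x. ball x (r x)) ` \<Omega>"] by auto
  have "AE y in lebesgue. \<forall>B\<in>F. y \<in> B \<longrightarrow> P y"
    using F r(2) by (subst AE_ball_countable) auto
  moreover have "\<Omega> \<subseteq> \<Union>F" using F(3) r(1) by fastforce
  ultimately show ?thesis by (elim AE_mp) (intro AE_I2, blast)
qed

lemma continuous_measurable_lebesgue_on:
  fixes f :: "'a::euclidean_space \<Rightarrow> 'b::euclidean_space"
  assumes "continuous_on UNIV f"
  shows "f \<in> borel_measurable (lebesgue_on S)"
  using borel_measurable_continuous_onI[OF assms]
  by (intro measurable_restrict_space1 measurable_completion) simp

lemma integrable_lebesgue_on_cong_set:
  fixes f :: "'a::euclidean_space \<Rightarrow> 'b::euclidean_space"
  assumes "K \<subseteq> S" "\<And>x. x \<in> S - K \<Longrightarrow> f x = 0" "K \<in> sets lebesgue" "S \<in> sets lebesgue"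
    "integrable (lebesgue_on K) f"
  shows "integrable (lebesgue_on S) f"
proof -
  have "(\<lambda>x. if x \<in> S then f x else 0) = (\<lambda>x. if x \<in> K then f x else 0)"
    using assms(1,2) by (intro ext) auto
  then show ?thesis
    using assms(3-5) Lebesgue_Measure.integrable_restrict_UNIV[of K f] Lebesgue_Measure.integrable_restrict_UNIV[of S f] by simp
qed

lemma locally_integrable_mult:
  fixes g :: "'a::euclidean_space \<Rightarrow> real"
  assumes "locally_integrable \<Omega> g" "open \<Omega>" "compact K" "K \<subseteq> \<Omega>"
    "continuous_on UNIV \<phi>" "\<And>x. x \<notin> K \<Longrightarrow> \<phi> x = 0"
  shows "integrable (lebesgue_on \<Omega>) (\<lambda>x. g x * \<phi> x)"
proof (rule integrable_lebesgue_on_cong_set)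
  obtain B where B: "\<And>x. x \<in> K \<Longrightarrow> norm (\<phi> x) \<le> B"
    using compact_imp_bounded[OF compact_continuous_image[OF continuous_on_subset[OF assms(5)] assms(3)]]
    by (auto simp: bounded_iff)
  have i: "integrable (lebesgue_on K) g"
    using assms(1,3,4) by (auto simp: locally_integrable_def)
  show "integrable (lebesgue_on K) (\<lambda>x. g x * \<phi> x)"
  proof (rule Bochner_Integration.integrable_bound)
    show "integrable (lebesgue_on K) (\<lambda>x. B * g x)" using i by simp
    show "(\<lambda>x. g x * \<phi> x) \<in> borel_measurable (lebesgue_on K)"
      using i continuous_measurable_lebesgue_on[OF assms(5)] by auto
    show "AE x in lebesgue_on K. norm (g x * \<phi> x) \<le> norm (B * g x)"
    proof (rule AE_I2)
      fix x assume "x \<in> space (lebesgue_on K)"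
      then have "\<bar>\<phi> x\<bar> \<le> \<bar>B\<bar>" using B[of x] by simp
      then show "norm (g x * \<phi> x) \<le> norm (B * g x)"
        by (simp add: abs_mult mult.commute mult_right_mono)
    qed
  qed
qed (use assms fmeasurableD[OF lmeasurable_compact] in auto)

text \<open>A box is the positivity set of a product of one-dimensional bumps, so that its indicator is a
  bounded limit of smooth functions; boxes generate the Borel sets.\<close>

lemma box_smooth:
  fixes a b :: "'a::euclidean_space"
  obtains Q where "smooth Q" "\<And>x. Q x \<ge> 0" "\<And>x. Q x > 0 \<longleftrightarrow> x \<in> box a b"
proof
  let ?q = "\<lambda>i x. flat 0 ((x - a) \<bullet> i) * flat 0 ((b - x) \<bullet> i)"
  let ?Q = "\<lambda>x. \<Prod>i\<in>Basis. ?q i x"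
  have "continuously_differentiable k (\<lambda>x. (x - a) \<bullet> i)" for k i
    using continuously_differentiable_add[OF
        continuously_differentiable_bounded_linear[OF bounded_linear_inner_left[of i]]
        continuously_differentiable_const[of k "- (a \<bullet> i)"]]
    by (simp add: inner_diff_left)
  moreover have "continuously_differentiable k (\<lambda>x. (b - x) \<bullet> i)" for k i
    using continuously_differentiable_add[OF
        continuously_differentiable_bounded_linear[OF
          bounded_linear_minus[OF bounded_linear_inner_left[of i]]]
        continuously_differentiable_const[of k "b \<bullet> i"]]
    by (simp add: inner_diff_left)
  ultimately have q: "continuously_differentiable k (?q i)" for k i
    by (intro continuously_differentiable_mult
        continuously_differentiable_compose[OF smooth_flat[rule_format]])
  have "continuously_differentiable k (\<lambda>x. \<Prod>i\<in>B. ?q i x)" if "finite B" for B k using that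
  proof (induction B)
    case (insert i B)
    show ?case unfolding prod.insert[OF insert(1,2)]
      by (intro continuously_differentiable_mult[OF q insert.IH])
  qed (simp add: continuously_differentiable_const)
  then show "smooth ?Q" by simp
  have fl: "flat 0 s \<ge> 0" "flat 0 s > 0 \<longleftrightarrow> s > 0" for s by (auto simp: flat_def)
  show "?Q x \<ge> 0" for x by (intro prod_nonneg) (auto simp: fl)
  show "?Q x > 0 \<longleftrightarrow> x \<in> box a b" for x
  proof
    assume "?Q x > 0"
    then have "?q i x \<noteq> 0" if "i \<in> Basis" for i
      using that by (metis (no_types, lifting) finite_Basis less_irrefl prod_zero)
    then have "0 < (x - a) \<bullet> i \<and> 0 < (b - x) \<bullet> i" if "i \<in> Basis" for i
      using that fl by (fastforce simp: order_less_le)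
    then show "x \<in> box a b" by (auto simp: mem_box inner_diff_left)
  next
    assume "x \<in> box a b"
    then show "?Q x > 0" by (intro prod_pos) (auto simp: mem_box inner_diff_left fl)
  qed
qed

text \<open>Boxes are closed under intersection and generate the Borel sets, and the sets on which \<open>H\<close> has integral
  zero are closed under complements and countable disjoint unions.\<close>

lemma integral_zero_on_boxes_imp_AE_zero:
  fixes H :: "'a::euclidean_space \<Rightarrow> real"
  assumes H: "integrable lborel H" and z: "\<And>a b. (\<integral>x. indicator (box a b) x * H x \<partial>lborel) = 0"
  shows "AE x in lborel. H x = 0"
proof -
  have [measurable]: "H \<in> borel_measurable borel" using H by simp
  have ind: "integrable lborel (\<lambda>x. indicator A x * H x)" if "A \<in> sets borel" for A
    using integrable_mult_indicator[of A lborel H] that H by simp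
  let ?E = "range (\<lambda>(a, b). box a b) :: 'a set set"
  have stable: "Int_stable ?E"
    by (auto simp: Int_stable_def box_Int_box)
  have univ: "(\<integral>x. H x \<partial>lborel) = 0"
  proof -
    have "(\<lambda>n. \<integral>x. indicator (box (- (real n *\<^sub>R One)) (real n *\<^sub>R One)) x * H x \<partial>lborel)
        \<longlonglongrightarrow> (\<integral>x. H x \<partial>lborel)"
    proof (rule integral_dominated_convergence[where w = "\<lambda>x. norm (H x)"])
      show "AE x in lborel. (\<lambda>n. indicator (box (- (real n *\<^sub>R One)) (real n *\<^sub>R One)) x * H x)
          \<longlonglongrightarrow> H x"
      proof (rule AE_I2)
        fix x :: 'a
        have "\<exists>n. x \<in> box (- (real n *\<^sub>R One)) (real n *\<^sub>R One)"
          using UN_box_eq_UNIV by blast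
        then obtain n where n: "x \<in> box (- (real n *\<^sub>R One)) (real n *\<^sub>R One)" ..
        have "x \<in> box (- (real k *\<^sub>R One)) (real k *\<^sub>R One)" if "k \<ge> n" for k
          using n that by (auto simp: mem_box)
        then show "(\<lambda>n. indicator (box (- (real n *\<^sub>R One)) (real n *\<^sub>R One)) x * H x) \<longlonglongrightarrow> H x"
          by (intro tendsto_eventually) (auto simp: eventually_sequentially intro!: exI[of _ n])
      qed
    qed (use H in \<open>auto simp: indicator_def\<close>)
    then show ?thesis using z by (simp add: LIMSEQ_const_iff)
  qed
  have "(\<integral>x. indicator A x * H x \<partial>lborel) = 0" if "A \<in> sigma_sets UNIV ?E" for A
  proof (rule sigma_sets_induct_disjoint[OF stable _ that, of "\<lambda>A. (\<integral>x. indicator A x * H x \<partial>lborel) = 0"])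
    have sb: "sigma_sets UNIV ?E = sets borel"
      by (simp add: borel_eq_box)
    show "(\<integral>x. indicator (UNIV - A) x * H x \<partial>lborel) = 0"
      if "A \<in> sigma_sets UNIV ?E" "(\<integral>x. indicator A x * H x \<partial>lborel) = 0" for A
    proof -
      have "A \<in> sets borel" using that sb by simp
      have "(\<integral>x. indicator (UNIV - A) x * H x \<partial>lborel) = (\<integral>x. H x - indicator A x * H x \<partial>lborel)"
        by (rule Bochner_Integration.integral_cong) (auto simp: indicator_def)
      also have "\<dots> = 0"
        using that univ H ind[OF \<open>A \<in> sets borel\<close>] by (simp add: Bochner_Integration.integral_diff)
      finally show ?thesis .
    qed
    show "(\<integral>x. indicator (\<Union>i. A i) x * H x \<partial>lborel) = 0"
      if d: "disjoint_family A" and m: "range A \<subseteq> sigma_sets UNIV ?E"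
        and z: "\<And>i. (\<integral>x. indicator (A i) x * H x \<partial>lborel) = 0" for A :: "nat \<Rightarrow> 'a set"
    proof -
      have A: "A i \<in> sets lborel" for i using m sb by auto
      have "set_integrable lborel (\<Union>i. A i) H"
        using ind[of "\<Union>i. A i"] A by (auto simp: set_integrable_def)
      then have "set_lebesgue_integral lborel (\<Union>i. A i) H = (\<Sum>i. set_lebesgue_integral lborel (A i) H)"
        using A d by (intro lebesgue_integral_countable_add) (auto simp: disjoint_family_on_def)
      then show ?thesis using z by (simp add: set_lebesgue_integral_def)
    qed
  qed (use z in auto)
  then have "(\<integral>x. indicator A x * H x \<partial>lborel) = 0" if "A \<in> sets lborel" for A
    using that by (simp add: borel_eq_box)
  then show ?thesis
    using density_unique_real[of lborel H "\<lambda>x. 0"] H by (simp add: set_lebesgue_integral_def)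
qed

text \<open>Multiplied by a bump, \<open>h\<close> becomes integrable on the whole space, and the bump times a smooth
  approximation of the indicator of a box is an admissible test function.\<close>

lemma fundamental_lemma:
  fixes h :: "'a::euclidean_space \<Rightarrow> real"
  assumes \<Omega>: "open \<Omega>" and h: "locally_integrable \<Omega> h"
    and z: "\<And>\<phi>. \<phi> \<in> test_functions \<Omega> \<Longrightarrow> (\<integral>x. h x * \<phi> x \<partial>lebesgue_on \<Omega>) = 0"
  shows "AE x in lebesgue_on \<Omega>. h x = 0"
proof -
  have S: "\<Omega> \<in> sets lebesgue" using \<Omega> by simp
  have "\<exists>r>0. AE y in lebesgue. y \<in> ball x0 r \<longrightarrow> h y = 0" if x0: "x0 \<in> \<Omega>" for x0
  proof -
    obtain r where r: "r > 0" "cball x0 r \<subseteq> \<Omega>" using \<Omega> x0 open_contains_cball by blast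
    let ?P = "ball_bump x0 r"
    let ?H = "\<lambda>x. if x \<in> \<Omega> then h x * ?P x else 0"
    have P: "?P \<in> test_functions \<Omega>" using ball_bump_test_function r by blast
    have i: "integrable (lebesgue_on \<Omega>) (\<lambda>x. h x * ?P x)"
    proof (rule locally_integrable_mult[OF h \<Omega> compact_cball r(2)])
      show "?P x = 0" if "x \<notin> cball x0 r" for x
        using that ball_bump_pos_iff[OF r(1), of x0 x] ball_bump_nonneg[of x0 r x] by auto
    qed (rule smooth_continuous[OF smooth_ball_bump])
    then have iH: "integrable lebesgue ?H" using Lebesgue_Measure.integrable_restrict_UNIV[OF S, of "\<lambda>x. h x * ?P x"] by simp
    obtain H where H: "H \<in> borel_measurable lborel" "AE x in lborel. ?H x = H x"
      using completion_ex_borel_measurable_real[of ?H lborel] iH by blast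
    have AH: "AE x in lebesgue. ?H x = H x" using H(2) by (rule AE_completion)
    have Hl: "H \<in> borel_measurable lebesgue" using H(1) by (rule measurable_completion)
    have "integrable lebesgue H" by (rule integrable_cong_AE_imp[OF iH Hl AH])
    then have intH: "integrable lborel H" using H(1) integrable_completion by blast
    have "(\<integral>x. indicator (box a b) x * H x \<partial>lborel) = 0" for a b
    proof -
      obtain Q where Q: "smooth Q" "\<And>x. Q x \<ge> 0" "\<And>x. Q x > 0 \<longleftrightarrow> x \<in> box a b"
        using box_smooth by metis
      \<comment> \<open>These functions increase to the indicator of the positivity set of \<open>Q\<close> and are bounded by one.\<close>
      define G where "G n x = 2 * logistic (real n * Q x) + (-1)" for n x
      have smG: "smooth (G n)" for n
        unfolding G_def using Q(1)
        by (intro allI continuously_differentiable_add continuously_differentiable_mult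
            continuously_differentiable_const continuously_differentiable_compose[OF smooth_logistic[rule_format]]) auto
      have G1: "\<bar>G n x\<bar> \<le> 1" for n x
        using logistic_pos[of "real n * Q x"] logistic_less_one[of "real n * Q x"] by (simp add: G_def)
      have lim: "(\<lambda>n. G n x) \<longlonglongrightarrow> indicator (box a b) x" for x
      proof (cases "x \<in> box a b")
        case True
        have "filterlim (\<lambda>n. real n * Q x) at_top sequentially"
          using Q(3) True by (intro filterlim_at_top_mult_tendsto_pos[OF tendsto_const _ filterlim_real_sequentially, of "Q x", simplified mult.commute[of "Q x"]]) auto
        then have "(\<lambda>n. exp (- (real n * Q x))) \<longlonglongrightarrow> 0"
          by (intro filterlim_compose[OF exp_at_bot] filterlim_compose[OF filterlim_uminus_at_bot_at_top])
        then have "(\<lambda>n. G n x) \<longlonglongrightarrow> 2 * (1 / (1 + 0)) + (-1)"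
          unfolding G_def logistic_def by (intro tendsto_intros) auto
        then show ?thesis using True by simp
      next
        case False
        then have "Q x = 0" using Q(2)[of x] Q(3)[of x] by linarith
        then show ?thesis using False by (simp add: G_def logistic_def)
      qed
      have t: "(\<lambda>x. ?P x * G n x) \<in> test_functions \<Omega>" for n
        using P smG by (rule test_functions_mult)
      have mQ: "G n \<in> borel_measurable lborel" for n
        using borel_measurable_continuous_onI[OF smooth_continuous[OF smG]] by simp
      have "(\<integral>x. G n x * H x \<partial>lborel) = 0" for n
      proof -
        have "(\<integral>x. G n x * H x \<partial>lborel) = (\<integral>x. G n x * H x \<partial>lebesgue)"
          using H(1) mQ by (intro integral_completion[symmetric]) simp
        also have "\<dots> = (\<integral>x. (if x \<in> \<Omega> then h x * (?P x * G n x) else 0) \<partial>lebesgue)"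
        proof (rule integral_cong_AE)
          show "(\<lambda>x. G n x * H x) \<in> borel_measurable lebesgue"
            by (rule borel_measurable_times[OF measurable_completion[OF mQ] Hl])
          have "(\<lambda>x. G n x * ?H x) \<in> borel_measurable lebesgue"
            by (rule borel_measurable_times[OF measurable_completion[OF mQ] borel_measurable_integrable[OF iH]])
          then show "(\<lambda>x. if x \<in> \<Omega> then h x * (?P x * G n x) else 0) \<in> borel_measurable lebesgue"
            by (rule back_subst[of "\<lambda>f. f \<in> borel_measurable lebesgue"]) auto
          show "AE x in lebesgue. G n x * H x = (if x \<in> \<Omega> then h x * (?P x * G n x) else 0)"
            using AH by eventually_elim (auto split: if_splits)
        qed
        also have "\<dots> = (\<integral>x. h x * (?P x * G n x) \<partial>lebesgue_on \<Omega>)"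
          using S by (rule Lebesgue_Measure.integral_restrict_UNIV)
        also have "\<dots> = 0" using z[OF t] .
        finally show ?thesis .
      qed
      moreover have "(\<lambda>n. \<integral>x. G n x * H x \<partial>lborel) \<longlonglongrightarrow> (\<integral>x. indicator (box a b) x * H x \<partial>lborel)"
      proof (rule integral_dominated_convergence[where w = "\<lambda>x. norm (H x)"])
        show "AE x in lborel. (\<lambda>n. G n x * H x) \<longlonglongrightarrow> indicator (box a b) x * H x"
          by (intro AE_I2 tendsto_mult lim tendsto_const)
        show "AE x in lborel. norm (G n x * H x) \<le> norm (H x)" for n
          using G1 by (intro AE_I2) (simp add: abs_mult mult_left_le_one_le)
      qed (use H(1) mQ intH in auto)
      ultimately show ?thesis by (simp add: LIMSEQ_const_iff)
    qed
    then have "AE x in lborel. H x = 0" by (rule integral_zero_on_boxes_imp_AE_zero[OF intH])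
    then have "AE x in lebesgue. H x = 0" by (rule AE_completion)
    with AH have "AE y in lebesgue. y \<in> ball x0 r \<longrightarrow> h y = 0"
    proof eventually_elim
      case (elim y)
      show ?case
      proof
        assume y: "y \<in> ball x0 r"
        then have "y \<in> \<Omega>" using r(2) by auto
        moreover have "?P y > 0" using y r(1) ball_bump_pos_iff by blast
        ultimately show "h y = 0" using elim by auto
      qed
    qed
    then show ?thesis using r(1) by blast
  qed
  then have "AE y in lebesgue. y \<in> \<Omega> \<longrightarrow> h y = 0" by (rule AE_locally)
  then show ?thesis using S by (simp add: AE_lebesgue_on_iff)
qed

lemma locally_integrable_inner:
  assumes "locally_integrable \<Omega> g"
  shows "locally_integrable \<Omega> (\<lambda>x. g x \<bullet> i)"
  using assms by (auto simp: locally_integrable_def)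

lemma locally_integrable_diff:
  assumes "locally_integrable \<Omega> g" "locally_integrable \<Omega> h"
  shows "locally_integrable \<Omega> (\<lambda>x. g x - h x)"
  using assms by (auto simp: locally_integrable_def)

lemma weak_gradient_unique:
  assumes \<Omega>: "open \<Omega>" and g: "has_weak_gradient \<Omega> u g" and h: "has_weak_gradient \<Omega> u h"
  shows "AE x in lebesgue_on \<Omega>. g x = h x"
proof -
  have "AE x in lebesgue_on \<Omega>. g x \<bullet> i - h x \<bullet> i = 0" if i: "i \<in> Basis" for i
  proof (rule fundamental_lemma[OF \<Omega>])
    have l: "locally_integrable \<Omega> (\<lambda>x. g x \<bullet> i)" "locally_integrable \<Omega> (\<lambda>x. h x \<bullet> i)"
      using g h by (auto simp: has_weak_gradient_def intro: locally_integrable_inner)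
    then show "locally_integrable \<Omega> (\<lambda>x. g x \<bullet> i - h x \<bullet> i)"
      by (rule locally_integrable_diff)
    fix \<phi> assume \<phi>: "\<phi> \<in> test_functions \<Omega>"
    obtain K where K: "compact K" "K \<subseteq> \<Omega>" "\<And>x. x \<notin> K \<Longrightarrow> \<phi> x = 0" "\<And>x. x \<notin> K \<Longrightarrow> grad \<phi> x = 0"
      by (rule test_functions_support[OF \<phi>], rule that)
    note c = smooth_continuous[OF test_functions_smooth[OF \<phi>], of UNIV]
    have "(\<integral>x. (g x \<bullet> i - h x \<bullet> i) * \<phi> x \<partial>lebesgue_on \<Omega>) =
        (\<integral>x. g x \<bullet> i * \<phi> x \<partial>lebesgue_on \<Omega>) - (\<integral>x. h x \<bullet> i * \<phi> x \<partial>lebesgue_on \<Omega>)"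
      using locally_integrable_mult[OF l(1) \<Omega> K(1,2) c K(3)] locally_integrable_mult[OF l(2) \<Omega> K(1,2) c K(3)]
      by (simp add: left_diff_distrib)
    also have "\<dots> = 0"
    proof -
      have "(\<integral>x. k x \<bullet> i * \<phi> x \<partial>lebesgue_on \<Omega>) =
          - (\<integral>x. u x * frechet_derivative \<phi> (at x) i \<partial>lebesgue_on \<Omega>)"
        if "has_weak_gradient \<Omega> u k" for k
        using that \<phi> i unfolding has_weak_gradient_def by simp
      from this[OF g] this[OF h] show ?thesis by simp
    qed
    finally show "(\<integral>x. (g x \<bullet> i - h x \<bullet> i) * \<phi> x \<partial>lebesgue_on \<Omega>) = 0" .
  qed
  then have "AE x in lebesgue_on \<Omega>. \<forall>i\<in>Basis. g x \<bullet> i - h x \<bullet> i = 0"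
    by (subst AE_ball_countable) (auto simp: countable_finite)
  then show ?thesis by eventually_elim (rule euclidean_eqI, simp)
qed

section \<open>Convergence in $L^p$\<close>

lemma norm_add_powr_le:
  fixes x y :: "'b::real_normed_vector"
  assumes "0 \<le> p"
  shows "norm (x + y) powr p \<le> 2 powr p * (norm x powr p + norm y powr p)"
proof -
  have "norm (x + y) powr p \<le> (2 * max (norm x) (norm y)) powr p"
    using norm_triangle_ineq[of x y] assms by (intro powr_mono2) auto
  also have "\<dots> = 2 powr p * max (norm x) (norm y) powr p" by (simp add: powr_mult)
  also have "\<dots> \<le> 2 powr p * (norm x powr p + norm y powr p)"
    by (intro mult_left_mono) (auto simp: max_def)
  finally show ?thesis .
qed

locale bounded_open =
  fixes \<Omega> :: "'a::euclidean_space set" and p :: real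
  assumes open_\<Omega>: "open \<Omega>" and bounded_\<Omega>: "bounded \<Omega>" and p_gt_1: "1 < p"
begin

lemma \<Omega>_sets: "\<Omega> \<in> sets lebesgue" using open_\<Omega> by simp

lemma \<Omega>_lmeasurable: "\<Omega> \<in> lmeasurable"
  using bounded_\<Omega> \<Omega>_sets by (rule bounded_set_imp_lmeasurable)

sublocale finite_measure "lebesgue_on \<Omega>"
  by (rule finite_measure_lebesgue_on[OF \<Omega>_lmeasurable])

abbreviation "M \<equiv> lebesgue_on \<Omega>"

abbreviation "Lp \<equiv> Lebesgue_space p \<Omega>"

lemma Lp_measurable: "u \<in> Lp \<Longrightarrow> u \<in> borel_measurable M"
  and Lp_powr_integrable: "u \<in> Lp \<Longrightarrow> integrable M (\<lambda>x. norm (u x) powr p)"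
  by (auto simp: Lebesgue_space_def)

lemma Lp_mono:
  assumes "v \<in> Lp" "u \<in> borel_measurable M" "AE x in M. norm (u x) \<le> norm (v x)"
  shows "u \<in> Lp"
proof -
  have "integrable M (\<lambda>x. norm (u x) powr p)"
  proof (rule Bochner_Integration.integrable_bound[OF Lp_powr_integrable[OF assms(1)]])
    show "AE x in M. norm (norm (u x) powr p) \<le> norm (norm (v x) powr p)"
      using assms(3) by eventually_elim (use p_gt_1 in \<open>auto intro!: powr_mono2\<close>)
  qed (use assms(2) in measurable)
  then show ?thesis using assms(2) by (simp add: Lebesgue_space_def)
qed

lemma Lp_bounded:
  fixes u :: "'a \<Rightarrow> 'b::euclidean_space"
  assumes "u \<in> borel_measurable M" "\<And>x. norm (u x) \<le> B"
  shows "u \<in> Lp"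
proof -
  have "(\<lambda>x. B) \<in> Lp" by (simp add: Lebesgue_space_def)
  moreover have "norm (u x) \<le> norm B" for x using assms(2)[of x] by simp
  ultimately show ?thesis using assms(1) Lp_mono by blast
qed

lemma Lp_add:
  fixes u v :: "'a \<Rightarrow> 'b::euclidean_space"
  assumes "u \<in> Lp" "v \<in> Lp"
  shows "(\<lambda>x. u x + v x) \<in> Lp"
proof -
  have m: "(\<lambda>x. u x + v x) \<in> borel_measurable M" using assms Lp_measurable by (intro borel_measurable_add)
  have "integrable M (\<lambda>x. norm (u x + v x) powr p)"
  proof (rule Bochner_Integration.integrable_bound)
    show "integrable M (\<lambda>x. 2 powr p * (norm (u x) powr p + norm (v x) powr p))"
      using assms by (simp add: Lp_powr_integrable)
    show "AE x in M. norm (norm (u x + v x) powr p) \<le> norm (2 powr p * (norm (u x) powr p + norm (v x) powr p))"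
      using norm_add_powr_le[of p] p_gt_1 by (intro AE_I2) simp
  qed (use m in measurable)
  then show ?thesis using m by (simp add: Lebesgue_space_def)
qed

lemma Lp_mult_bounded:
  fixes u :: "'a \<Rightarrow> 'b::euclidean_space"
  assumes "u \<in> Lp" "b \<in> borel_measurable M" "\<And>x. \<bar>b x\<bar> \<le> B"
  shows "(\<lambda>x. b x *\<^sub>R u x) \<in> Lp"
proof -
  have "integrable M (\<lambda>x. norm (B *\<^sub>R u x) powr p)"
    using Lp_powr_integrable[OF assms(1)] by (simp add: powr_mult)
  then have "(\<lambda>x. B *\<^sub>R u x) \<in> Lp"
    using Lp_measurable[OF assms(1)] by (simp add: Lebesgue_space_def)
  then show ?thesis
  proof (rule Lp_mono)
    show "AE x in M. norm (b x *\<^sub>R u x) \<le> norm (B *\<^sub>R u x)"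
    proof (rule AE_I2)
      fix x
      have "\<bar>b x\<bar> \<le> \<bar>B\<bar>" using assms(3)[of x] by simp
      then show "norm (b x *\<^sub>R u x) \<le> norm (B *\<^sub>R u x)" by (simp add: mult_right_mono)
    qed
  qed (use assms Lp_measurable in \<open>auto intro!: borel_measurable_scaleR\<close>)
qed

lemma Lp_scale: "u \<in> Lp \<Longrightarrow> (\<lambda>x. c *\<^sub>R u x) \<in> Lp"
  using Lp_mult_bounded[of u "\<lambda>x. c" "\<bar>c\<bar>"] by simp

lemma Lp_diff:
  fixes u v :: "'a \<Rightarrow> 'b::euclidean_space"
  assumes "u \<in> Lp" "v \<in> Lp"
  shows "(\<lambda>x. u x - v x) \<in> Lp"
  using Lp_add[OF assms(1) Lp_scale[OF assms(2), of "-1"]] by simp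

lemma Lp_integrable:
  fixes u :: "'a \<Rightarrow> 'b::euclidean_space"
  assumes "u \<in> Lp"
  shows "integrable M u"
proof (rule Bochner_Integration.integrable_bound)
  show "integrable M (\<lambda>x. 1 + norm (u x) powr p)"
    using Lp_powr_integrable[OF assms] by simp
  show "AE x in M. norm (u x) \<le> norm (1 + norm (u x) powr p)"
  proof (rule AE_I2)
    fix x
    show "norm (u x) \<le> norm (1 + norm (u x) powr p)"
    proof (cases "norm (u x) \<le> 1")
      case False
      then have "norm (u x) powr 1 \<le> norm (u x) powr p" using p_gt_1 by (intro powr_mono) auto
      then show ?thesis by simp
    qed (simp add: add_increasing2)
  qed
qed (rule Lp_measurable[OF assms])

lemma Lp_diff_powr_integrable:
  fixes u v :: "'a \<Rightarrow> 'b::euclidean_space"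
  assumes "u \<in> Lp" "v \<in> Lp"
  shows "integrable M (\<lambda>x. norm (u x - v x) powr p)"
  using Lp_powr_integrable[OF Lp_diff[OF assms]] .

text \<open>Membership in \<open>L\<^sup>p\<close> is part of the notion of convergence: the integral of a function that is not
  integrable is zero, so smallness of the integral alone says nothing.\<close>

definition Lp_lim :: "(nat \<Rightarrow> 'a \<Rightarrow> 'b::euclidean_space) \<Rightarrow> ('a \<Rightarrow> 'b) \<Rightarrow> bool" where
  "Lp_lim F f \<longleftrightarrow> (\<forall>n. F n \<in> Lp) \<and> f \<in> Lp \<and>
     (\<lambda>n. \<integral>x. norm (F n x - f x) powr p \<partial>M) \<longlonglongrightarrow> 0"

lemma Lp_limD: "Lp_lim F f \<Longrightarrow> F n \<in> Lp" "Lp_lim F f \<Longrightarrow> f \<in> Lp"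
  "Lp_lim F f \<Longrightarrow> (\<lambda>n. \<integral>x. norm (F n x - f x) powr p \<partial>M) \<longlonglongrightarrow> 0"
  by (auto simp: Lp_lim_def)

lemma Lp_lim_integrable:
  fixes F :: "nat \<Rightarrow> 'a \<Rightarrow> 'b::euclidean_space"
  assumes "Lp_lim F f"
  shows "integrable M (\<lambda>x. norm (F n x - f x) powr p)"
  using Lp_limD(1,2)[OF assms] by (rule Lp_diff_powr_integrable)

lemma Lp_lim_squeeze:
  fixes F :: "nat \<Rightarrow> 'a \<Rightarrow> 'b::euclidean_space"
  assumes "\<And>n. F n \<in> Lp" "f \<in> Lp"
    and "\<And>n. integrable M (R n)" "(\<lambda>n. \<integral>x. R n x \<partial>M) \<longlonglongrightarrow> 0"
    and "\<And>n. AE x in M. norm (F n x - f x) powr p \<le> R n x"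
  shows "Lp_lim F f"
proof -
  have "(\<lambda>n. \<integral>x. norm (F n x - f x) powr p \<partial>M) \<longlonglongrightarrow> 0"
  proof (rule tendsto_sandwich[OF _ _ tendsto_const assms(4)])
    show "\<forall>\<^sub>F n in sequentially. (\<integral>x. norm (F n x - f x) powr p \<partial>M) \<le> (\<integral>x. R n x \<partial>M)"
      by (intro always_eventually allI
          integral_mono_AE[OF Lp_diff_powr_integrable[OF assms(1,2)] assms(3,5)])
  qed simp
  then show ?thesis using assms by (simp add: Lp_lim_def)
qed

lemma Lp_lim_add:
  fixes F G :: "nat \<Rightarrow> 'a \<Rightarrow> 'b::euclidean_space"
  assumes F: "Lp_lim F f" and G: "Lp_lim G g"
  shows "Lp_lim (\<lambda>n x. F n x + G n x) (\<lambda>x. f x + g x)"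
proof (rule Lp_lim_squeeze)
  let ?R = "\<lambda>n x. 2 powr p * (norm (F n x - f x) powr p + norm (G n x - g x) powr p)"
  have i: "integrable M (\<lambda>x. norm (F n x - f x) powr p)" "integrable M (\<lambda>x. norm (G n x - g x) powr p)" for n
    by (rule Lp_lim_integrable[OF F], rule Lp_lim_integrable[OF G])
  then show "integrable M (?R n)" for n by simp
  have "(\<lambda>n. 2 powr p * ((\<integral>x. norm (F n x - f x) powr p \<partial>M) + (\<integral>x. norm (G n x - g x) powr p \<partial>M)))
      \<longlonglongrightarrow> 2 powr p * (0 + 0)"
    by (intro tendsto_intros Lp_limD(3) F G)
  then show "(\<lambda>n. \<integral>x. ?R n x \<partial>M) \<longlonglongrightarrow> 0" using i by simp
  show "AE x in M. norm (F n x + G n x - (f x + g x)) powr p \<le> ?R n x" for n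
    using norm_add_powr_le[of p "F n x - f x" "G n x - g x" for x] p_gt_1
    by (intro AE_I2) (simp add: add_diff_add)
qed (use F G in \<open>auto intro!: Lp_add dest: Lp_limD\<close>)

lemma Lp_lim_const: "f \<in> Lp \<Longrightarrow> Lp_lim (\<lambda>n. f) f"
  using p_gt_1 by (simp add: Lp_lim_def)

lemma Lp_lim_subseq: "Lp_lim F f \<Longrightarrow> strict_mono r \<Longrightarrow> Lp_lim (\<lambda>n. F (r n)) f"
  unfolding Lp_lim_def using LIMSEQ_subseq_LIMSEQ[of "\<lambda>n. \<integral>x. norm (F n x - f x) powr p \<partial>M" 0 r]
  by (auto simp: o_def)

lemma Lp_lim_mult_bounded_left:
  fixes F :: "nat \<Rightarrow> 'a \<Rightarrow> 'b::euclidean_space"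
  assumes F: "Lp_lim F (\<lambda>x. 0)" and b: "\<And>n. b n \<in> borel_measurable M" "\<And>n x. \<bar>b n x\<bar> \<le> B"
  shows "Lp_lim (\<lambda>n x. b n x *\<^sub>R F n x) (\<lambda>x. 0)"
proof (rule Lp_lim_squeeze)
  let ?R = "\<lambda>n x. B powr p * norm (F n x - 0) powr p"
  have i: "integrable M (\<lambda>x. norm (F n x - 0) powr p)" for n
    using Lp_powr_integrable[OF Lp_limD(1)[OF F]] by simp
  then show "integrable M (?R n)" for n by simp
  have "(\<lambda>n. B powr p * (\<integral>x. norm (F n x - 0) powr p \<partial>M)) \<longlonglongrightarrow> B powr p * 0"
    by (intro tendsto_intros Lp_limD(3) F)
  then show "(\<lambda>n. \<integral>x. ?R n x \<partial>M) \<longlonglongrightarrow> 0" using i by simp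
  have "0 \<le> B" using b(2)[of undefined undefined] by linarith
  then show "AE x in M. norm (b n x *\<^sub>R F n x - 0) powr p \<le> ?R n x" for n
    using b(2)[of n] p_gt_1 by (intro AE_I2) (auto simp: powr_mult intro!: mult_right_mono powr_mono2)
  show "(\<lambda>x. b n x *\<^sub>R F n x) \<in> Lp" for n using Lp_mult_bounded[OF Lp_limD(1)[OF F] b] .
qed (use F in \<open>auto dest: Lp_limD\<close>)

lemma Lp_lim_iff_diff:
  fixes F :: "nat \<Rightarrow> 'a \<Rightarrow> 'b::euclidean_space"
  assumes "f \<in> Lp"
  shows "Lp_lim F f \<longleftrightarrow> Lp_lim (\<lambda>n x. F n x - f x) (\<lambda>x. 0)"
proof
  assume "Lp_lim F f"
  from Lp_lim_add[OF this Lp_lim_const[OF Lp_scale[OF assms, of "-1"]]]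
  show "Lp_lim (\<lambda>n x. F n x - f x) (\<lambda>x. 0)" by simp
next
  assume "Lp_lim (\<lambda>n x. F n x - f x) (\<lambda>x. 0)"
  from Lp_lim_add[OF this Lp_lim_const[OF assms]] show "Lp_lim F f" by simp
qed

lemma Lp_lim_scale:
  fixes F :: "nat \<Rightarrow> 'a \<Rightarrow> 'b::euclidean_space"
  assumes "Lp_lim F f"
  shows "Lp_lim (\<lambda>n x. c *\<^sub>R F n x) (\<lambda>x. c *\<^sub>R f x)"
proof -
  have "Lp_lim (\<lambda>n x. c *\<^sub>R (F n x - f x)) (\<lambda>x. 0)"
    using assms Lp_limD(2)[OF assms] by (intro Lp_lim_mult_bounded_left[of _ _ "\<bar>c\<bar>"]) (auto simp: Lp_lim_iff_diff)
  then show ?thesis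
    using Lp_limD(2)[OF assms] by (subst Lp_lim_iff_diff) (auto simp: Lp_scale scaleR_diff_right)
qed

lemma Lp_lim_dominated:
  fixes F :: "nat \<Rightarrow> 'a \<Rightarrow> 'b::euclidean_space" and w :: "'a \<Rightarrow> real"
  assumes F: "\<And>n. F n \<in> borel_measurable M" "f \<in> borel_measurable M"
    and lim: "AE x in M. (\<lambda>n. F n x) \<longlonglongrightarrow> f x"
    and w: "w \<in> Lp" "\<And>n. AE x in M. norm (F n x) \<le> w x"
  shows "Lp_lim F f"
proof -
  have all: "AE x in M. \<forall>n. norm (F n x) \<le> w x" using w(2) by (simp add: AE_all_countable)
  have FL: "F n \<in> Lp" for n
    using w(2)[of n] by (intro Lp_mono[OF w(1) F(1)]) (auto elim!: eventually_mono)
  have fw: "AE x in M. norm (f x) \<le> w x"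
    using all lim by eventually_elim (rule LIMSEQ_le_const2[OF tendsto_norm], auto)
  have fL: "f \<in> Lp"
    using fw by (intro Lp_mono[OF w(1) F(2)]) (auto elim!: eventually_mono)
  have "(\<lambda>n. \<integral>x. norm (F n x - f x) powr p \<partial>M) \<longlonglongrightarrow> (\<integral>x. 0 \<partial>M)"
  proof (rule integral_dominated_convergence[where w = "\<lambda>x. 2 powr p * (\<bar>w x\<bar> powr p + \<bar>w x\<bar> powr p)"])
    show "integrable M (\<lambda>x. 2 powr p * (\<bar>w x\<bar> powr p + \<bar>w x\<bar> powr p))"
      using Lp_powr_integrable[OF w(1)] by simp
    show "AE x in M. (\<lambda>n. norm (F n x - f x) powr p) \<longlonglongrightarrow> 0"
      using lim
    proof eventually_elim
      case (elim x)
      then have "(\<lambda>n. norm (F n x - f x)) \<longlonglongrightarrow> 0" using LIM_zero tendsto_norm_zero by blast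
      then show ?case using p_gt_1 by (intro tendsto_zero_powrI[where b = p]) auto
    qed
    show "AE x in M. norm (norm (F n x - f x) powr p) \<le> 2 powr p * (\<bar>w x\<bar> powr p + \<bar>w x\<bar> powr p)" for n
      using all fw
    proof eventually_elim
      case (elim x)
      have "norm (F n x - f x) powr p \<le> 2 powr p * (norm (F n x) powr p + norm (f x) powr p)"
        using norm_add_powr_le[of p "F n x" "- f x"] p_gt_1 by simp
      also have "\<dots> \<le> 2 powr p * (\<bar>w x\<bar> powr p + \<bar>w x\<bar> powr p)"
      proof (intro mult_left_mono add_mono powr_mono2)
        show "norm (F n x) \<le> \<bar>w x\<bar>" "norm (f x) \<le> \<bar>w x\<bar>" using elim abs_ge_self[of "w x"] order_trans by blast+
      qed (use p_gt_1 in auto)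
      finally show ?case by simp
    qed
  qed (use F in auto)
  then show ?thesis using FL fL by (simp add: Lp_lim_def)
qed

lemma Lp_lim_mult:
  fixes F :: "nat \<Rightarrow> 'a \<Rightarrow> 'b::euclidean_space"
  assumes F: "Lp_lim F f" and b: "\<And>n. b n \<in> borel_measurable M" "\<And>n x. \<bar>b n x\<bar> \<le> B"
    and b': "b' \<in> borel_measurable M" "AE x in M. (\<lambda>n. b n x) \<longlonglongrightarrow> b' x"
  shows "Lp_lim (\<lambda>n x. b n x *\<^sub>R F n x) (\<lambda>x. b' x *\<^sub>R f x)"
proof -
  note f = Lp_limD(2)[OF F]
  have "Lp_lim (\<lambda>n x. b n x *\<^sub>R (F n x - f x)) (\<lambda>x. 0)"
    using F f b by (intro Lp_lim_mult_bounded_left[of _ _ B]) (auto simp: Lp_lim_iff_diff)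
  moreover have "Lp_lim (\<lambda>n x. b n x *\<^sub>R f x) (\<lambda>x. b' x *\<^sub>R f x)"
  proof (rule Lp_lim_dominated)
    show "(\<lambda>x. norm (B *\<^sub>R f x)) \<in> Lp"
      using Lp_scale[OF f, of B] by (rule Lp_mono) (use Lp_measurable[OF f] in auto)
    show "AE x in M. (\<lambda>n. b n x *\<^sub>R f x) \<longlonglongrightarrow> b' x *\<^sub>R f x"
      using b'(2) by eventually_elim (intro tendsto_intros)
    show "AE x in M. norm (b n x *\<^sub>R f x) \<le> norm (B *\<^sub>R f x)" for n
    proof (rule AE_I2)
      fix x
      have "\<bar>b n x\<bar> \<le> \<bar>B\<bar>" using b(2)[of n x] by simp
      then show "norm (b n x *\<^sub>R f x) \<le> norm (B *\<^sub>R f x)" by (simp add: mult_right_mono)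
    qed
  qed (use b b' Lp_measurable[OF f] in auto)
  ultimately have "Lp_lim (\<lambda>n x. b n x *\<^sub>R (F n x - f x) + b n x *\<^sub>R f x) (\<lambda>x. 0 + b' x *\<^sub>R f x)"
    by (rule Lp_lim_add)
  then show ?thesis by (simp add: scaleR_diff_right)
qed

lemma Lp_lim_AE_subseq:
  fixes F :: "nat \<Rightarrow> 'a \<Rightarrow> 'b::euclidean_space"
  assumes F: "Lp_lim F f"
  obtains r where "strict_mono r" "AE x in M. (\<lambda>n. F (r n) x) \<longlonglongrightarrow> f x"
proof -
  have "\<exists>r. strict_mono r \<and> (AE x in M. (\<lambda>n. norm (F (r n) x - f x) powr p) \<longlonglongrightarrow> 0)"
  proof (rule tendsto_L1_AE_subseq)
    show "integrable M (\<lambda>x. norm (F n x - f x) powr p)" for n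
      by (rule Lp_lim_integrable[OF F])
    show "(\<lambda>n. \<integral>x. norm (norm (F n x - f x) powr p) \<partial>M) \<longlonglongrightarrow> 0"
      using Lp_limD(3)[OF F] by simp
  qed
  then obtain r where r: "strict_mono r" "AE x in M. (\<lambda>n. norm (F (r n) x - f x) powr p) \<longlonglongrightarrow> 0" by blast
  have "AE x in M. (\<lambda>n. F (r n) x) \<longlonglongrightarrow> f x"
    using r(2)
  proof eventually_elim
    case (elim x)
    have "(\<lambda>n. (norm (F (r n) x - f x) powr p) powr (1 / p)) \<longlonglongrightarrow> 0"
      using p_gt_1 by (intro tendsto_zero_powrI[OF elim tendsto_const]) auto
    then have "(\<lambda>n. norm (F (r n) x - f x)) \<longlonglongrightarrow> 0" using p_gt_1 by (simp add: powr_powr)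
    then show ?case by (intro LIM_zero_cancel[of "\<lambda>n. F (r n) x"]) (rule tendsto_norm_zero_cancel)
  qed
  with r(1) show ?thesis using that by blast
qed

text \<open>The measure is finite, and \<open>t \<le> d + d\<^sup>1\<^sup>-\<^sup>p t\<^sup>p\<close> for every \<open>d > 0\<close>.\<close>

lemma Lp_lim_L1:
  fixes F :: "nat \<Rightarrow> 'a \<Rightarrow> 'b::euclidean_space"
  assumes F: "Lp_lim F f"
  shows "(\<lambda>n. \<integral>x. norm (F n x - f x) \<partial>M) \<longlonglongrightarrow> 0"
proof (rule LIMSEQ_I)
  fix e :: real assume e: "e > 0"
  define V where "V = measure M (space M)"
  define d where "d = e / (2 * (V + 1))"
  have V: "V \<ge> 0" by (simp add: V_def)
  have d: "d > 0" using e V by (simp add: d_def)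
  have i: "integrable M (\<lambda>x. norm (F n x - f x) powr p)" "integrable M (\<lambda>x. F n x - f x)" for n
    using Lp_lim_integrable[OF F] Lp_integrable[OF Lp_diff[OF Lp_limD(1,2)[OF F]]] by blast+
  have "eventually (\<lambda>n. (\<integral>x. norm (F n x - f x) powr p \<partial>M) < (e / 2) * d powr (p - 1)) sequentially"
    using Lp_limD(3)[OF F] by (rule order_tendstoD) (use e d in auto)
  then obtain N where N: "\<And>n. n \<ge> N \<Longrightarrow> (\<integral>x. norm (F n x - f x) powr p \<partial>M) < (e / 2) * d powr (p - 1)"
    by (auto simp: eventually_sequentially)
  show "\<exists>N. \<forall>n\<ge>N. norm ((\<integral>x. norm (F n x - f x) \<partial>M) - 0) < e"
  proof (intro exI allI impI)
    fix n assume n: "n \<ge> N"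
    have pt: "t \<le> d + d powr (1 - p) * t powr p" if "t \<ge> 0" for t :: real
    proof (cases "t \<le> d")
      case False
      then have t: "t > 0" using d by linarith
      have "t = t powr (1 - p) * t powr p" using t by (simp flip: powr_add)
      also have "\<dots> \<le> d powr (1 - p) * t powr p"
        using False d p_gt_1 by (intro mult_right_mono powr_mono2') auto
      finally show ?thesis using d by linarith
    qed (simp add: add_increasing2)
    have "(\<integral>x. norm (F n x - f x) \<partial>M) \<le> (\<integral>x. d + d powr (1 - p) * norm (F n x - f x) powr p \<partial>M)"
      using i by (intro integral_mono) (auto intro!: pt)
    also have "\<dots> = d * V + d powr (1 - p) * (\<integral>x. norm (F n x - f x) powr p \<partial>M)"
      using i by (simp add: V_def)
    also have "\<dots> \<le> d * V + d powr (1 - p) * ((e / 2) * d powr (p - 1))"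
      using N[OF n] by (intro add_left_mono mult_left_mono) auto
    also have "d powr (1 - p) * ((e / 2) * d powr (p - 1)) = e / 2"
      using d by (simp add: mult.left_commute flip: powr_add)
    also have "d * V < e / 2"
      using e V by (simp add: d_def field_simps)
    finally show "norm ((\<integral>x. norm (F n x - f x) \<partial>M) - 0) < e" by simp
  qed
qed

section \<open>The space $W_0^{1,p}$\<close>

text \<open>An element of \<open>W\<^sub>0\<^sup>1\<^sup>,\<^sup>p\<close> together with its gradient. Limits, products and the chain rule act on such
  pairs directly, without reference to the selected representative \<^const>\<open>weak_gradient\<close>.\<close>

definition W0 :: "('a \<Rightarrow> real) \<Rightarrow> ('a \<Rightarrow> 'a) \<Rightarrow> bool" where
  "W0 u g \<longleftrightarrow> (\<exists>\<phi>. (\<forall>n. \<phi> n \<in> test_functions \<Omega>) \<and> Lp_lim \<phi> u \<and> Lp_lim (\<lambda>n. grad (\<phi> n)) g)"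

lemma W0D: "W0 u g \<Longrightarrow> u \<in> Lp" "W0 u g \<Longrightarrow> g \<in> Lp"
  using Lp_limD(2) by (auto simp: W0_def)

lemma test_function_Lp:
  assumes "\<phi> \<in> test_functions \<Omega>"
  shows "\<phi> \<in> Lp" and "grad \<phi> \<in> Lp"
proof -
  note s = test_functions_smooth[OF assms]
  obtain B where B: "\<And>x. \<bar>\<phi> x\<bar> \<le> B" "\<And>x. norm (grad \<phi> x) \<le> B" "0 < B"
    using test_functions_bounded[OF assms] by metis
  show "\<phi> \<in> Lp"
    by (rule Lp_bounded[OF continuous_measurable_lebesgue_on[OF smooth_continuous[OF s]], of B])
      (use B in auto)
  show "grad \<phi> \<in> Lp"
    by (rule Lp_bounded[OF continuous_measurable_lebesgue_on[OF continuous_grad[OF s]], of B])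
      (use B in auto)
qed

lemma W0_test_function: "\<phi> \<in> test_functions \<Omega> \<Longrightarrow> W0 \<phi> (grad \<phi>)"
  unfolding W0_def
  by (intro exI[of _ "\<lambda>n. \<phi>"] conjI allI Lp_lim_const test_function_Lp)

lemma W0_add:
  assumes "W0 u g" "W0 v h"
  shows "W0 (\<lambda>x. u x + v x) (\<lambda>x. g x + h x)"
proof -
  obtain \<phi> \<psi> where *: "\<And>n. \<phi> n \<in> test_functions \<Omega>" "Lp_lim \<phi> u" "Lp_lim (\<lambda>n. grad (\<phi> n)) g"
    "\<And>n. \<psi> n \<in> test_functions \<Omega>" "Lp_lim \<psi> v" "Lp_lim (\<lambda>n. grad (\<psi> n)) h"
    using assms unfolding W0_def by blast
  have "grad (\<lambda>x. \<phi> n x + \<psi> n x) = (\<lambda>x. grad (\<phi> n) x + grad (\<psi> n) x)" for n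
    using * by (intro ext grad_add test_functions_smooth)
  then show ?thesis
    unfolding W0_def
    using test_functions_add[OF *(1,4)] Lp_lim_add[OF *(2,5)] Lp_lim_add[OF *(3,6)]
    by (intro exI[of _ "\<lambda>n x. \<phi> n x + \<psi> n x"] conjI allI) simp_all
qed

lemma W0_scale:
  assumes "W0 u g"
  shows "W0 (\<lambda>x. c * u x) (\<lambda>x. c *\<^sub>R g x)"
proof -
  obtain \<phi> where *: "\<And>n. \<phi> n \<in> test_functions \<Omega>" "Lp_lim \<phi> u" "Lp_lim (\<lambda>n. grad (\<phi> n)) g"
    using assms unfolding W0_def by blast
  have "grad (\<lambda>x. c * \<phi> n x) = (\<lambda>x. c *\<^sub>R grad (\<phi> n) x)" for n
    using * by (intro ext grad_scale test_functions_smooth)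
  then show ?thesis
    unfolding W0_def
    using test_functions_scale[OF *(1)] Lp_lim_scale[OF *(2), of c] Lp_lim_scale[OF *(3), of c]
    by (intro exI[of _ "\<lambda>n x. c * \<phi> n x"] conjI allI) simp_all
qed

text \<open>A diagonal argument: the \<open>n\<close>-th test function is chosen within \<open>1/(n+1)\<close> of the \<open>n\<close>-th pair.\<close>

lemma W0_closed:
  assumes W: "\<And>n. W0 (U n) (G n)" and U: "Lp_lim U u" and G: "Lp_lim G g"
  shows "W0 u g"
proof -
  have "\<exists>\<phi>. \<phi> \<in> test_functions \<Omega> \<and> (\<integral>x. norm (\<phi> x - U n x) powr p \<partial>M) < inverse (real (Suc n)) \<and>
      (\<integral>x. norm (grad \<phi> x - G n x) powr p \<partial>M) < inverse (real (Suc n))" for n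
  proof -
    obtain \<phi> where *: "\<And>n. \<phi> n \<in> test_functions \<Omega>" "Lp_lim \<phi> (U n)" "Lp_lim (\<lambda>n. grad (\<phi> n)) (G n)"
      using W[of n] unfolding W0_def by blast
    have "eventually (\<lambda>k. (\<integral>x. norm (\<phi> k x - U n x) powr p \<partial>M) < inverse (real (Suc n))) sequentially"
      using Lp_limD(3)[OF *(2)] by (rule order_tendstoD) simp
    moreover have "eventually (\<lambda>k. (\<integral>x. norm (grad (\<phi> k) x - G n x) powr p \<partial>M) < inverse (real (Suc n))) sequentially"
      using Lp_limD(3)[OF *(3)] by (rule order_tendstoD) simp
    ultimately have "eventually (\<lambda>k. (\<integral>x. norm (\<phi> k x - U n x) powr p \<partial>M) < inverse (real (Suc n)) \<and>
      (\<integral>x. norm (grad (\<phi> k) x - G n x) powr p \<partial>M) < inverse (real (Suc n))) sequentially"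
      by (rule eventually_conj)
    then show ?thesis using *(1) unfolding eventually_sequentially by blast
  qed
  then have "\<forall>n. \<exists>\<phi>. \<phi> \<in> test_functions \<Omega> \<and> (\<integral>x. norm (\<phi> x - U n x) powr p \<partial>M) < inverse (real (Suc n)) \<and>
      (\<integral>x. norm (grad \<phi> x - G n x) powr p \<partial>M) < inverse (real (Suc n))" ..
  from choice[OF this] obtain \<phi> where "\<forall>n. \<phi> n \<in> test_functions \<Omega> \<and>
      (\<integral>x. norm (\<phi> n x - U n x) powr p \<partial>M) < inverse (real (Suc n)) \<and>
      (\<integral>x. norm (grad (\<phi> n) x - G n x) powr p \<partial>M) < inverse (real (Suc n))" ..
  then have \<phi>: "\<phi> n \<in> test_functions \<Omega>"
      "(\<integral>x. norm (\<phi> n x - U n x) powr p \<partial>M) < inverse (real (Suc n))"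
      "(\<integral>x. norm (grad (\<phi> n) x - G n x) powr p \<partial>M) < inverse (real (Suc n))" for n
    by simp_all
  have d: "Lp_lim (\<lambda>n x. F n x - H n x) (\<lambda>x. 0)"
    if F: "\<And>n. F n \<in> Lp" "\<And>n. H n \<in> Lp"
      and lt: "\<And>n. (\<integral>x. norm (F n x - H n x) powr p \<partial>M) < inverse (real (Suc n))"
    for F H :: "nat \<Rightarrow> 'a \<Rightarrow> 'b::euclidean_space"
  proof -
    have "(\<lambda>n. \<integral>x. norm (F n x - H n x) powr p \<partial>M) \<longlonglongrightarrow> 0"
      by (rule tendsto_sandwich[OF _ _ tendsto_const LIMSEQ_inverse_real_of_nat])
        (use lt less_imp_le in \<open>auto intro!: always_eventually\<close>)
    then show ?thesis using F by (auto simp: Lp_lim_def Lp_diff intro!: Lp_bounded[of _ 0])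
  qed
  have t: "Lp_lim F f" if "Lp_lim (\<lambda>n x. F n x - H n x) (\<lambda>x. 0)" "Lp_lim H f"
    for F H :: "nat \<Rightarrow> 'a \<Rightarrow> 'b::euclidean_space" and f
    using Lp_lim_add[OF that] by simp
  have "Lp_lim \<phi> u"
    by (rule t[OF d[OF test_function_Lp(1)[OF \<phi>(1)] Lp_limD(1)[OF U] \<phi>(2)] U])
  moreover have "Lp_lim (\<lambda>n. grad (\<phi> n)) g"
    by (rule t[OF d[OF test_function_Lp(2)[OF \<phi>(1)] Lp_limD(1)[OF G] \<phi>(3)] G])
  ultimately show ?thesis unfolding W0_def using \<phi>(1) by blast
qed

lemma W0_test_mult:
  assumes "W0 u g" "\<Phi> \<in> test_functions \<Omega>"
  shows "W0 (\<lambda>x. \<Phi> x * u x) (\<lambda>x. \<Phi> x *\<^sub>R g x + u x *\<^sub>R grad \<Phi> x)"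
proof -
  obtain \<phi> where *: "\<And>n. \<phi> n \<in> test_functions \<Omega>" "Lp_lim \<phi> u" "Lp_lim (\<lambda>n. grad (\<phi> n)) g"
    using assms unfolding W0_def by blast
  note s = test_functions_smooth[OF assms(2)]
  obtain B where B: "\<And>x. \<bar>\<Phi> x\<bar> \<le> B" "\<And>x. norm (grad \<Phi> x) \<le> B" "0 < B"
    using test_functions_bounded[OF assms(2)] by metis
  have m: "\<Phi> \<in> borel_measurable M" "grad \<Phi> \<in> borel_measurable M"
    using s by (auto intro!: continuous_measurable_lebesgue_on smooth_continuous continuous_grad)
  have g: "grad (\<lambda>x. \<Phi> x * \<phi> n x) = (\<lambda>x. \<Phi> x *\<^sub>R grad (\<phi> n) x + \<phi> n x *\<^sub>R grad \<Phi> x)" for n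
    by (intro ext grad_mult s test_functions_smooth[OF *(1)])
  have 1: "Lp_lim (\<lambda>n x. \<Phi> x *\<^sub>R F n x) (\<lambda>x. \<Phi> x *\<^sub>R f x)" if "Lp_lim F f"
    for F :: "nat \<Rightarrow> 'a \<Rightarrow> 'b::euclidean_space" and f
    using that m B(1) by (intro Lp_lim_mult) auto
  have 2: "Lp_lim (\<lambda>n x. \<phi> n x *\<^sub>R grad \<Phi> x) (\<lambda>x. u x *\<^sub>R grad \<Phi> x)"
  proof (rule Lp_lim_squeeze)
    have b: "w \<in> Lp \<Longrightarrow> (\<lambda>x. w x *\<^sub>R grad \<Phi> x) \<in> Lp" for w :: "'a \<Rightarrow> real"
    proof (rule Lp_mono[OF Lp_scale[of w B]])
      assume w: "w \<in> Lp"
      show "(\<lambda>x. w x *\<^sub>R grad \<Phi> x) \<in> borel_measurable M" using Lp_measurable[OF w] m by simp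
      show "AE x in M. norm (w x *\<^sub>R grad \<Phi> x) \<le> norm (B *\<^sub>R w x)"
        using B(2,3) by (intro AE_I2) (simp add: abs_mult mult.commute[of "\<bar>w _\<bar>"] mult_right_mono)
    qed
    show "(\<lambda>x. \<phi> n x *\<^sub>R grad \<Phi> x) \<in> Lp" for n using b *(1) test_function_Lp by blast
    show "(\<lambda>x. u x *\<^sub>R grad \<Phi> x) \<in> Lp" using b W0D[OF assms(1)] by blast
    let ?R = "\<lambda>n x. B powr p * norm (\<phi> n x - u x) powr p"
    have i: "integrable M (\<lambda>x. norm (\<phi> n x - u x) powr p)" for n
      by (rule Lp_lim_integrable[OF *(2)])
    then show "integrable M (?R n)" for n by simp
    have "(\<lambda>n. B powr p * (\<integral>x. norm (\<phi> n x - u x) powr p \<partial>M)) \<longlonglongrightarrow> B powr p * 0"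
      by (intro tendsto_intros Lp_limD(3) *)
    then show "(\<lambda>n. \<integral>x. ?R n x \<partial>M) \<longlonglongrightarrow> 0" using i by simp
    show "AE x in M. norm (\<phi> n x *\<^sub>R grad \<Phi> x - u x *\<^sub>R grad \<Phi> x) powr p \<le> ?R n x" for n
    proof (rule AE_I2)
      fix x
      have "norm (\<phi> n x *\<^sub>R grad \<Phi> x - u x *\<^sub>R grad \<Phi> x) = norm (grad \<Phi> x) * norm (\<phi> n x - u x)"
        by (simp flip: scaleR_diff_left)
      then show "norm (\<phi> n x *\<^sub>R grad \<Phi> x - u x *\<^sub>R grad \<Phi> x) powr p \<le> ?R n x"
        using B(2)[of x] p_gt_1 by (auto simp: powr_mult intro!: mult_right_mono powr_mono2)
    qed
  qed
  show ?thesis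
    unfolding W0_def
  proof (intro exI conjI allI)
    show "(\<lambda>x. \<Phi> x * \<phi> n x) \<in> test_functions \<Omega>" for n
      using test_functions_mult[OF assms(2) test_functions_smooth[OF *(1)]] .
    show "Lp_lim (\<lambda>n x. \<Phi> x * \<phi> n x) (\<lambda>x. \<Phi> x * u x)" using 1[OF *(2)] by simp
    show "Lp_lim (\<lambda>n. grad (\<lambda>x. \<Phi> x * \<phi> n x)) (\<lambda>x. \<Phi> x *\<^sub>R g x + u x *\<^sub>R grad \<Phi> x)"
      unfolding g by (rule Lp_lim_add[OF 1[OF *(3)] 2])
  qed
qed

lemma real_lipschitz_bound:
  fixes G :: "real \<Rightarrow> real"
  assumes "\<And>s. (G has_real_derivative G' s) (at s)" "\<And>s. \<bar>G' s\<bar> \<le> L"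
  shows "\<bar>G s - G t\<bar> \<le> L * \<bar>s - t\<bar>"
  using field_differentiable_bound[of UNIV G G' L s t] assms by simp

text \<open>The approximating test functions converge almost everywhere along a subsequence, so the factors
  \<open>G'\<close> converge boundedly; composition with a smooth \<open>G\<close> vanishing at the origin keeps test functions
  test functions.\<close>

lemma W0_compose:
  assumes W: "W0 u g" and d: "\<And>s. (G has_real_derivative G' s) (at s)" and s: "smooth G'"
    and L: "\<And>s. \<bar>G' s\<bar> \<le> L" and 0: "G 0 = 0"
  shows "W0 (\<lambda>x. G (u x)) (\<lambda>x. G' (u x) *\<^sub>R g x)"
proof -
  obtain \<phi> where \<phi>: "\<And>n. \<phi> n \<in> test_functions \<Omega>" "Lp_lim \<phi> u" "Lp_lim (\<lambda>n. grad (\<phi> n)) g"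
    using W unfolding W0_def by blast
  obtain r where r: "strict_mono r" "AE x in M. (\<lambda>n. \<phi> (r n) x) \<longlonglongrightarrow> u x"
    using Lp_lim_AE_subseq[OF \<phi>(2)] by metis
  define \<psi> where "\<psi> n = \<phi> (r n)" for n
  have \<psi>: "\<psi> n \<in> test_functions \<Omega>" "Lp_lim \<psi> u" "Lp_lim (\<lambda>n. grad (\<psi> n)) g" for n
    using \<phi> Lp_lim_subseq[OF _ r(1)] by (auto simp: \<psi>_def[abs_def])
  have sG: "smooth G" using smooth_real_antiderivative d s by blast
  have cG': "continuous_on UNIV G'" using s smooth_continuous by blast
  have mG: "G \<in> borel_measurable borel" "G' \<in> borel_measurable borel"
    using borel_measurable_continuous_onI[OF smooth_continuous] sG s by auto
  have m\<psi>: "\<psi> n \<in> borel_measurable M" for n using \<psi>(2) Lp_limD Lp_measurable by blast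
  have mu: "u \<in> borel_measurable M" using W0D[OF W] Lp_measurable by blast
  have lip: "\<bar>G s - G t\<bar> \<le> L * \<bar>s - t\<bar>" for s t by (rule real_lipschitz_bound[OF d L])
  have g: "grad (\<lambda>x. G (\<psi> n x)) = (\<lambda>x. G' (\<psi> n x) *\<^sub>R grad (\<psi> n) x)" for n
    by (intro ext grad_compose test_functions_smooth[OF \<psi>(1)] d)
  have L0: "0 \<le> L" using L[of 0] by linarith
  show ?thesis unfolding W0_def
  proof (intro exI conjI allI)
    show t: "(\<lambda>x. G (\<psi> n x)) \<in> test_functions \<Omega>" for n
      using test_functions_compose[OF \<psi>(1) sG 0] .
    show "Lp_lim (\<lambda>n x. G (\<psi> n x)) (\<lambda>x. G (u x))"
    proof (rule Lp_lim_squeeze)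
      show "(\<lambda>x. G (\<psi> n x)) \<in> Lp" for n using t test_function_Lp by blast
      show "(\<lambda>x. G (u x)) \<in> Lp"
        by (rule Lp_mono[OF Lp_scale[OF W0D(1)[OF W], of L]])
          (use lip[of "u x" 0 for x] 0 L0 mG mu in \<open>auto simp: abs_mult intro: measurable_compose\<close>)
      let ?R = "\<lambda>n x. L powr p * norm (\<psi> n x - u x) powr p"
      have i: "integrable M (\<lambda>x. norm (\<psi> n x - u x) powr p)" for n
        by (rule Lp_lim_integrable[OF \<psi>(2)])
      then show "integrable M (?R n)" for n by simp
      have "(\<lambda>n. L powr p * (\<integral>x. norm (\<psi> n x - u x) powr p \<partial>M)) \<longlonglongrightarrow> L powr p * 0"
        by (intro tendsto_intros Lp_limD(3) \<psi>)
      then show "(\<lambda>n. \<integral>x. ?R n x \<partial>M) \<longlonglongrightarrow> 0" using i by simp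
      show "AE x in M. norm (G (\<psi> n x) - G (u x)) powr p \<le> ?R n x" for n
      proof (rule AE_I2)
        fix x
        have "norm (G (\<psi> n x) - G (u x)) powr p \<le> (L * \<bar>\<psi> n x - u x\<bar>) powr p"
          using lip[of "\<psi> n x" "u x"] p_gt_1 by (intro powr_mono2) auto
        then show "norm (G (\<psi> n x) - G (u x)) powr p \<le> ?R n x" using L0 by (simp add: powr_mult)
      qed
    qed
    show "Lp_lim (\<lambda>n. grad (\<lambda>x. G (\<psi> n x))) (\<lambda>x. G' (u x) *\<^sub>R g x)"
      unfolding g
    proof (rule Lp_lim_mult[OF \<psi>(3)])
      show "AE x in M. (\<lambda>n. G' (\<psi> n x)) \<longlonglongrightarrow> G' (u x)"
        using r(2) unfolding \<psi>_def
        by eventually_elim (rule continuous_on_tendsto_compose[OF cG'], auto)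
    qed (use mG m\<psi> mu L in \<open>auto intro: measurable_compose\<close>)
  qed
qed

text \<open>Chain rule for functions that are bounded pointwise limits of smooth ones together with their
  derivatives; the limit derivative may have jumps.\<close>

lemma W0_compose_limit:
  assumes W: "W0 u g" and d: "\<And>n s. (G n has_real_derivative G' n s) (at s)" and s: "\<And>n. smooth (G' n)"
    and L: "\<And>n s. \<bar>G' n s\<bar> \<le> L" and 0: "\<And>n. G n 0 = 0"
    and lim: "\<And>s. (\<lambda>n. G n s) \<longlonglongrightarrow> H s" "\<And>s. (\<lambda>n. G' n s) \<longlonglongrightarrow> H' s"
  shows "W0 (\<lambda>x. H (u x)) (\<lambda>x. H' (u x) *\<^sub>R g x)"
proof -
  have Wn: "W0 (\<lambda>x. G n (u x)) (\<lambda>x. G' n (u x) *\<^sub>R g x)" for n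
    by (rule W0_compose[OF W d s L 0])
  have mu: "u \<in> borel_measurable M" using W0D[OF W] Lp_measurable by blast
  have mG: "(\<lambda>x. G n (u x)) \<in> borel_measurable M" for n using W0D[OF Wn] Lp_measurable by blast
  have mG': "(\<lambda>x. G' n (u x)) \<in> borel_measurable M" for n
    using borel_measurable_continuous_onI[OF smooth_continuous[OF s]] mu by (auto intro: measurable_compose)
  have L0: "0 \<le> L" using L[of 0 0] by linarith
  have 1: "Lp_lim (\<lambda>n x. G n (u x)) (\<lambda>x. H (u x))"
  proof (rule Lp_lim_dominated[where w = "\<lambda>x. L * \<bar>u x\<bar>"])
    show "(\<lambda>x. L * \<bar>u x\<bar>) \<in> Lp"
      using Lp_mono[OF Lp_scale[OF W0D(1)[OF W], of L], of "\<lambda>x. L * \<bar>u x\<bar>"] mu by (simp add: abs_mult)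
    show "(\<lambda>x. H (u x)) \<in> borel_measurable M"
      by (rule borel_measurable_LIMSEQ_real[OF lim(1) mG])
    show "AE x in M. norm (G n (u x)) \<le> L * \<bar>u x\<bar>" for n
      using real_lipschitz_bound[OF d L, of n _ 0] 0 by simp
  qed (use lim mG in auto)
  have 2: "Lp_lim (\<lambda>n x. G' n (u x) *\<^sub>R g x) (\<lambda>x. H' (u x) *\<^sub>R g x)"
  proof (rule Lp_lim_mult[OF Lp_lim_const[OF W0D(2)[OF W]] mG' L])
    show "(\<lambda>x. H' (u x)) \<in> borel_measurable M"
      by (rule borel_measurable_LIMSEQ_real[OF lim(2) mG'])
  qed (use lim in auto)
  show "W0 (\<lambda>x. H (u x)) (\<lambda>x. H' (u x) *\<^sub>R g x)" by (rule W0_closed[OF Wn 1 2])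
qed

text \<open>Rescaled softplus functions approximate the negative part. They are shifted by \<open>1/N\<close>, a distance
  large compared with their scale \<open>1/N\<^sup>2\<close>, so that their derivatives tend to zero at the origin as well.
  The limit gradient therefore vanishes on the set where \<open>u\<close> does.\<close>

lemma W0_neg_part:
  assumes W: "W0 u g"
  shows "W0 (\<lambda>x. max (- u x) 0) (\<lambda>x. (if u x < 0 then - 1 else 0) *\<^sub>R g x)"
proof -
  define N where "N n = real (Suc n)" for n
  have N: "N n \<ge> 1" for n by (simp add: N_def)
  have Ninf: "filterlim N at_top sequentially"
    unfolding N_def using filterlim_Suc filterlim_compose filterlim_real_sequentially by blast
  define z where "z n s = - (N n)\<^sup>2 * s - N n" for n s
  define G where "G n s = (softplus (z n s) - softplus (- N n)) / (N n)\<^sup>2" for n s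
  define G' where "G' n s = - 1 * logistic (z n s)" for n s
  have zs: "smooth (z n)" for n
    unfolding z_def[abs_def]
    using continuously_differentiable_add[OF continuously_differentiable_bounded_linear[OF bounded_linear_mult_right[of "- (N n)\<^sup>2"]]
        continuously_differentiable_const[of _ "- N n"]] by simp
  show ?thesis
  proof (rule W0_compose_limit[where G = G and G' = G' and L = 1, OF W])
    show "(G n has_real_derivative G' n s) (at s)" for n s
    proof -
      have "(z n has_real_derivative - (N n)\<^sup>2) (at s)"
        unfolding z_def by (auto intro!: derivative_eq_intros)
      from DERIV_chain2[OF has_derivative_softplus this]
      have "((\<lambda>s. softplus (z n s)) has_real_derivative logistic (z n s) * - (N n)\<^sup>2) (at s)" .
      then have "(G n has_real_derivative (logistic (z n s) * - (N n)\<^sup>2 - 0) / (N n)\<^sup>2) (at s)"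
        unfolding G_def by (intro DERIV_cdivide DERIV_diff DERIV_const)
      then show ?thesis using N[of n] by (simp add: G'_def)
    qed
    show "smooth (G' n)" for n unfolding G'_def
      by (intro allI continuously_differentiable_mult continuously_differentiable_const
          continuously_differentiable_compose[OF smooth_logistic[rule_format] zs[rule_format]])
    show "\<bar>G' n s\<bar> \<le> 1" for n s
      using logistic_pos[of "z n s"] logistic_less_one[of "z n s"] by (simp add: G'_def)
    show "G n 0 = 0" for n by (simp add: G_def z_def)
    show "(\<lambda>n. G' n s) \<longlonglongrightarrow> (if s < 0 then - 1 else 0)" for s
    proof (cases "s < 0")
      case True
      have "filterlim (\<lambda>n. N n * (N n * (- s) + (- 1))) at_top sequentially"
      proof (rule filterlim_at_top_mult_at_top[OF Ninf])
        have "filterlim (\<lambda>n. N n * (- s)) at_top sequentially"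
          using True by (intro filterlim_tendsto_pos_mult_at_top[OF tendsto_const _ Ninf, of "- s", simplified mult.commute[of "- s"]]) auto
        then show "filterlim (\<lambda>n. N n * (- s) + (- 1)) at_top sequentially"
          by (subst add.commute) (rule filterlim_tendsto_add_at_top[OF tendsto_const])
      qed
      moreover have "N n * (N n * (- s) + (- 1)) = z n s" for n
        by (simp add: z_def algebra_simps power2_eq_square)
      ultimately have "filterlim (\<lambda>n. z n s) at_top sequentially" by simp
      then have "(\<lambda>n. exp (- z n s)) \<longlonglongrightarrow> 0"
        by (intro filterlim_compose[OF exp_at_bot] filterlim_compose[OF filterlim_uminus_at_bot_at_top])
      then have "(\<lambda>n. G' n s) \<longlonglongrightarrow> - 1 * (1 / (1 + 0))"
        unfolding G'_def logistic_def by (intro tendsto_intros) auto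
      then show ?thesis using True by simp
    next
      case False
      have le: "logistic (z n s) \<le> exp (- N n)" for n
      proof -
        have "logistic (z n s) \<le> exp (z n s)"
          by (simp add: logistic_def exp_minus field_simps add_pos_pos)
        also have "z n s \<le> - N n" using False by (simp add: z_def)
        finally show ?thesis by simp
      qed
      have "(\<lambda>n. exp (- N n)) \<longlonglongrightarrow> 0"
        by (intro filterlim_compose[OF exp_at_bot] filterlim_compose[OF filterlim_uminus_at_bot_at_top] Ninf)
      from tendsto_sandwich[OF _ _ tendsto_const this]
      have "(\<lambda>n. logistic (z n s)) \<longlonglongrightarrow> 0"
        by this (use le logistic_pos less_imp_le in \<open>auto intro!: always_eventually\<close>)
      then have "(\<lambda>n. G' n s) \<longlonglongrightarrow> - 1 * 0" unfolding G'_def by (intro tendsto_intros)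
      then show ?thesis using False by simp
    qed
    show "(\<lambda>n. G n s) \<longlonglongrightarrow> max (- s) 0" for s
    proof -
      have bound: "norm (G n s - max (- s) 0) \<le> 3 * inverse (N n)" for n
      proof -
        have n2: "(N n)\<^sup>2 > 0" using N[of n] by simp
        have "(N n)\<^sup>2 * max (- s) 0 - N n \<le> softplus (z n s)"
        proof (cases "s \<le> 0")
          case True
          then have "(N n)\<^sup>2 * max (- s) 0 - N n = z n s" by (simp add: z_def)
          then show ?thesis using softplus_ge[of "z n s"] by simp
        next
          case False
          then show ?thesis using softplus_pos[of "z n s"] N[of n] by simp
        qed
        moreover have "softplus (z n s) \<le> (N n)\<^sup>2 * max (- s) 0 + ln 2"
        proof -
          have "(N n)\<^sup>2 * (- s) \<le> (N n)\<^sup>2 * max (- s) 0" by (intro mult_left_mono) auto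
          moreover have "0 \<le> (N n)\<^sup>2 * max (- s) 0" by simp
          ultimately have "max (z n s) 0 \<le> (N n)\<^sup>2 * max (- s) 0"
            using N[of n] by (simp add: z_def)
          then show ?thesis using softplus_le[of "z n s"] by linarith
        qed
        moreover have "0 < softplus (- N n)" "softplus (- N n) \<le> ln 2"
          using softplus_pos softplus_le[of "- N n"] N[of n] by auto
        moreover have "ln 2 \<le> (1::real)" using ln_2_less_1 by simp
        ultimately have "\<bar>(softplus (z n s) - softplus (- N n)) - (N n)\<^sup>2 * max (- s) 0\<bar> \<le> 3 * N n"
          using N[of n] by linarith
        moreover have "G n s - max (- s) 0 = ((softplus (z n s) - softplus (- N n)) - (N n)\<^sup>2 * max (- s) 0) / (N n)\<^sup>2"
          using n2 by (simp add: G_def diff_divide_distrib)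
        ultimately have "\<bar>G n s - max (- s) 0\<bar> \<le> 3 * N n / (N n)\<^sup>2"
          using n2 by (simp add: abs_divide divide_right_mono)
        also have "\<dots> = 3 * inverse (N n)" using N[of n] by (simp add: power2_eq_square divide_simps)
        finally show ?thesis by simp
      qed
      have "(\<lambda>n. 3 * inverse (N n)) \<longlonglongrightarrow> 3 * 0"
        unfolding N_def by (intro tendsto_intros LIMSEQ_inverse_real_of_nat)
      then have "(\<lambda>n. 3 * inverse (N n)) \<longlonglongrightarrow> 0" by (simp only: mult_zero_right)
      then have "(\<lambda>n. G n s - max (- s) 0) \<longlonglongrightarrow> 0"
        by (rule Lim_null_comparison[OF always_eventually[OF allI[OF bound]]])
      then show ?thesis by (rule LIM_zero_cancel)
    qed
  qed
qed

section \<open>Weak gradients of elements of $W_0^{1,p}$\<close>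

text \<open>The gradient of the product of two test functions has integral zero.\<close>

lemma integral_by_parts_test:
  assumes \<phi>: "\<phi> \<in> test_functions \<Omega>" and \<psi>: "\<psi> \<in> test_functions \<Omega>"
  shows "(\<integral>x. \<phi> x * (grad \<psi> x \<bullet> i) \<partial>M) = - (\<integral>x. (grad \<phi> x \<bullet> i) * \<psi> x \<partial>M)"
proof -
  note s = test_functions_smooth[OF \<phi>] test_functions_smooth[OF \<psi>]
  have t: "(\<lambda>x. \<phi> x * \<psi> x) \<in> test_functions \<Omega>" by (rule test_functions_mult[OF \<phi> s(2)])
  then have "(\<lambda>x. \<phi> x * \<psi> x) \<in> test_functions UNIV" by (simp add: test_functions_def)
  then have "(\<integral>x. grad (\<lambda>x. \<phi> x * \<psi> x) x \<bullet> i \<partial>lborel) = 0" by (rule integral_grad_eq_0)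
  moreover have "(\<integral>x. grad (\<lambda>x. \<phi> x * \<psi> x) x \<bullet> i \<partial>M) = (\<integral>x. grad (\<lambda>x. \<phi> x * \<psi> x) x \<bullet> i \<partial>lborel)"
    using test_functions_outside[OF t] borel_measurable_continuous_onI[OF continuous_grad[OF test_functions_smooth[OF t]]]
    by (intro integral_lebesgue_on_eq_lborel[OF \<Omega>_sets]) auto
  moreover have "(\<integral>x. grad (\<lambda>x. \<phi> x * \<psi> x) x \<bullet> i \<partial>M) =
      (\<integral>x. \<phi> x * (grad \<psi> x \<bullet> i) + (grad \<phi> x \<bullet> i) * \<psi> x \<partial>M)"
    by (simp add: grad_mult[OF s] inner_add_left mult.commute)
  moreover have "integrable M (\<lambda>x. \<phi> x * (grad \<psi> x \<bullet> i))" if "\<phi> \<in> test_functions \<Omega>" "\<psi> \<in> test_functions \<Omega>" for \<phi> \<psi>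
  proof -
    obtain B where B: "\<And>x. \<bar>\<phi> x\<bar> \<le> B" using test_functions_bounded[OF \<open>\<phi> \<in> test_functions \<Omega>\<close>] by metis
    have "integrable M (\<lambda>x. \<phi> x *\<^sub>R grad \<psi> x)"
      using B that by (intro Lp_integrable Lp_mult_bounded[where B = B] test_function_Lp Lp_measurable)
    then have "integrable M (\<lambda>x. (\<phi> x *\<^sub>R grad \<psi> x) \<bullet> i)" by (intro integrable_inner_left)
    then show ?thesis by simp
  qed
  from this[OF \<phi> \<psi>] this[OF \<psi> \<phi>]
  have "(\<integral>x. \<phi> x * (grad \<psi> x \<bullet> i) + (grad \<phi> x \<bullet> i) * \<psi> x \<partial>M) =
      (\<integral>x. \<phi> x * (grad \<psi> x \<bullet> i) \<partial>M) + (\<integral>x. (grad \<phi> x \<bullet> i) * \<psi> x \<partial>M)"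
    by (intro Bochner_Integration.integral_add) (auto simp: mult.commute)
  ultimately show ?thesis by linarith
qed

lemma Lp_locally_integrable:
  fixes u :: "'a \<Rightarrow> 'b::euclidean_space"
  assumes "u \<in> Lp"
  shows "locally_integrable \<Omega> u"
  unfolding locally_integrable_def
proof (intro conjI allI impI)
  show "u \<in> borel_measurable M" by (rule Lp_measurable[OF assms])
  fix K assume K: "compact K \<and> K \<subseteq> \<Omega>"
  then have Ks: "K \<in> sets lebesgue" using fmeasurableD[OF lmeasurable_compact] by blast
  have "set_integrable M K u"
    unfolding set_integrable_def using Lp_integrable[OF assms] K Ks
    by (intro integrable_mult_indicator) (auto simp: sets_restrict_space)
  then have "integrable (restrict_space M K) u"
    using K Ks by (subst integrable_restrict_space) (auto simp: set_integrable_def sets_restrict_space)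
  moreover have "restrict_space M K = lebesgue_on K"
    using K \<Omega>_sets Ks by (subst restrict_restrict_space) (auto simp: inf.absorb2)
  ultimately show "integrable (lebesgue_on K) u" by simp
qed

lemma Lp_lim_integral_mult:
  fixes F :: "nat \<Rightarrow> 'a \<Rightarrow> real"
  assumes F: "Lp_lim F f" and b: "b \<in> borel_measurable M" "\<And>x. \<bar>b x\<bar> \<le> B"
  shows "(\<lambda>n. \<integral>x. F n x * b x \<partial>M) \<longlonglongrightarrow> (\<integral>x. f x * b x \<partial>M)"
proof -
  have "Lp_lim (\<lambda>n x. b x *\<^sub>R F n x) (\<lambda>x. b x *\<^sub>R f x)"
    using b by (intro Lp_lim_mult[OF F]) auto
  then have l: "Lp_lim (\<lambda>n x. F n x * b x) (\<lambda>x. f x * b x)" by (simp add: mult.commute)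
  have i: "integrable M (\<lambda>x. F n x * b x)" "integrable M (\<lambda>x. f x * b x)" for n
    using l by (auto intro: Lp_integrable dest: Lp_limD)
  have "(\<lambda>n. (\<integral>x. F n x * b x \<partial>M) - (\<integral>x. f x * b x \<partial>M)) \<longlonglongrightarrow> 0"
  proof (rule Lim_null_comparison[OF _ Lp_lim_L1[OF l]])
    show "\<forall>\<^sub>F n in sequentially. norm ((\<integral>x. F n x * b x \<partial>M) - (\<integral>x. f x * b x \<partial>M)) \<le>
        (\<integral>x. norm (F n x * b x - f x * b x) \<partial>M)"
    proof (intro always_eventually allI)
      fix n
      have "(\<integral>x. F n x * b x \<partial>M) - (\<integral>x. f x * b x \<partial>M) = (\<integral>x. F n x * b x - f x * b x \<partial>M)"
        using i by (intro Bochner_Integration.integral_diff[symmetric])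
      then show "norm ((\<integral>x. F n x * b x \<partial>M) - (\<integral>x. f x * b x \<partial>M)) \<le>
          (\<integral>x. norm (F n x * b x - f x * b x) \<partial>M)"
        by (simp only: integral_norm_bound)
    qed
  qed
  then show ?thesis by (rule LIM_zero_cancel)
qed

lemma Lp_lim_inner:
  fixes F :: "nat \<Rightarrow> 'a \<Rightarrow> 'b::euclidean_space"
  assumes "Lp_lim F f" "i \<in> Basis"
  shows "Lp_lim (\<lambda>n x. F n x \<bullet> i) (\<lambda>x. f x \<bullet> i)"
proof (rule Lp_lim_squeeze)
  have i: "(\<lambda>x. h x \<bullet> i) \<in> Lp" if "h \<in> Lp" for h :: "'a \<Rightarrow> 'b"
    using Lp_measurable[OF that] assms(2) by (intro Lp_mono[OF that]) (auto intro: Basis_le_norm)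
  show "(\<lambda>x. F n x \<bullet> i) \<in> Lp" "(\<lambda>x. f x \<bullet> i) \<in> Lp" for n
    using i Lp_limD[OF assms(1)] by blast+
  show "integrable M (\<lambda>x. norm (F n x - f x) powr p)" for n
    by (rule Lp_lim_integrable[OF assms(1)])
  show "AE x in M. norm (F n x \<bullet> i - f x \<bullet> i) powr p \<le> norm (F n x - f x) powr p" for n
    using assms(2) p_gt_1 Basis_le_norm[of i "F n x - f x" for x]
    by (intro AE_I2 powr_mono2) (auto simp: inner_diff_left)
qed (rule Lp_limD(3)[OF assms(1)])

lemma W0_has_weak_gradient:
  assumes "W0 u g"
  shows "has_weak_gradient \<Omega> u g"
  unfolding has_weak_gradient_def
proof (intro conjI ballI)
  show "locally_integrable \<Omega> u" "locally_integrable \<Omega> g"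
    using W0D[OF assms] Lp_locally_integrable by blast+
  fix \<psi> and i :: 'a assume \<psi>: "\<psi> \<in> test_functions \<Omega>" and i: "i \<in> Basis"
  obtain \<phi> where \<phi>: "\<And>n. \<phi> n \<in> test_functions \<Omega>" "Lp_lim \<phi> u" "Lp_lim (\<lambda>n. grad (\<phi> n)) g"
    using assms unfolding W0_def by blast
  note s = test_functions_smooth[OF \<psi>]
  obtain B where B: "\<And>x. \<bar>\<psi> x\<bar> \<le> B" "\<And>x. norm (grad \<psi> x) \<le> B" "0 < B"
    using test_functions_bounded[OF \<psi>] by metis
  have m: "\<psi> \<in> borel_measurable M" "(\<lambda>x. grad \<psi> x \<bullet> i) \<in> borel_measurable M"
    by (intro continuous_measurable_lebesgue_on smooth_continuous[OF s],
        intro continuous_measurable_lebesgue_on continuous_intros continuous_grad[OF s])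
  have 1: "(\<lambda>n. \<integral>x. \<phi> n x * (grad \<psi> x \<bullet> i) \<partial>M) \<longlonglongrightarrow> (\<integral>x. u x * (grad \<psi> x \<bullet> i) \<partial>M)"
    using Basis_le_norm[OF i] B(2) order_trans by (intro Lp_lim_integral_mult[OF \<phi>(2) m(2)]) blast
  have 2: "(\<lambda>n. \<integral>x. (grad (\<phi> n) x \<bullet> i) * \<psi> x \<partial>M) \<longlonglongrightarrow> (\<integral>x. (g x \<bullet> i) * \<psi> x \<partial>M)"
    using B(1) by (intro Lp_lim_integral_mult[OF Lp_lim_inner[OF \<phi>(3) i] m(1)])
  have "(\<lambda>n. \<integral>x. \<phi> n x * (grad \<psi> x \<bullet> i) \<partial>M) \<longlonglongrightarrow> - (\<integral>x. (g x \<bullet> i) * \<psi> x \<partial>M)"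
    unfolding integral_by_parts_test[OF \<phi>(1) \<psi>] by (rule tendsto_minus[OF 2])
  with 1 have "(\<integral>x. u x * (grad \<psi> x \<bullet> i) \<partial>M) = - (\<integral>x. (g x \<bullet> i) * \<psi> x \<partial>M)"
    using LIMSEQ_unique by blast
  then show "(\<integral>x. u x * frechet_derivative \<psi> (at x) i \<partial>M) = - (\<integral>x. (g x \<bullet> i) * \<psi> x \<partial>M)"
    by (simp add: frechet_derivative_grad[OF s])
qed

lemma has_weak_gradient_weak_gradient:
  "has_weak_gradient \<Omega> u g \<Longrightarrow> has_weak_gradient \<Omega> u (weak_gradient \<Omega> u)"
  unfolding weak_gradient_def by (rule someI[of "has_weak_gradient \<Omega> u"])

lemma weak_gradient_AE_eq:
  assumes "has_weak_gradient \<Omega> u g"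
  shows "AE x in M. weak_gradient \<Omega> u x = g x"
proof -
  have "has_weak_gradient \<Omega> u (weak_gradient \<Omega> u)"
    by (rule has_weak_gradient_weak_gradient[OF assms])
  then show ?thesis using weak_gradient_unique[OF open_\<Omega>] assms by blast
qed

lemma has_weak_gradient_diff_test:
  assumes u: "has_weak_gradient \<Omega> u g" and \<phi>: "\<phi> \<in> test_functions \<Omega>"
  shows "has_weak_gradient \<Omega> (\<lambda>x. u x - \<phi> x) (\<lambda>x. g x - grad \<phi> x)"
  unfolding has_weak_gradient_def
proof (intro conjI ballI)
  have h: "has_weak_gradient \<Omega> \<phi> (grad \<phi>)" by (rule W0_has_weak_gradient[OF W0_test_function[OF \<phi>]])
  have l: "locally_integrable \<Omega> u" "locally_integrable \<Omega> g" "locally_integrable \<Omega> \<phi>" "locally_integrable \<Omega> (grad \<phi>)"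
    using u h by (auto simp: has_weak_gradient_def)
  then show "locally_integrable \<Omega> (\<lambda>x. u x - \<phi> x)" "locally_integrable \<Omega> (\<lambda>x. g x - grad \<phi> x)"
    by (auto intro: locally_integrable_diff)
  fix \<psi> and i :: 'a assume \<psi>: "\<psi> \<in> test_functions \<Omega>" and i: "i \<in> Basis"
  note s = test_functions_smooth[OF \<psi>]
  obtain K where K: "compact K" "K \<subseteq> \<Omega>" "\<And>x. x \<notin> K \<Longrightarrow> \<psi> x = 0" "\<And>x. x \<notin> K \<Longrightarrow> grad \<psi> x = 0"
    by (rule test_functions_support[OF \<psi>], rule that)
  have c: "continuous_on UNIV (\<lambda>x. grad \<psi> x \<bullet> i)" by (intro continuous_intros continuous_grad s)
  have i1: "integrable M (\<lambda>x. v x * (grad \<psi> x \<bullet> i))" if "locally_integrable \<Omega> v" for v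
    using K by (intro locally_integrable_mult[OF that open_\<Omega> K(1,2) c]) auto
  have i2: "integrable M (\<lambda>x. (v x \<bullet> i) * \<psi> x)" if "locally_integrable \<Omega> v" for v
    using K by (intro locally_integrable_mult[OF locally_integrable_inner[OF that] open_\<Omega> K(1,2) smooth_continuous[OF s]]) auto
  have eq: "(\<integral>x. v x * (grad \<psi> x \<bullet> i) \<partial>M) = - (\<integral>x. (k x \<bullet> i) * \<psi> x \<partial>M)" if "has_weak_gradient \<Omega> v k" for v k
    using that \<psi> i unfolding has_weak_gradient_def frechet_derivative_grad[OF s, symmetric] by blast
  show "(\<integral>x. (u x - \<phi> x) * frechet_derivative \<psi> (at x) i \<partial>M) = - (\<integral>x. ((g x - grad \<phi> x) \<bullet> i) * \<psi> x \<partial>M)"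
    using eq[OF u] eq[OF h] i1[OF l(1)] i1[OF l(3)] i2[OF l(2)] i2[OF l(4)]
    by (simp add: frechet_derivative_grad[OF s] left_diff_distrib inner_diff_left)
qed

lemma Lp_cong_AE:
  fixes u v :: "'a \<Rightarrow> 'b::euclidean_space"
  assumes "u \<in> Lp" "v \<in> borel_measurable M" "AE x in M. v x = u x"
  shows "v \<in> Lp"
  by (rule Lp_mono[OF assms(1,2)]) (use assms(3) in \<open>auto elim: eventually_mono\<close>)

text \<open>The Sobolev norm is defined with the selected weak gradient of the difference; uniqueness identifies
  it with the difference of the gradients.\<close>

lemma Sobolev_norm_diff_test:
  assumes u: "u \<in> Lp" and g: "g \<in> Lp" and ug: "has_weak_gradient \<Omega> u g" and \<phi>: "\<phi> \<in> test_functions \<Omega>"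
  shows "Sobolev_norm p \<Omega> (\<lambda>x. u x - \<phi> x) =
    ((\<integral>x. norm (\<phi> x - u x) powr p \<partial>M) + (\<integral>x. norm (grad \<phi> x - g x) powr p \<partial>M)) powr (1 / p)"
proof -
  have h: "has_weak_gradient \<Omega> (\<lambda>x. u x - \<phi> x) (\<lambda>x. g x - grad \<phi> x)"
    by (rule has_weak_gradient_diff_test[OF ug \<phi>])
  have "has_weak_gradient \<Omega> (\<lambda>x. u x - \<phi> x) (weak_gradient \<Omega> (\<lambda>x. u x - \<phi> x))"
    by (rule has_weak_gradient_weak_gradient[OF h])
  then have m: "weak_gradient \<Omega> (\<lambda>x. u x - \<phi> x) \<in> borel_measurable M"
    by (auto simp: has_weak_gradient_def locally_integrable_def)
  have "(\<integral>x. norm (weak_gradient \<Omega> (\<lambda>x. u x - \<phi> x) x) powr p \<partial>M) = (\<integral>x. norm (grad \<phi> x - g x) powr p \<partial>M)"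
  proof (rule integral_cong_AE)
    show "(\<lambda>x. norm (grad \<phi> x - g x) powr p) \<in> borel_measurable M"
      using Lp_measurable[OF Lp_diff[OF test_function_Lp(2)[OF \<phi>] g]] by measurable
    show "AE x in M. norm (weak_gradient \<Omega> (\<lambda>x. u x - \<phi> x) x) powr p = norm (grad \<phi> x - g x) powr p"
      using weak_gradient_AE_eq[OF h] by eventually_elim (simp add: norm_minus_commute)
  qed (use m in measurable)
  then show ?thesis by (simp add: Sobolev_norm_def abs_minus_commute)
qed

lemma Sobolev_space0_imp_W0:
  assumes "u \<in> Sobolev_space0 p \<Omega>"
  shows "W0 u (weak_gradient \<Omega> u)"
proof -
  let ?g = "weak_gradient \<Omega> u"
  obtain g0 where g0: "g0 \<in> Lp" "has_weak_gradient \<Omega> u g0" and u: "u \<in> Lp"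
    using assms by (auto simp: Sobolev_space0_def Sobolev_space_def)
  have w: "has_weak_gradient \<Omega> u ?g" by (rule has_weak_gradient_weak_gradient[OF g0(2)])
  then have m: "?g \<in> borel_measurable M" by (auto simp: has_weak_gradient_def locally_integrable_def)
  have g: "?g \<in> Lp" using Lp_cong_AE[OF g0(1) m weak_gradient_AE_eq[OF g0(2)]] .
  have "\<exists>\<phi>\<in>test_functions \<Omega>. Sobolev_norm p \<Omega> (\<lambda>x. u x - \<phi> x) < inverse (real (Suc n)) powr (1 / p)" for n
    using assms by (auto simp: Sobolev_space0_def)
  then obtain \<phi> where \<phi>: "\<And>n. \<phi> n \<in> test_functions \<Omega>"
    "\<And>n. Sobolev_norm p \<Omega> (\<lambda>x. u x - \<phi> n x) < inverse (real (Suc n)) powr (1 / p)" by metis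
  have lt: "(\<integral>x. norm (\<phi> n x - u x) powr p \<partial>M) + (\<integral>x. norm (grad (\<phi> n) x - ?g x) powr p \<partial>M) < inverse (real (Suc n))" for n
  proof (rule ccontr)
    assume "\<not> ?thesis"
    then have "inverse (real (Suc n)) powr (1 / p) \<le>
        ((\<integral>x. norm (\<phi> n x - u x) powr p \<partial>M) + (\<integral>x. norm (grad (\<phi> n) x - ?g x) powr p \<partial>M)) powr (1 / p)"
      using p_gt_1 by (intro powr_mono2) auto
    then show False
      using \<phi>(2)[of n] unfolding Sobolev_norm_diff_test[OF u g w \<phi>(1)] by linarith
  qed
  have nn: "0 \<le> (\<integral>x. norm (F x) powr p \<partial>M)" for F :: "'a \<Rightarrow> 'b::real_normed_vector" by simp
  have "(\<lambda>n. \<integral>x. norm (\<phi> n x - u x) powr p \<partial>M) \<longlonglongrightarrow> 0"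
  proof (rule tendsto_sandwich[OF _ _ tendsto_const LIMSEQ_inverse_real_of_nat])
    show "\<forall>\<^sub>F n in sequentially. (\<integral>x. norm (\<phi> n x - u x) powr p \<partial>M) \<le> inverse (real (Suc n))"
    proof (intro always_eventually allI)
      fix n show "(\<integral>x. norm (\<phi> n x - u x) powr p \<partial>M) \<le> inverse (real (Suc n))"
        using lt[of n] nn[of "\<lambda>x. grad (\<phi> n) x - ?g x"] by linarith
    qed
  qed simp
  moreover have "(\<lambda>n. \<integral>x. norm (grad (\<phi> n) x - ?g x) powr p \<partial>M) \<longlonglongrightarrow> 0"
  proof (rule tendsto_sandwich[OF _ _ tendsto_const LIMSEQ_inverse_real_of_nat])
    show "\<forall>\<^sub>F n in sequentially. (\<integral>x. norm (grad (\<phi> n) x - ?g x) powr p \<partial>M) \<le> inverse (real (Suc n))"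
    proof (intro always_eventually allI)
      fix n show "(\<integral>x. norm (grad (\<phi> n) x - ?g x) powr p \<partial>M) \<le> inverse (real (Suc n))"
        using lt[of n] nn[of "\<lambda>x. \<phi> n x - u x"] by linarith
    qed
  qed simp
  ultimately show ?thesis
    unfolding W0_def Lp_lim_def using \<phi>(1) test_function_Lp u g by blast
qed

lemma W0_imp_Sobolev_space0:
  assumes "W0 u g"
  shows "u \<in> Sobolev_space0 p \<Omega>"
proof -
  note w = W0_has_weak_gradient[OF assms] and L = W0D[OF assms]
  obtain \<phi> where \<phi>: "\<And>n. \<phi> n \<in> test_functions \<Omega>" "Lp_lim \<phi> u" "Lp_lim (\<lambda>n. grad (\<phi> n)) g"
    using assms unfolding W0_def by blast
  have "\<exists>\<phi>\<in>test_functions \<Omega>. Sobolev_norm p \<Omega> (\<lambda>x. u x - \<phi> x) < \<epsilon>" if "\<epsilon> > 0" for \<epsilon>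
  proof -
    have "(\<lambda>n. ((\<integral>x. norm (\<phi> n x - u x) powr p \<partial>M) + (\<integral>x. norm (grad (\<phi> n) x - g x) powr p \<partial>M)) powr (1 / p)) \<longlonglongrightarrow> 0"
    proof (rule tendsto_zero_powrI[where b = "1 / p"])
      show "(\<lambda>n. (\<integral>x. norm (\<phi> n x - u x) powr p \<partial>M) + (\<integral>x. norm (grad (\<phi> n) x - g x) powr p \<partial>M)) \<longlonglongrightarrow> 0"
        using tendsto_add[OF Lp_limD(3)[OF \<phi>(2)] Lp_limD(3)[OF \<phi>(3)]] by simp
    qed (use p_gt_1 in auto)
    then have "(\<lambda>n. Sobolev_norm p \<Omega> (\<lambda>x. u x - \<phi> n x)) \<longlonglongrightarrow> 0"
      using Sobolev_norm_diff_test[OF L w \<phi>(1)] by simp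
    from order_tendstoD(2)[OF this that] show ?thesis
      using \<phi>(1) by (auto simp: eventually_sequentially)
  qed
  then show ?thesis using w L by (auto simp: Sobolev_space0_def Sobolev_space_def)
qed

lemma W0_weak_gradient:
  assumes "W0 u g"
  shows "AE x in M. weak_gradient \<Omega> u x = g x" and "weak_gradient \<Omega> u \<in> Lp"
  using weak_gradient_AE_eq[OF W0_has_weak_gradient[OF assms]]
    W0D[OF Sobolev_space0_imp_W0[OF W0_imp_Sobolev_space0[OF assms]]] by blast+

lemma W0_weak_gradient_integral:
  assumes "W0 u g"
  shows "(\<integral>x. norm (weak_gradient \<Omega> u x) powr p \<partial>M) = (\<integral>x. norm (g x) powr p \<partial>M)"
proof (rule integral_cong_AE)
  show "AE x in M. norm (weak_gradient \<Omega> u x) powr p = norm (g x) powr p"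
    using W0_weak_gradient(1)[OF assms] by eventually_elim simp
qed (use Lp_measurable[OF W0_weak_gradient(2)[OF assms]] Lp_measurable[OF W0D(2)[OF assms]] in measurable)

end

section \<open>A Poincare inequality on balls\<close>

lemma nn_integral_affine_le:
  fixes f :: "'a::euclidean_space \<Rightarrow> ennreal"
  assumes "f \<in> borel_measurable borel" "1 / 2 \<le> c"
  shows "(\<integral>\<^sup>+x. f (t + c *\<^sub>R x) \<partial>lborel) \<le> 2 ^ DIM('a) * (\<integral>\<^sup>+x. f x \<partial>lborel)"
proof -
  have c: "c \<noteq> 0" "\<bar>c\<bar> = c" using assms(2) by auto
  have "(\<integral>\<^sup>+x. f x \<partial>lborel) =
      (\<integral>\<^sup>+x. f x \<partial>density (distr lborel borel (\<lambda>x. t + c *\<^sub>R x)) (\<lambda>_. ennreal (\<bar>c\<bar> ^ DIM('a))))"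
    by (subst lborel_affine[OF c(1), of t]) (rule refl)
  also have "\<dots> = (\<integral>\<^sup>+x. ennreal (c ^ DIM('a)) * f (t + c *\<^sub>R x) \<partial>lborel)"
    using assms(1) c by (simp add: nn_integral_density nn_integral_distr)
  also have "\<dots> = ennreal (c ^ DIM('a)) * (\<integral>\<^sup>+x. f (t + c *\<^sub>R x) \<partial>lborel)"
    by (intro nn_integral_cmult) (use assms(1) in measurable)
  finally have eq: "(\<integral>\<^sup>+x. f x \<partial>lborel) = ennreal (c ^ DIM('a)) * (\<integral>\<^sup>+x. f (t + c *\<^sub>R x) \<partial>lborel)" .
  have "1 \<le> (2 * c) ^ DIM('a)" using assms(2) by (intro one_le_power) simp
  then have "1 \<le> ennreal (2 ^ DIM('a) * c ^ DIM('a))" by (simp add: power_mult_distrib)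
  also have "\<dots> = 2 ^ DIM('a) * ennreal (c ^ DIM('a))"
    using assms(2) by (simp add: ennreal_mult ennreal_power[symmetric])
  finally have "1 * (\<integral>\<^sup>+x. f (t + c *\<^sub>R x) \<partial>lborel) \<le>
      (2 ^ DIM('a) * ennreal (c ^ DIM('a))) * (\<integral>\<^sup>+x. f (t + c *\<^sub>R x) \<partial>lborel)"
    by (rule mult_right_mono) simp
  then show ?thesis by (simp add: eq mult.assoc)
qed

lemma smooth_diff_le_segment_integral:
  fixes \<phi> :: "'a::euclidean_space \<Rightarrow> real"
  assumes s: "smooth \<phi>"
  shows "ennreal \<bar>\<phi> x - \<phi> y\<bar> \<le>
    (\<integral>\<^sup>+t. ennreal (norm (x - y)) * (ennreal (norm (grad \<phi> (y + t *\<^sub>R (x - y)))) * indicator {0..1} t) \<partial>lborel)"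
proof -
  let ?h = "\<lambda>t. \<phi> (y + t *\<^sub>R (x - y))" and ?h' = "\<lambda>t. grad \<phi> (y + t *\<^sub>R (x - y)) \<bullet> (x - y)"
  have c: "continuous_on UNIV ?h'"
    by (intro continuous_intros continuous_on_compose2[OF continuous_grad[OF s, of UNIV]]) auto
  have d: "(?h has_real_derivative ?h' t) (at t)" for t
  proof -
    have "((\<lambda>t. y + t *\<^sub>R (x - y)) has_derivative (\<lambda>r. r *\<^sub>R (x - y))) (at t)"
      by (auto intro!: derivative_eq_intros)
    from has_derivative_compose[OF this has_derivative_grad[OF s]]
    show ?thesis by (simp add: has_field_derivative_def mult_commute_abs)
  qed
  have eq: "(\<integral>t. indicator {0..1} t *\<^sub>R ?h' t \<partial>lborel) = ?h 1 - ?h 0"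
  proof (rule integral_FTC_Icc)
    show "(?h has_vector_derivative ?h' t) (at t within {0..1})" for t
      using has_vector_derivative_at_within[OF d[of t, unfolded has_real_derivative_iff_has_vector_derivative]] .
    show "continuous_on {0..1} ?h'" using c continuous_on_subset by blast
  qed simp
  have "ennreal \<bar>\<phi> x - \<phi> y\<bar> = ennreal (norm (\<integral>t. indicator {0..1} t *\<^sub>R ?h' t \<partial>lborel))"
    unfolding eq by simp
  also have "\<dots> \<le> (\<integral>\<^sup>+t. norm (indicator {0..1} t *\<^sub>R ?h' t) \<partial>lborel)"
    using borel_integrable_compact[of "{0..1}" ?h'] c continuous_on_subset
    by (intro integral_norm_bound_ennreal) (auto simp: set_integrable_def)
  also have "\<dots> \<le> (\<integral>\<^sup>+t. ennreal (norm (x - y)) * (ennreal (norm (grad \<phi> (y + t *\<^sub>R (x - y)))) * indicator {0..1} t) \<partial>lborel)"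
  proof (rule nn_integral_mono)
    fix t
    have "norm (?h' t) \<le> norm (x - y) * norm (grad \<phi> (y + t *\<^sub>R (x - y)))"
      using Cauchy_Schwarz_ineq2[of "grad \<phi> (y + t *\<^sub>R (x - y))" "x - y"] by (simp add: mult.commute)
    then have "ennreal (norm (?h' t)) \<le> ennreal (norm (x - y)) * ennreal (norm (grad \<phi> (y + t *\<^sub>R (x - y))))"
      by (simp add: ennreal_mult[symmetric] ennreal_leI)
    then show "ennreal (norm (indicator {0..1} t *\<^sub>R ?h' t)) \<le>
      ennreal (norm (x - y)) * (ennreal (norm (grad \<phi> (y + t *\<^sub>R (x - y)))) * indicator {0..1} t)"
      by (auto simp: indicator_def)
  qed
  finally show ?thesis .
qed

text \<open>The difference \<open>\<phi> x - \<phi> y\<close> is an integral of the gradient over the segment from \<open>y\<close> to \<open>x\<close>.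
  The point at parameter \<open>t\<close> of that segment is an affine function of \<open>x\<close> with factor \<open>t\<close>, and of
  \<open>y\<close> with factor \<open>1 - t\<close>; one of the factors is at least one half, and the change of variables
  is made in that variable.\<close>

lemma Poincare_double_integral:
  fixes \<phi> :: "'a::euclidean_space \<Rightarrow> real" and x0 :: 'a and R :: real
  assumes s: "smooth \<phi>"
  defines B_def: "B \<equiv> ball x0 R"
  shows "(\<integral>\<^sup>+y. (\<integral>\<^sup>+x. ennreal \<bar>\<phi> x - \<phi> y\<bar> * indicator B x \<partial>lborel) * indicator B y \<partial>lborel) \<le>
    ennreal (2 * R) * (2 ^ DIM('a) * emeasure lborel B * (\<integral>\<^sup>+x. ennreal (norm (grad \<phi> x)) * indicator B x \<partial>lborel))"
proof -
  have [measurable]: "\<phi> \<in> borel_measurable borel" "grad \<phi> \<in> borel_measurable borel"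
    using smooth_continuous[OF s] continuous_grad[OF s] borel_measurable_continuous_onI by blast+
  have [measurable]: "B \<in> sets borel" by (simp add: B_def)
  define g where "g x = ennreal (norm (grad \<phi> x))" for x
  have [measurable]: "g \<in> borel_measurable borel" unfolding g_def by measurable
  define k where "k x y t = indicator B x * indicator B y * indicator {0..1::real} t * g (y + t *\<^sub>R (x - y))" for x y t
  define I where "I = (\<integral>\<^sup>+x. g x * indicator B x \<partial>lborel)"
  have km: "(\<lambda>(x, y, t). k x y t) \<in> borel_measurable (borel \<Otimes>\<^sub>M borel \<Otimes>\<^sub>M borel)"
    unfolding k_def by measurable
  have [measurable]: "(\<lambda>(x, t). k x y t) \<in> borel_measurable (lborel \<Otimes>\<^sub>M lborel)" for y
    unfolding k_def by measurable
  have [measurable]: "(\<lambda>(x, y). k x y t) \<in> borel_measurable (lborel \<Otimes>\<^sub>M lborel)" for t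
    unfolding k_def by measurable
  have le: "(\<integral>\<^sup>+y. (\<integral>\<^sup>+x. k x y t \<partial>lborel) \<partial>lborel) \<le> 2 ^ DIM('a) * emeasure lborel B * I * indicator {0..1} t" for t
  proof (cases "t \<in> {0..1}")
    case True
    have inB: "y + t *\<^sub>R (x - y) \<in> B" if "x \<in> B" "y \<in> B" for x y
    proof -
      have "(1 - t) *\<^sub>R y + t *\<^sub>R x \<in> B"
        using convex_ball[of x0 R] that True unfolding B_def by (intro convexD) auto
      then show ?thesis by (simp add: algebra_simps)
    qed
    have const: "(\<integral>\<^sup>+y. indicator B y * (2 ^ DIM('a) * I) \<partial>lborel) = 2 ^ DIM('a) * emeasure lborel B * I"
      by (subst nn_integral_multc) (auto simp: mult_ac)
    show ?thesis
    proof (cases "1 / 2 \<le> t")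
      case half: True
      have "(\<integral>\<^sup>+x. k x y t \<partial>lborel) \<le> indicator B y * (2 ^ DIM('a) * I)" for y
      proof (cases "y \<in> B")
        case True
        have "(\<integral>\<^sup>+x. k x y t \<partial>lborel) \<le>
            (\<integral>\<^sup>+x. g ((1 - t) *\<^sub>R y + t *\<^sub>R x) * indicator B ((1 - t) *\<^sub>R y + t *\<^sub>R x) \<partial>lborel)"
        proof (rule nn_integral_mono)
          fix x
          have "(1 - t) *\<^sub>R y + t *\<^sub>R x = y + t *\<^sub>R (x - y)" by (simp add: algebra_simps)
          then show "k x y t \<le> g ((1 - t) *\<^sub>R y + t *\<^sub>R x) * indicator B ((1 - t) *\<^sub>R y + t *\<^sub>R x)"
            using inB[of x y] by (auto simp: k_def indicator_def)
        qed
        also have "\<dots> \<le> 2 ^ DIM('a) * I"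
          unfolding I_def using half
          by (rule nn_integral_affine_le[of "\<lambda>x. g x * indicator B x", rotated]) measurable
        finally show ?thesis using True by simp
      qed (simp add: k_def)
      then have "(\<integral>\<^sup>+y. (\<integral>\<^sup>+x. k x y t \<partial>lborel) \<partial>lborel) \<le> (\<integral>\<^sup>+y. indicator B y * (2 ^ DIM('a) * I) \<partial>lborel)"
        by (intro nn_integral_mono)
      then show ?thesis using const True by simp
    next
      case half: False
      have "(\<integral>\<^sup>+y. k x y t \<partial>lborel) \<le> indicator B x * (2 ^ DIM('a) * I)" for x
      proof (cases "x \<in> B")
        case True
        have "(\<integral>\<^sup>+y. k x y t \<partial>lborel) \<le>
            (\<integral>\<^sup>+y. g (t *\<^sub>R x + (1 - t) *\<^sub>R y) * indicator B (t *\<^sub>R x + (1 - t) *\<^sub>R y) \<partial>lborel)"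
        proof (rule nn_integral_mono)
          fix y
          have "t *\<^sub>R x + (1 - t) *\<^sub>R y = y + t *\<^sub>R (x - y)" by (simp add: algebra_simps)
          then show "k x y t \<le> g (t *\<^sub>R x + (1 - t) *\<^sub>R y) * indicator B (t *\<^sub>R x + (1 - t) *\<^sub>R y)"
            using inB[of x y] by (auto simp: k_def indicator_def)
        qed
        also have "\<dots> \<le> 2 ^ DIM('a) * I"
          unfolding I_def
        proof (rule nn_integral_affine_le[of "\<lambda>x. g x * indicator B x"])
          show "1 / 2 \<le> 1 - t" using half by simp
        qed measurable
        finally show ?thesis using True by simp
      qed (simp add: k_def)
      then have "(\<integral>\<^sup>+x. (\<integral>\<^sup>+y. k x y t \<partial>lborel) \<partial>lborel) \<le> (\<integral>\<^sup>+y. indicator B y * (2 ^ DIM('a) * I) \<partial>lborel)"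
        by (intro nn_integral_mono)
      moreover have "(\<integral>\<^sup>+y. (\<integral>\<^sup>+x. k x y t \<partial>lborel) \<partial>lborel) = (\<integral>\<^sup>+x. (\<integral>\<^sup>+y. k x y t \<partial>lborel) \<partial>lborel)"
        by (rule lborel_pair.Fubini') measurable
      ultimately show ?thesis using const True by simp
    qed
  qed (simp add: k_def)
  have "(\<integral>\<^sup>+y. (\<integral>\<^sup>+x. ennreal \<bar>\<phi> x - \<phi> y\<bar> * indicator B x \<partial>lborel) * indicator B y \<partial>lborel) \<le>
      (\<integral>\<^sup>+y. (\<integral>\<^sup>+x. ennreal (2 * R) * (\<integral>\<^sup>+t. k x y t \<partial>lborel) \<partial>lborel) \<partial>lborel)"
  proof (rule nn_integral_mono)
    fix y
    show "(\<integral>\<^sup>+x. ennreal \<bar>\<phi> x - \<phi> y\<bar> * indicator B x \<partial>lborel) * indicator B y \<le>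
      (\<integral>\<^sup>+x. ennreal (2 * R) * (\<integral>\<^sup>+t. k x y t \<partial>lborel) \<partial>lborel)"
    proof (cases "y \<in> B")
      case y: True
      have "(\<integral>\<^sup>+x. ennreal \<bar>\<phi> x - \<phi> y\<bar> * indicator B x \<partial>lborel) \<le>
          (\<integral>\<^sup>+x. ennreal (2 * R) * (\<integral>\<^sup>+t. k x y t \<partial>lborel) \<partial>lborel)"
      proof (rule nn_integral_mono)
        fix x
        show "ennreal \<bar>\<phi> x - \<phi> y\<bar> * indicator B x \<le> ennreal (2 * R) * (\<integral>\<^sup>+t. k x y t \<partial>lborel)"
        proof (cases "x \<in> B")
          case x: True
          have "norm (x - y) \<le> 2 * R"
            using x y dist_triangle2[of x y x0] by (simp add: B_def dist_norm norm_minus_commute)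
          then have nle: "ennreal (norm (x - y)) \<le> ennreal (2 * R)" by (rule ennreal_leI)
          have "ennreal \<bar>\<phi> x - \<phi> y\<bar> \<le> (\<integral>\<^sup>+t. ennreal (norm (x - y)) * (g (y + t *\<^sub>R (x - y)) * indicator {0..1} t) \<partial>lborel)"
            unfolding g_def by (rule smooth_diff_le_segment_integral[OF s])
          also have "\<dots> \<le> (\<integral>\<^sup>+t. ennreal (2 * R) * k x y t \<partial>lborel)"
            using x y nle by (intro nn_integral_mono) (auto simp: k_def indicator_def intro: mult_right_mono)
          also have "\<dots> = ennreal (2 * R) * (\<integral>\<^sup>+t. k x y t \<partial>lborel)"
            unfolding k_def by (intro nn_integral_cmult) measurable
          finally show ?thesis using x by simp
        qed simp
      qed
      then show ?thesis using y by simp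
    qed simp
  qed
  also have "\<dots> = ennreal (2 * R) * (\<integral>\<^sup>+y. (\<integral>\<^sup>+x. (\<integral>\<^sup>+t. k x y t \<partial>lborel) \<partial>lborel) \<partial>lborel)"
    unfolding k_def by (subst nn_integral_cmult nn_integral_cmult, measurable)+
  also have "(\<integral>\<^sup>+y. (\<integral>\<^sup>+x. (\<integral>\<^sup>+t. k x y t \<partial>lborel) \<partial>lborel) \<partial>lborel) =
      (\<integral>\<^sup>+y. (\<integral>\<^sup>+t. (\<integral>\<^sup>+x. k x y t \<partial>lborel) \<partial>lborel) \<partial>lborel)"
    by (intro nn_integral_cong lborel_pair.Fubini'[symmetric]) measurable
  also have "\<dots> = (\<integral>\<^sup>+t. (\<integral>\<^sup>+y. (\<integral>\<^sup>+x. k x y t \<partial>lborel) \<partial>lborel) \<partial>lborel)"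
    unfolding k_def by (intro lborel_pair.Fubini'[symmetric]) measurable
  also have "\<dots> \<le> (\<integral>\<^sup>+t. 2 ^ DIM('a) * emeasure lborel B * I * indicator {0..1::real} t \<partial>lborel)"
    by (rule nn_integral_mono, rule le)
  also have "\<dots> = 2 ^ DIM('a) * emeasure lborel B * I"
    by (subst nn_integral_cmult) auto
  finally show ?thesis by (simp add: I_def g_def mult_left_mono)
qed

text \<open>Integrate \<open>\<bar>\<phi> x\<bar> \<le> \<bar>\<phi> x - \<phi> y\<bar> + \<bar>\<phi> y\<bar>\<close> over \<open>x\<close> in the ball and \<open>y\<close> in \<open>Z\<close>.\<close>

lemma Poincare_smooth:
  fixes \<phi> :: "'a::euclidean_space \<Rightarrow> real" and x0 :: 'a and R :: real
  assumes s: "smooth \<phi>" and R: "0 < R" and Z: "Z \<in> sets lebesgue" "Z \<subseteq> ball x0 R"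
  defines B_def: "B \<equiv> ball x0 R"
  shows "measure lebesgue Z * (\<integral>x. \<bar>\<phi> x\<bar> \<partial>lebesgue_on B) \<le>
    2 * R * 2 ^ DIM('a) * measure lebesgue B * (\<integral>x. norm (grad \<phi> x) \<partial>lebesgue_on B) +
    measure lebesgue B * (\<integral>x. \<bar>\<phi> x\<bar> \<partial>lebesgue_on Z)"
proof -
  have mb: "\<phi> \<in> borel_measurable borel" "grad \<phi> \<in> borel_measurable borel"
    using smooth_continuous[OF s] continuous_grad[OF s] borel_measurable_continuous_onI by blast+
  note mb[measurable]
  have [measurable]: "B \<in> sets borel" by (simp add: B_def)
  have BL: "B \<in> lmeasurable" by (simp add: B_def)
  have ZL: "Z \<in> lmeasurable" using bounded_subset[OF bounded_ball Z(2)] Z(1) by (rule bounded_set_imp_lmeasurable)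
  have eB: "emeasure lborel B = ennreal (measure lebesgue B)" "emeasure lebesgue B = ennreal (measure lebesgue B)"
    using emeasure_eq_ennreal_measure[of lborel B] emeasure_bounded_finite[of B]
    by (simp_all add: B_def less_top[symmetric] emeasure_eq_measure2)
  have ZB: "Z \<subseteq> B" using Z(2) by (simp add: B_def)
  have eZ: "emeasure lebesgue Z = ennreal (measure lebesgue Z)" using ZL by (simp add: emeasure_eq_measure2)
  have bd: "\<exists>K. \<forall>x\<in>S. norm (h x) \<le> K" if "continuous_on UNIV h" "S \<subseteq> B" for h :: "'a \<Rightarrow> 'c::real_normed_vector" and S
  proof -
    have "compact (h ` cball x0 R)"
      by (intro compact_continuous_image continuous_on_subset[OF that(1)]) auto
    then obtain K where "\<forall>y\<in>h ` cball x0 R. norm y \<le> K" using compact_imp_bounded bounded_iff by metis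
    then show ?thesis using that(2) ball_subset_cball[of x0 R] unfolding B_def by blast
  qed
  have int: "integrable (lebesgue_on S) (\<lambda>x. norm (h x))"
    if c: "continuous_on UNIV h" and S: "S \<subseteq> B" "S \<in> lmeasurable" for h :: "'a \<Rightarrow> 'c::euclidean_space" and S
  proof -
    interpret finite_measure "lebesgue_on S" by (rule finite_measure_lebesgue_on[OF S(2)])
    obtain K where "\<forall>x\<in>S. norm (h x) \<le> K" using bd[OF c S(1)] by blast
    then show ?thesis
      using continuous_measurable_lebesgue_on[OF c, of S]
      by (intro integrable_const_bound[where B = K]) auto
  qed
  have conv: "(\<integral>\<^sup>+x. ennreal (norm (h x)) * indicator S x \<partial>lebesgue) = ennreal (\<integral>x. norm (h x) \<partial>lebesgue_on S)"
    if c: "continuous_on UNIV h" and S: "S \<subseteq> B" "S \<in> lmeasurable" for h :: "'a \<Rightarrow> 'c::euclidean_space" and S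
  proof -
    have "(\<integral>\<^sup>+x. ennreal (norm (h x)) * indicator S x \<partial>lebesgue) = (\<integral>\<^sup>+x. ennreal (norm (h x)) \<partial>lebesgue_on S)"
      using S(2) by (intro nn_integral_restrict_space[symmetric]) auto
    also have "\<dots> = ennreal (\<integral>x. norm (h x) \<partial>lebesgue_on S)"
      by (rule nn_integral_eq_integral[OF int[OF c S]]) simp
    finally show ?thesis .
  qed
  note c\<phi> = smooth_continuous[OF s, of UNIV] and cg = continuous_grad[OF s, of UNIV]
  have "ennreal (measure lebesgue Z * (\<integral>x. \<bar>\<phi> x\<bar> \<partial>lebesgue_on B)) =
      emeasure lebesgue Z * (\<integral>\<^sup>+x. ennreal \<bar>\<phi> x\<bar> * indicator B x \<partial>lebesgue)"
    using conv[OF c\<phi> _ BL] by (simp add: eZ ennreal_mult)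
  also have "\<dots> = (\<integral>\<^sup>+y. (\<integral>\<^sup>+x. ennreal \<bar>\<phi> x\<bar> * indicator B x \<partial>lborel) * indicator Z y \<partial>lebesgue)"
    using Z(1) by (subst nn_integral_cmult_indicator) (auto simp: nn_integral_completion mult.commute)
  also have "\<dots> \<le> (\<integral>\<^sup>+y. (\<integral>\<^sup>+x. ennreal \<bar>\<phi> x - \<phi> y\<bar> * indicator B x \<partial>lborel) * indicator B y
      + emeasure lborel B * (ennreal \<bar>\<phi> y\<bar> * indicator Z y) \<partial>lebesgue)"
  proof (rule nn_integral_mono)
    fix y
    show "(\<integral>\<^sup>+x. ennreal \<bar>\<phi> x\<bar> * indicator B x \<partial>lborel) * indicator Z y \<le>
        (\<integral>\<^sup>+x. ennreal \<bar>\<phi> x - \<phi> y\<bar> * indicator B x \<partial>lborel) * indicator B y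
      + emeasure lborel B * (ennreal \<bar>\<phi> y\<bar> * indicator Z y)"
    proof (cases "y \<in> Z")
      case True
      then have "y \<in> B" using Z(2) by (auto simp: B_def)
      have "(\<integral>\<^sup>+x. ennreal \<bar>\<phi> x\<bar> * indicator B x \<partial>lborel) \<le>
          (\<integral>\<^sup>+x. ennreal \<bar>\<phi> x - \<phi> y\<bar> * indicator B x + ennreal \<bar>\<phi> y\<bar> * indicator B x \<partial>lborel)"
      proof (rule nn_integral_mono)
        fix x
        have "ennreal \<bar>\<phi> x\<bar> \<le> ennreal \<bar>\<phi> x - \<phi> y\<bar> + ennreal \<bar>\<phi> y\<bar>"
          by (simp add: ennreal_plus[symmetric] ennreal_leI del: ennreal_plus)
        then show "ennreal \<bar>\<phi> x\<bar> * indicator B x \<le> ennreal \<bar>\<phi> x - \<phi> y\<bar> * indicator B x + ennreal \<bar>\<phi> y\<bar> * indicator B x"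
          by (auto simp: indicator_def)
      qed
      also have "\<dots> = (\<integral>\<^sup>+x. ennreal \<bar>\<phi> x - \<phi> y\<bar> * indicator B x \<partial>lborel) + ennreal \<bar>\<phi> y\<bar> * emeasure lborel B"
        by (subst nn_integral_add) (auto simp: nn_integral_cmult_indicator)
      finally show ?thesis using True \<open>y \<in> B\<close> by (simp add: mult.commute)
    qed simp
  qed
  also have "\<dots> = (\<integral>\<^sup>+y. (\<integral>\<^sup>+x. ennreal \<bar>\<phi> x - \<phi> y\<bar> * indicator B x \<partial>lborel) * indicator B y \<partial>lebesgue)
      + (\<integral>\<^sup>+y. emeasure lborel B * (ennreal \<bar>\<phi> y\<bar> * indicator Z y) \<partial>lebesgue)"
  proof (rule nn_integral_add)
    have "(\<lambda>y. (\<integral>\<^sup>+x. ennreal \<bar>\<phi> x - \<phi> y\<bar> * indicator B x \<partial>lborel) * indicator B y) \<in> borel_measurable lborel"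
      by measurable
    then show "(\<lambda>y. (\<integral>\<^sup>+x. ennreal \<bar>\<phi> x - \<phi> y\<bar> * indicator B x \<partial>lborel) * indicator B y) \<in> borel_measurable lebesgue"
      by (rule measurable_completion)
    have "\<phi> \<in> borel_measurable lebesgue" using mb(1) by (intro measurable_completion) simp
    then show "(\<lambda>y. emeasure lborel B * (ennreal \<bar>\<phi> y\<bar> * indicator Z y)) \<in> borel_measurable lebesgue"
      using Z(1) by measurable
  qed
  also have "(\<integral>\<^sup>+y. emeasure lborel B * (ennreal \<bar>\<phi> y\<bar> * indicator Z y) \<partial>lebesgue) =
      emeasure lborel B * (\<integral>\<^sup>+y. ennreal \<bar>\<phi> y\<bar> * indicator Z y \<partial>lebesgue)"
  proof (rule nn_integral_cmult)
    have "\<phi> \<in> borel_measurable lebesgue" using mb(1) by (intro measurable_completion) simp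
    then show "(\<lambda>y. ennreal \<bar>\<phi> y\<bar> * indicator Z y) \<in> borel_measurable lebesgue"
      using Z(1) by measurable
  qed
  also have "\<dots> = ennreal (measure lebesgue B * (\<integral>x. \<bar>\<phi> x\<bar> \<partial>lebesgue_on Z))"
    unfolding eB using conv[OF c\<phi> ZB ZL] by (simp add: ennreal_mult)
  also have "(\<integral>\<^sup>+y. (\<integral>\<^sup>+x. ennreal \<bar>\<phi> x - \<phi> y\<bar> * indicator B x \<partial>lborel) * indicator B y \<partial>lebesgue) =
      (\<integral>\<^sup>+y. (\<integral>\<^sup>+x. ennreal \<bar>\<phi> x - \<phi> y\<bar> * indicator B x \<partial>lborel) * indicator B y \<partial>lborel)"
    by (rule nn_integral_completion)
  also have "\<dots> \<le> ennreal (2 * R) * (2 ^ DIM('a) * emeasure lborel B * (\<integral>\<^sup>+x. ennreal (norm (grad \<phi> x)) * indicator B x \<partial>lborel))"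
    unfolding B_def by (rule Poincare_double_integral[OF s])
  also have "(\<integral>\<^sup>+x. ennreal (norm (grad \<phi> x)) * indicator B x \<partial>lborel) = ennreal (\<integral>x. norm (grad \<phi> x) \<partial>lebesgue_on B)"
    using conv[OF cg _ BL] by (simp add: nn_integral_completion)
  also have "ennreal (2 * R) * (2 ^ DIM('a) * emeasure lborel B * ennreal (\<integral>x. norm (grad \<phi> x) \<partial>lebesgue_on B)) =
      ennreal (2 * R * 2 ^ DIM('a) * measure lebesgue B * (\<integral>x. norm (grad \<phi> x) \<partial>lebesgue_on B))"
    using R by (simp add: eB ennreal_mult ennreal_power[symmetric] mult.assoc)
  finally have "ennreal (measure lebesgue Z * (\<integral>x. \<bar>\<phi> x\<bar> \<partial>lebesgue_on B)) \<le>
     ennreal (2 * R * 2 ^ DIM('a) * measure lebesgue B * (\<integral>x. norm (grad \<phi> x) \<partial>lebesgue_on B)) +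
     ennreal (measure lebesgue B * (\<integral>x. \<bar>\<phi> x\<bar> \<partial>lebesgue_on Z))"
    by (simp add: add_right_mono)
  also have "\<dots> = ennreal (2 * R * 2 ^ DIM('a) * measure lebesgue B * (\<integral>x. norm (grad \<phi> x) \<partial>lebesgue_on B) +
     measure lebesgue B * (\<integral>x. \<bar>\<phi> x\<bar> \<partial>lebesgue_on Z))"
    using R by (intro ennreal_plus[symmetric] mult_nonneg_nonneg integral_nonneg_AE) auto
  finally show ?thesis
    using R by (subst (asm) ennreal_le_iff) (auto intro!: add_nonneg_nonneg mult_nonneg_nonneg integral_nonneg_AE)
qed

context bounded_open
begin

lemma integral_lebesgue_on_subset:
  fixes f :: "'a \<Rightarrow> real"
  assumes "S \<subseteq> \<Omega>" "S \<in> sets lebesgue"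
  shows "(\<integral>x. f x \<partial>lebesgue_on S) = (\<integral>x. f x * indicator S x \<partial>M)"
proof -
  have "(\<integral>x. f x * indicator S x \<partial>M) = (\<integral>x. indicator \<Omega> x *\<^sub>R (f x * indicator S x) \<partial>lebesgue)"
    using \<Omega>_sets by (intro integral_restrict_space) auto
  also have "\<dots> = (\<integral>x. indicator S x *\<^sub>R f x \<partial>lebesgue)"
    using assms(1) by (intro Bochner_Integration.integral_cong) (auto simp: indicator_def)
  also have "\<dots> = (\<integral>x. f x \<partial>lebesgue_on S)"
    using assms(2) by (intro integral_restrict_space[symmetric]) auto
  finally show ?thesis ..
qed

lemma Lp_lim_norm_integral:
  fixes F :: "nat \<Rightarrow> 'a \<Rightarrow> 'b::euclidean_space"
  assumes F: "Lp_lim F f" and S: "S \<subseteq> \<Omega>" "S \<in> sets lebesgue"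
  shows "(\<lambda>n. \<integral>x. norm (F n x) * indicator S x \<partial>M) \<longlonglongrightarrow> (\<integral>x. norm (f x) * indicator S x \<partial>M)"
proof (rule Lp_lim_integral_mult)
  have n: "(\<lambda>x. norm (h x)) \<in> Lp" if "h \<in> Lp" for h :: "'a \<Rightarrow> 'b"
    using Lp_measurable[OF that] by (intro Lp_mono[OF that]) auto
  show "Lp_lim (\<lambda>n x. norm (F n x)) (\<lambda>x. norm (f x))"
  proof (rule Lp_lim_squeeze[OF n[OF Lp_limD(1)[OF F]] n[OF Lp_limD(2)[OF F]] Lp_lim_integrable[OF F] Lp_limD(3)[OF F]])
    show "AE x in M. norm (norm (F n x) - norm (f x)) powr p \<le> norm (F n x - f x) powr p" for n
      using p_gt_1 norm_triangle_ineq3[of "F n x" "f x" for x] by (intro AE_I2 powr_mono2) auto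
  qed
  have "S \<in> sets M" using S by (simp add: sets_restrict_space image_iff) (metis Int_absorb1)
  then show "indicator S \<in> borel_measurable M" by measurable
  show "\<bar>indicator S x\<bar> \<le> (1::real)" for x by (simp add: indicator_def)
qed

lemma W0_Poincare:
  assumes W: "W0 v h" and R: "0 < R" "ball x0 R \<subseteq> \<Omega>"
    and Z: "Z \<in> sets lebesgue" "Z \<subseteq> ball x0 R" "\<And>x. x \<in> Z \<Longrightarrow> v x = 0"
  shows "measure lebesgue Z * (\<integral>x. \<bar>v x\<bar> * indicator (ball x0 R) x \<partial>M) \<le>
    2 * R * 2 ^ DIM('a) * measure lebesgue (ball x0 R) * (\<integral>x. norm (h x) * indicator (ball x0 R) x \<partial>M)"
proof -
  let ?B = "ball x0 R"
  obtain \<phi> where \<phi>: "\<And>n. \<phi> n \<in> test_functions \<Omega>" "Lp_lim \<phi> v" "Lp_lim (\<lambda>n. grad (\<phi> n)) h"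
    using W unfolding W0_def by blast
  have B: "?B \<subseteq> \<Omega>" "?B \<in> sets lebesgue" using R by auto
  have ZO: "Z \<subseteq> \<Omega>" "Z \<in> sets lebesgue" using R Z by auto
  let ?C = "2 * R * 2 ^ DIM('a) * measure lebesgue ?B"
  have "measure lebesgue Z * (\<integral>x. norm (\<phi> n x) * indicator ?B x \<partial>M) \<le>
    ?C * (\<integral>x. norm (grad (\<phi> n) x) * indicator ?B x \<partial>M) +
    measure lebesgue ?B * (\<integral>x. norm (\<phi> n x) * indicator Z x \<partial>M)" for n
    using Poincare_smooth[OF test_functions_smooth[OF \<phi>(1)] R(1) Z(1,2), of n]
    by (simp add: integral_lebesgue_on_subset[OF B] integral_lebesgue_on_subset[OF ZO])
  moreover have "(\<lambda>n. measure lebesgue Z * (\<integral>x. norm (\<phi> n x) * indicator ?B x \<partial>M)) \<longlonglongrightarrow>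
      measure lebesgue Z * (\<integral>x. norm (v x) * indicator ?B x \<partial>M)"
    by (intro tendsto_intros Lp_lim_norm_integral[OF \<phi>(2) B])
  moreover have "(\<lambda>n. ?C * (\<integral>x. norm (grad (\<phi> n) x) * indicator ?B x \<partial>M) +
    measure lebesgue ?B * (\<integral>x. norm (\<phi> n x) * indicator Z x \<partial>M)) \<longlonglongrightarrow>
     ?C * (\<integral>x. norm (h x) * indicator ?B x \<partial>M) +
    measure lebesgue ?B * (\<integral>x. norm (v x) * indicator Z x \<partial>M)"
    by (intro tendsto_intros Lp_lim_norm_integral[OF \<phi>(2) ZO] Lp_lim_norm_integral[OF \<phi>(3) B])
  ultimately have "measure lebesgue Z * (\<integral>x. norm (v x) * indicator ?B x \<partial>M) \<le>
     ?C * (\<integral>x. norm (h x) * indicator ?B x \<partial>M) +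
    measure lebesgue ?B * (\<integral>x. norm (v x) * indicator Z x \<partial>M)"
    using LIMSEQ_le by blast
  moreover have "(\<integral>x. norm (v x) * indicator Z x \<partial>M) = (\<integral>x. 0 \<partial>M)"
    using Z(3) by (intro Bochner_Integration.integral_cong) (auto simp: indicator_def)
  ultimately show ?thesis by simp
qed

text \<open>Test functions extend by zero to a large ball that contains, besides \<open>\<Omega>\<close>, a unit ball on which they all
  vanish; the Poincare inequality there bounds them by their gradients.\<close>

lemma W0_gradient_zero:
  assumes W: "W0 v h" and h: "AE x in M. h x = 0"
  shows "AE x in M. v x = 0"
proof -
  obtain \<phi> where \<phi>: "\<And>n. \<phi> n \<in> test_functions \<Omega>" "Lp_lim \<phi> v" "Lp_lim (\<lambda>n. grad (\<phi> n)) h"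
    using W unfolding W0_def by blast
  obtain R0 where "\<forall>x\<in>\<Omega>. norm x \<le> R0" using bounded_\<Omega> bounded_iff by metis
  define R where "R = max R0 1"
  have R: "R > 0" "\<And>x. x \<in> \<Omega> \<Longrightarrow> norm x \<le> R" using \<open>\<forall>x\<in>\<Omega>. norm x \<le> R0\<close> by (auto simp: R_def)
  obtain e :: 'a where e: "e \<in> Basis" using nonempty_Basis by blast
  let ?B = "ball (0::'a) (R + 2)" and ?Z = "ball ((R + 1) *\<^sub>R e) 1"
  have ZB: "?Z \<subseteq> ?B"
  proof
    fix x assume "x \<in> ?Z"
    then have "norm (x - (R + 1) *\<^sub>R e) < 1" by (simp add: dist_norm norm_minus_commute)
    then show "x \<in> ?B" using norm_triangle_sub[of x "(R + 1) *\<^sub>R e"] e R(1) by simp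
  qed
  have ZO: "?Z \<inter> \<Omega> = {}"
  proof -
    have "norm x > R" if "x \<in> ?Z" for x
    proof -
      have "norm ((R + 1) *\<^sub>R e - x) < 1" using that by (simp add: dist_norm)
      then show ?thesis using norm_triangle_sub[of "(R + 1) *\<^sub>R e" x] e R(1) by simp
    qed
    then show ?thesis using R(2) by fastforce
  qed
  have OB: "\<Omega> \<subseteq> ?B" using R by (auto simp: dist_norm) (smt (verit))
  let ?C = "2 * (R + 2) * 2 ^ DIM('a) * measure lebesgue ?B"
  have ext: "(\<integral>x. f x \<partial>lebesgue_on ?B) = (\<integral>x. f x * indicator \<Omega> x \<partial>M)" if "\<And>x. x \<notin> \<Omega> \<Longrightarrow> f x = 0" for f :: "'a \<Rightarrow> real"
  proof -
    have "(\<integral>x. f x \<partial>lebesgue_on ?B) = (\<integral>x. indicator ?B x *\<^sub>R f x \<partial>lebesgue)"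
      by (intro integral_restrict_space) auto
    also have "\<dots> = (\<integral>x. indicator \<Omega> x *\<^sub>R f x \<partial>lebesgue)"
      using OB that by (intro Bochner_Integration.integral_cong) (auto simp: indicator_def)
    also have "\<dots> = (\<integral>x. f x \<partial>M)" using \<Omega>_sets by (intro integral_restrict_space[symmetric]) auto
    also have "\<dots> = (\<integral>x. f x * indicator \<Omega> x \<partial>M)"
      by (intro Bochner_Integration.integral_cong) auto
    finally show ?thesis .
  qed
  have "measure lebesgue ?Z * (\<integral>x. norm (\<phi> n x) * indicator \<Omega> x \<partial>M) \<le> ?C * (\<integral>x. norm (grad (\<phi> n) x) * indicator \<Omega> x \<partial>M)" for n
  proof -
    have z: "(\<integral>x. \<bar>\<phi> n x\<bar> \<partial>lebesgue_on ?Z) = (\<integral>x. 0 \<partial>lebesgue_on ?Z)"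
    proof (rule Bochner_Integration.integral_cong[OF refl])
      fix x assume "x \<in> space (lebesgue_on ?Z)"
      then have "x \<notin> \<Omega>" using ZO unfolding space_lebesgue_on by blast
      then show "\<bar>\<phi> n x\<bar> = 0" using test_functions_outside(1)[OF \<phi>(1)] by simp
    qed
    show ?thesis
      using Poincare_smooth[OF test_functions_smooth[OF \<phi>(1)], of "R + 2" ?Z 0 n] ZB R(1)
      by (simp add: z ext test_functions_outside[OF \<phi>(1)])
  qed
  moreover have "(\<lambda>n. measure lebesgue ?Z * (\<integral>x. norm (\<phi> n x) * indicator \<Omega> x \<partial>M)) \<longlonglongrightarrow>
      measure lebesgue ?Z * (\<integral>x. norm (v x) * indicator \<Omega> x \<partial>M)"
    by (intro tendsto_intros Lp_lim_norm_integral[OF \<phi>(2) subset_refl \<Omega>_sets])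
  moreover have "(\<lambda>n. ?C * (\<integral>x. norm (grad (\<phi> n) x) * indicator \<Omega> x \<partial>M)) \<longlonglongrightarrow> ?C * (\<integral>x. norm (h x) * indicator \<Omega> x \<partial>M)"
    by (intro tendsto_intros Lp_lim_norm_integral[OF \<phi>(3) subset_refl \<Omega>_sets])
  ultimately have le: "measure lebesgue ?Z * (\<integral>x. norm (v x) * indicator \<Omega> x \<partial>M) \<le> ?C * (\<integral>x. norm (h x) * indicator \<Omega> x \<partial>M)"
    using LIMSEQ_le by blast
  have "(\<integral>x. norm (h x) * indicator \<Omega> x \<partial>M) = 0"
    using h by (intro integral_eq_zero_AE) (auto elim: eventually_mono)
  moreover have "measure lebesgue ?Z > 0" using content_ball_pos[of 1 "(R + 1) *\<^sub>R e"] by simp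
  ultimately have "(\<integral>x. norm (v x) * indicator \<Omega> x \<partial>M) \<le> 0"
    using le mult_le_cancel_left_pos[of "measure lebesgue ?Z" "\<integral>x. norm (v x) * indicator \<Omega> x \<partial>M" 0]
    by simp
  moreover have "(\<integral>x. norm (v x) * indicator \<Omega> x \<partial>M) = (\<integral>x. norm (v x) \<partial>M)"
    by (intro Bochner_Integration.integral_cong) auto
  moreover have "0 \<le> (\<integral>x. norm (v x) \<partial>M)" by simp
  ultimately have "(\<integral>x. norm (v x) \<partial>M) = 0" by linarith
  then show ?thesis
    using integral_nonneg_eq_0_iff_AE[of M "\<lambda>x. norm (v x)"] Lp_integrable[OF W0D(1)[OF W]] by simp
qed

end

section \<open>The strong maximum principle for minimizers of a nonnegative energy\<close>

lemma powr_convex_comb: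
  fixes a b s p :: real
  assumes "0 \<le> a" "0 \<le> b" "0 \<le> s" "s \<le> 1" "1 < p"
  shows "((1 - s) * a + s * b) powr p \<le> (1 - s) * a powr p + s * b powr p"
proof -
  have le: "(c * x) powr p \<le> c * x powr p" if "0 \<le> c" "c \<le> 1" "0 \<le> x" for c x :: real
  proof -
    have "c powr p \<le> c powr 1" using that assms(5) by (intro powr_mono') auto
    then show ?thesis using that by (simp add: powr_mult mult_right_mono)
  qed
  consider "a = 0" | "b = 0" | "a > 0" "b > 0" using assms by linarith
  then show ?thesis
  proof cases
    case 3
    then show ?thesis
      using convex_onD[OF powr_convex[of p], of s a b] assms by simp
  qed (use le[of s b] le[of "1 - s" a] assms in auto)
qed

lemma norm_convex_comb_powr:
  fixes X Y :: "'b::real_normed_vector"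
  assumes "0 \<le> s" "s \<le> 1" "1 < p"
  shows "norm ((1 - s) *\<^sub>R X + s *\<^sub>R Y) powr p \<le> (1 - s) * norm X powr p + s * norm Y powr p"
proof -
  have "norm ((1 - s) *\<^sub>R X + s *\<^sub>R Y) \<le> (1 - s) * norm X + s * norm Y"
    using norm_triangle_ineq[of "(1 - s) *\<^sub>R X" "s *\<^sub>R Y"] assms by simp
  then have "norm ((1 - s) *\<^sub>R X + s *\<^sub>R Y) powr p \<le> ((1 - s) * norm X + s * norm Y) powr p"
    using assms by (intro powr_mono2) auto
  also have "\<dots> \<le> (1 - s) * norm X powr p + s * norm Y powr p"
    using assms by (intro powr_convex_comb) auto
  finally show ?thesis .
qed

lemma powr_diff_le:
  fixes a b p :: real
  assumes "0 \<le> a" "a \<le> b" "1 < p"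
  shows "b powr p - a powr p \<le> p * (b - a) * b powr (p - 1)"
proof (cases "a = b")
  case False
  then have ab: "a < b" using assms by simp
  have "continuous_on {a..b} (\<lambda>x. x powr p)"
    using assms by (intro continuous_on_powr' continuous_intros) auto
  moreover have d: "((\<lambda>x. x powr p) has_real_derivative p * x powr (p - 1)) (at x)" if "a < x" for x
    using that assms by (auto intro!: derivative_eq_intros)
  ultimately obtain l z where z: "a < z" "z < b" "DERIV (\<lambda>x. x powr p) z :> l" "b powr p - a powr p = (b - a) * l"
    using MVT[OF ab, of "\<lambda>x. x powr p"] real_differentiable_def by blast
  have "l = p * z powr (p - 1)" using DERIV_unique z(3) d[OF z(1)] by blast
  moreover have "z powr (p - 1) \<le> b powr (p - 1)" using z assms by (intro powr_mono2) auto
  ultimately have "l \<le> p * b powr (p - 1)" using assms by simp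
  then show ?thesis using z(4) ab by (simp add: mult.commute mult.left_commute mult_left_mono)
qed simp

text \<open>The logarithmic test function \<open>\<Phi> T\<^sup>1\<^sup>-\<^sup>p\<close> is inserted into the convex functional itself, not
  into its derivative: the gradient of the competitor is a convex combination of \<open>g\<close> and a multiple
  of the gradient \<open>D\<close> of the cutoff.\<close>

lemma log_competitor_gradient:
  fixes g D :: "'b::real_normed_vector"
  assumes p: "1 < p" and T: "0 < T" and \<sigma>: "1 / 2 \<le> \<sigma>" and t: "0 < t" and \<Phi>: "0 \<le> \<Phi>"
    and D: "norm D powr p \<le> K * \<Phi> powr (p - 1)" and K: "0 \<le> K"
    and s: "s = t * (p - 1) * \<Phi> * T powr (- p) * \<sigma>" "s \<le> 1"
  shows "norm ((1 - s) *\<^sub>R g + (t * T powr (1 - p)) *\<^sub>R D) powr p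
    \<le> (1 - s) * norm g powr p + t * ((p - 1) powr (1 - p) * 2 powr (p - 1) * K)"
proof (cases "\<Phi> = 0")
  case True
  then have "norm D powr p \<le> 0" using D p by simp
  then have "norm D powr p = 0" using powr_ge_zero[of "norm D" p] by linarith
  then have "D = 0" by simp
  then show ?thesis using True s(1) t K by simp
next
  case False
  then have \<Phi>': "\<Phi> > 0" using \<Phi> by simp
  have sp: "s > 0" unfolding s(1) using p T \<sigma> t \<Phi>' by (intro mult_pos_pos) auto
  define Y where "Y = (t * T powr (1 - p) / s) *\<^sub>R D"
  have "(t * T powr (1 - p)) *\<^sub>R D = s *\<^sub>R Y" using sp by (simp add: Y_def)
  then have "norm ((1 - s) *\<^sub>R g + (t * T powr (1 - p)) *\<^sub>R D) powr p
      \<le> (1 - s) * norm g powr p + s * norm Y powr p"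
    using norm_convex_comb_powr[of s p g Y] sp s(2) p by simp
  also have "s * norm Y powr p \<le> t * ((p - 1) powr (1 - p) * 2 powr (p - 1) * K)"
  proof -
    have tT: "0 < t * T powr (1 - p)" using t T by simp
    have nY: "norm Y = (t * T powr (1 - p) / s) * norm D" using sp t by (simp add: Y_def abs_mult)
    then have "s * norm Y powr p = s * ((t * T powr (1 - p) / s) powr p * norm D powr p)"
      unfolding nY by (subst powr_mult) (use sp tT in auto)
    also have "\<dots> \<le> s * ((t * T powr (1 - p) / s) powr p * (K * \<Phi> powr (p - 1)))"
      using D sp by (intro mult_left_mono) auto
    also have "\<dots> = t * ((p - 1) powr (1 - p) * \<sigma> powr (1 - p) * K)"
    proof -
      have "s * (t * T powr (1 - p) / s) powr p * \<Phi> powr (p - 1) = t * ((p - 1) powr (1 - p) * \<sigma> powr (1 - p))"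
      proof -
        have "\<sigma> > 0" using \<sigma> by simp
        have l: "ln s = ln t + ln (p - 1) + ln \<Phi> - p * ln T + ln \<sigma>"
          unfolding s(1) using p T t \<Phi>' \<open>\<sigma> > 0\<close> by (simp add: ln_mult ln_powr)
        have "ln (s * (t * T powr (1 - p) / s) powr p * \<Phi> powr (p - 1)) =
            ln s + p * (ln t + (1 - p) * ln T - ln s) + (p - 1) * ln \<Phi>"
          using sp tT t T \<Phi>' by (simp add: ln_mult ln_div ln_powr)
        also have "\<dots> = ln t + (1 - p) * ln (p - 1) + (1 - p) * ln \<sigma>"
          unfolding l by (simp add: algebra_simps)
        also have "\<dots> = ln (t * ((p - 1) powr (1 - p) * \<sigma> powr (1 - p)))"
          using p t \<open>\<sigma> > 0\<close> by (simp add: ln_mult ln_powr)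
        finally show ?thesis
          using sp tT t p \<Phi>' \<open>\<sigma> > 0\<close> by (subst (asm) ln_inj_iff) (auto intro!: mult_pos_pos)
      qed
      then have "(s * (t * T powr (1 - p) / s) powr p * \<Phi> powr (p - 1)) * K = (t * ((p - 1) powr (1 - p) * \<sigma> powr (1 - p))) * K"
        by simp
      then show ?thesis by (simp add: mult_ac)
    qed
    also have "\<dots> \<le> t * ((p - 1) powr (1 - p) * 2 powr (p - 1) * K)"
    proof -
      have "\<sigma> powr (1 - p) \<le> (1 / 2) powr (1 - p)" using \<sigma> p by (intro powr_mono2') auto
      also have "\<dots> = 2 powr (p - 1)" by (simp add: powr_divide powr_minus_divide[of 2 "1 - p", symmetric])
      finally show ?thesis using t K by (intro mult_left_mono mult_right_mono) auto
    qed
    finally show ?thesis .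
  qed
  finally show ?thesis by simp
qed

text \<open>The last assumption is the inequality \<open>\<lambda> \<le> \<lambda>\<^sub>1(m)\<close> written without a quotient.\<close>

locale nonneg_energy = bounded_open \<Omega> p for \<Omega> :: "'a::euclidean_space set" and p +
  fixes m :: "'a \<Rightarrow> real" and lam :: real
  assumes m_integrable: "integrable (lebesgue_on \<Omega>) m"
    and lam_nonneg: "0 \<le> lam"
    and energy_nonneg: "W0 v g \<Longrightarrow>
      lam * (\<integral>x. m x * \<bar>v x\<bar> powr p \<partial>lebesgue_on \<Omega>) \<le> (\<integral>x. norm (g x) powr p \<partial>lebesgue_on \<Omega>)"
begin

definition null_energy :: "('a \<Rightarrow> real) \<Rightarrow> ('a \<Rightarrow> 'a) \<Rightarrow> bool" where
  "null_energy w g \<longleftrightarrow> W0 w g \<and> (\<forall>x. 0 \<le> w x) \<and> integrable M (\<lambda>x. m x * w x powr p) \<and>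
     (\<integral>x. norm (g x) powr p \<partial>M) = lam * (\<integral>x. m x * w x powr p \<partial>M)"

text \<open>The logarithmic estimate, with a constant that does not depend on \<open>\<epsilon>\<close>. Softplus with scale \<open>\<epsilon>\<close>
  replaces the positive part, because the chain rule is available for smooth functions on the whole
  line.\<close>

lemma log_gradient_estimate:
  assumes w: "null_energy w g" and \<Phi>: "\<Phi> \<in> test_functions \<Omega>" "\<And>x. 0 \<le> \<Phi> x" "\<And>x. \<Phi> x \<le> 1"
    and K: "0 \<le> K" "\<And>x. norm (grad \<Phi> x) powr p \<le> K * \<Phi> x powr (p - 1)"
    and \<epsilon>: "0 < \<epsilon>"
  defines "T \<equiv> \<lambda>s. \<epsilon> + \<epsilon> * softplus (s / \<epsilon>)"
  shows "W0 (\<lambda>x. ln (T (w x)) - ln (T 0)) (\<lambda>x. (logistic (w x / \<epsilon>) / T (w x)) *\<^sub>R g x)"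
    and "(p - 1) * (\<integral>x. \<Phi> x * norm ((logistic (w x / \<epsilon>) / T (w x)) *\<^sub>R g x) powr p \<partial>M) \<le>
      (p - 1) powr (1 - p) * 2 powr (p - 1) * K * measure M \<Omega> + lam * p * (\<integral>x. \<bar>m x\<bar> \<partial>M)"
proof -
  define \<sigma> where "\<sigma> s = logistic (s / \<epsilon>)" for s
  have W: "W0 w g" and w0: "0 \<le> w x" and wi: "integrable M (\<lambda>x. m x * w x powr p)"
    and E: "(\<integral>x. norm (g x) powr p \<partial>M) = lam * (\<integral>x. m x * w x powr p \<partial>M)" for x
    using w by (auto simp: null_energy_def)
  have T\<epsilon>: "\<epsilon> \<le> T s" for s using \<epsilon> softplus_pos[of "s / \<epsilon>"] by (simp add: T_def)
  then have Tpos: "0 < T s" for s using \<epsilon> by (meson less_le_trans)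
  have Tw: "s + \<epsilon> \<le> T s" for s
    using softplus_ge[of "s / \<epsilon>"] \<epsilon> by (simp add: T_def field_simps)
  have \<sigma>: "0 < \<sigma> s" "\<sigma> s \<le> 1" for s
    using logistic_pos logistic_less_one less_imp_le by (auto simp: \<sigma>_def)
  have s\<sigma>: "smooth \<sigma>"
    unfolding \<sigma>_def[abs_def]
    by (intro allI continuously_differentiable_compose[OF smooth_logistic[rule_format]]
        continuously_differentiable_bounded_linear bounded_linear_divide)
  have dT: "(T has_real_derivative \<sigma> s) (at s)" for s
  proof -
    have "((\<lambda>s. s / \<epsilon>) has_real_derivative 1 / \<epsilon>) (at s)" by (intro DERIV_cdivide DERIV_ident)
    from DERIV_chain2[OF has_derivative_softplus this]
    have "((\<lambda>s. softplus (s / \<epsilon>)) has_real_derivative \<sigma> s * (1 / \<epsilon>)) (at s)" by (simp add: \<sigma>_def)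
    then have "(T has_real_derivative 0 + \<epsilon> * (\<sigma> s * (1 / \<epsilon>))) (at s)"
      unfolding T_def by (intro DERIV_add DERIV_const DERIV_cmult)
    then show ?thesis using \<epsilon> by simp
  qed
  have sTp: "smooth (\<lambda>s. T s powr r)" for r
    using continuously_differentiable_powr[OF dT Tpos s\<sigma>] by blast
  show 1: "W0 (\<lambda>x. ln (T (w x)) - ln (T 0)) (\<lambda>x. (logistic (w x / \<epsilon>) / T (w x)) *\<^sub>R g x)"
  proof -
    have eq: "T s powr (-1) * \<sigma> s = logistic (s / \<epsilon>) / T s" for s
      using Tpos[of s] by (simp add: \<sigma>_def powr_minus divide_simps)
    have "W0 (\<lambda>x. ln (T (w x)) - ln (T 0)) (\<lambda>x. (T (w x) powr (-1) * \<sigma> (w x)) *\<^sub>R g x)"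
    proof (rule W0_compose[OF W, of "\<lambda>s. ln (T s) - ln (T 0)" "\<lambda>s. T s powr (-1) * \<sigma> s" "1 / \<epsilon>"])
      show "((\<lambda>s. ln (T s) - ln (T 0)) has_real_derivative T s powr (-1) * \<sigma> s) (at s)" for s
        using DERIV_diff[OF DERIV_chain2[OF DERIV_ln[OF Tpos] dT[of s]] DERIV_const[of "ln (T 0)"]] Tpos[of s]
        by (simp add: powr_minus)
      show "smooth (\<lambda>s. T s powr - 1 * \<sigma> s)"
        by (intro allI continuously_differentiable_mult sTp[rule_format] s\<sigma>[rule_format])
      show "\<bar>T s powr - 1 * \<sigma> s\<bar> \<le> 1 / \<epsilon>" for s
        using Tpos[of s] T\<epsilon>[of s] \<sigma>[of s] \<epsilon> unfolding eq
        by (auto simp: \<sigma>_def[symmetric] abs_mult intro!: frac_le)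
    qed simp
    then show ?thesis by (simp only: eq)
  qed
  \<comment> \<open>With this step size \<open>s \<le> 1\<close>, and the competitor \<open>z\<close> exceeds \<open>w\<close> by at most \<open>\<epsilon>\<close>, so that \<open>z \<le> T w\<close>.\<close>
  define t where "t = \<epsilon> powr p / p"
  have t: "0 < t" using \<epsilon> p_gt_1 by (simp add: t_def)
  define C1 where "C1 = (p - 1) powr (1 - p) * 2 powr (p - 1) * K"
  define G where "G s = T s powr (1 - p)" for s
  define G' where "G' s = (1 - p) * T s powr (- p) * \<sigma> s" for s
  have Tneg: "T s powr (- r) \<le> \<epsilon> powr (- r)" if "0 < r" for s r
    using T\<epsilon> \<epsilon> that by (intro powr_mono2') auto
  have WG: "W0 (\<lambda>x. G (w x) - G 0) (\<lambda>x. G' (w x) *\<^sub>R g x)"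
  proof (rule W0_compose[OF W, of "\<lambda>s. G s - G 0" G' "(p - 1) * \<epsilon> powr (- p)"])
    show "((\<lambda>s. G s - G 0) has_real_derivative G' s) (at s)" for s
    proof -
      have "((\<lambda>s. T s powr (1 - p)) has_real_derivative (1 - p) * T s powr (1 - p - of_nat 1) * \<sigma> s) (at s)"
        by (rule DERIV_fun_powr[OF dT Tpos])
      from DERIV_diff[OF this DERIV_const] show ?thesis by (simp add: G_def G'_def)
    qed
    have "continuously_differentiable k (\<lambda>s. (1 - p) * T s powr (- p) * \<sigma> s)" for k
      by (intro continuously_differentiable_mult sTp[rule_format] s\<sigma>[rule_format] continuously_differentiable_const)
    then show "smooth G'" unfolding G'_def by blast
    show "\<bar>G' s\<bar> \<le> (p - 1) * \<epsilon> powr (- p)" for s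
    proof -
      have "\<bar>G' s\<bar> = (p - 1) * T s powr (- p) * \<sigma> s" using p_gt_1 \<sigma>(1)[of s] by (simp add: G'_def abs_mult)
      also have "\<dots> \<le> (p - 1) * \<epsilon> powr (- p) * 1"
        using p_gt_1 \<sigma>[of s] Tneg[of p s] by (intro mult_mono mult_left_mono) auto
      finally show ?thesis by simp
    qed
  qed simp
  define s where "s x = t * (p - 1) * \<Phi> x * T (w x) powr (- p) * \<sigma> (w x)" for x
  define z where "z x = w x + t * (\<Phi> x * G (w x))" for x
  define gz where "gz x = (1 - s x) *\<^sub>R g x + (t * T (w x) powr (1 - p)) *\<^sub>R grad \<Phi> x" for x
  have Wz: "W0 z gz"
  proof -
    from W0_add[OF W W0_scale[OF W0_add[OF W0_test_mult[OF WG \<Phi>(1)] W0_scale[OF W0_test_function[OF \<Phi>(1)], of "G 0"]], of t]]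
    have "W0 (\<lambda>x. w x + t * (\<Phi> x * (G (w x) - G 0) + G 0 * \<Phi> x))
     (\<lambda>x. g x + t *\<^sub>R (\<Phi> x *\<^sub>R G' (w x) *\<^sub>R g x + (G (w x) - G 0) *\<^sub>R grad \<Phi> x + G 0 *\<^sub>R grad \<Phi> x))" .
    moreover have "w x + t * (\<Phi> x * (G (w x) - G 0) + G 0 * \<Phi> x) = z x" for x
      by (simp add: z_def algebra_simps)
    moreover have "g x + t *\<^sub>R (\<Phi> x *\<^sub>R G' (w x) *\<^sub>R g x + (G (w x) - G 0) *\<^sub>R grad \<Phi> x + G 0 *\<^sub>R grad \<Phi> x) = gz x" for x
    proof -
      have "t * (\<Phi> x * G' (w x)) = - s x" by (simp add: G'_def s_def algebra_simps)
      then have "t *\<^sub>R (\<Phi> x *\<^sub>R G' (w x) *\<^sub>R g x) = (- s x) *\<^sub>R g x" by (simp only: scaleR_scaleR)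
      then show ?thesis by (simp add: gz_def G_def algebra_simps scaleR_add_right)
    qed
    ultimately show ?thesis by simp
  qed
  have tG: "0 \<le> t * (\<Phi> x * G (w x))" "t * (\<Phi> x * G (w x)) \<le> \<epsilon>" for x
  proof -
    show "0 \<le> t * (\<Phi> x * G (w x))" using t \<Phi>(2) by (simp add: G_def)
    have "\<Phi> x * G (w x) \<le> 1 * \<epsilon> powr (- (p - 1))"
      using \<Phi>(2,3) Tneg[of "p - 1" "w x"] p_gt_1 by (intro mult_mono) (auto simp: G_def)
    then have "t * (\<Phi> x * G (w x)) \<le> t * \<epsilon> powr (- (p - 1))" using t by simp
    also have "\<dots> = \<epsilon> / p" using \<epsilon> by (simp add: t_def powr_diff powr_minus field_simps)
    also have "\<dots> \<le> \<epsilon>" using \<epsilon> p_gt_1 by (simp add: divide_simps)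
    finally show "t * (\<Phi> x * G (w x)) \<le> \<epsilon>" .
  qed
  have s01: "0 \<le> s x" "s x \<le> 1" for x
  proof -
    show "0 \<le> s x" using t p_gt_1 \<Phi>(2)[of x] \<sigma>(1)[of "w x"] unfolding s_def by (intro mult_nonneg_nonneg) auto
    have "s x \<le> t * (p - 1) * 1 * \<epsilon> powr (- p) * 1"
      unfolding s_def using t p_gt_1 \<Phi>(2,3)[of x] \<sigma>[of "w x"] Tneg[of p "w x"]
      by (intro mult_mono mult_nonneg_nonneg) auto
    also have "\<dots> = (p - 1) * (\<epsilon> powr p * \<epsilon> powr (- p)) / p" by (simp add: t_def)
    also have "\<dots> = (p - 1) / p" using \<epsilon> by (simp flip: powr_add)
    also have "\<dots> \<le> 1" using p_gt_1 by simp
    finally show "s x \<le> 1" .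
  qed
  have z0: "0 \<le> z x" for x using w0[of x] tG(1)[of x] by (simp add: z_def)
  have zw: "z x powr p - w x powr p \<le> p * t" "0 \<le> z x powr p - w x powr p" for x
  proof -
    have "w x \<le> z x" using tG(1)[of x] by (simp add: z_def)
    then show "0 \<le> z x powr p - w x powr p" using w0[of x] p_gt_1 by (simp add: powr_mono2)
    have "z x \<le> T (w x)" using tG(2)[of x] Tw[of "w x"] by (simp add: z_def)
    have "z x powr p - w x powr p \<le> p * (z x - w x) * z x powr (p - 1)"
      using powr_diff_le[OF w0 \<open>w x \<le> z x\<close> p_gt_1] .
    also have "\<dots> \<le> p * (z x - w x) * T (w x) powr (p - 1)"
      using \<open>z x \<le> T (w x)\<close> \<open>w x \<le> z x\<close> z0[of x] p_gt_1 by (intro mult_left_mono powr_mono2) auto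
    also have "\<dots> = p * t * \<Phi> x"
      using Tpos[of "w x"] by (simp add: z_def G_def flip: powr_add)
    also have "\<dots> \<le> p * t" using \<Phi>(3)[of x] p_gt_1 t by (simp add: mult_left_le)
    finally show "z x powr p - w x powr p \<le> p * t" .
  qed
  have mm: "m \<in> borel_measurable M" using m_integrable by simp
  have mw: "w \<in> borel_measurable M" "g \<in> borel_measurable M" "z \<in> borel_measurable M" "gz \<in> borel_measurable M"
    using W0D[OF W] W0D[OF Wz] Lp_measurable by blast+
  have zi: "integrable M (\<lambda>x. m x * (z x powr p - w x powr p))"
  proof (rule Bochner_Integration.integrable_bound[OF integrable_mult_right[OF m_integrable, of "p * t"]])
    show "AE x in M. norm (m x * (z x powr p - w x powr p)) \<le> norm (p * t * m x)"
    proof (rule AE_I2)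
      fix x
      have "\<bar>m x\<bar> * \<bar>z x powr p - w x powr p\<bar> \<le> \<bar>m x\<bar> * (p * t)"
        using zw[of x] by (intro mult_left_mono) auto
      then show "norm (m x * (z x powr p - w x powr p)) \<le> norm (p * t * m x)"
        using p_gt_1 t by (simp add: abs_mult mult_ac)
    qed
  qed (use mm mw in measurable)
  have zp: "(\<integral>x. m x * \<bar>z x\<bar> powr p \<partial>M) = (\<integral>x. m x * w x powr p \<partial>M) + (\<integral>x. m x * (z x powr p - w x powr p) \<partial>M)"
    using wi zi z0 by (subst Bochner_Integration.integral_add[symmetric]) (auto simp: algebra_simps)
  have zlow: "(\<integral>x. m x * (z x powr p - w x powr p) \<partial>M) \<ge> - (p * t * (\<integral>x. \<bar>m x\<bar> \<partial>M))"
  proof -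
    have "(\<integral>x. - (p * t) * \<bar>m x\<bar> \<partial>M) \<le> (\<integral>x. m x * (z x powr p - w x powr p) \<partial>M)"
    proof (rule integral_mono)
      show "integrable M (\<lambda>x. - (p * t) * \<bar>m x\<bar>)" using m_integrable by (intro integrable_mult_right integrable_abs)
      show "- (p * t) * \<bar>m x\<bar> \<le> m x * (z x powr p - w x powr p)" for x
      proof -
        have "\<bar>m x\<bar> * (z x powr p - w x powr p) \<le> \<bar>m x\<bar> * (p * t)" using zw[of x] by (intro mult_left_mono) auto
        moreover have "- (\<bar>m x\<bar> * (z x powr p - w x powr p)) \<le> m x * (z x powr p - w x powr p)"
          using mult_right_mono[OF _ zw(2)[of x], of "- \<bar>m x\<bar>" "m x"] by simp
        ultimately show ?thesis by (simp add: mult.commute)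
      qed
    qed (rule zi)
    then show ?thesis by simp
  qed
  have gi: "integrable M (\<lambda>x. norm (g x) powr p)" "integrable M (\<lambda>x. norm (gz x) powr p)"
    using W0D[OF W] W0D[OF Wz] Lp_powr_integrable by blast+
  have ms: "s \<in> borel_measurable M"
  proof -
    have "\<Phi> \<in> borel_measurable M" using \<Phi>(1) test_function_Lp Lp_measurable by blast
    moreover have "(\<lambda>x. T (w x) powr (- p)) \<in> borel_measurable M" "(\<lambda>x. \<sigma> (w x)) \<in> borel_measurable M"
      using borel_measurable_continuous_onI[OF smooth_continuous[OF sTp]]
        borel_measurable_continuous_onI[OF smooth_continuous[OF s\<sigma>]] mw(1)
      by (auto intro: measurable_compose)
    ultimately show ?thesis unfolding s_def by measurable
  qed
  have si: "integrable M (\<lambda>x. s x * norm (g x) powr p)"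
  proof (rule Bochner_Integration.integrable_bound[OF gi(1)])
    show "AE x in M. norm (s x * norm (g x) powr p) \<le> norm (norm (g x) powr p)"
      using s01 by (intro AE_I2) (simp add: abs_mult mult_left_le_one_le)
  qed (use ms mw in measurable)
  have "lam * (\<integral>x. m x * \<bar>z x\<bar> powr p \<partial>M) \<le> (\<integral>x. norm (gz x) powr p \<partial>M)"
    by (rule energy_nonneg[OF Wz])
  also have "\<dots> \<le> (\<integral>x. norm (g x) powr p - s x * norm (g x) powr p + t * C1 \<partial>M)"
  proof (rule integral_mono[OF gi(2)])
    show "norm (gz x) powr p \<le> norm (g x) powr p - s x * norm (g x) powr p + t * C1" for x
    proof -
      have "1 / 2 \<le> \<sigma> (w x)" unfolding \<sigma>_def
        by (rule logistic_ge_half) (use w0[of x] \<epsilon> in simp)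
      from log_competitor_gradient[OF p_gt_1 Tpos this t \<Phi>(2) K(2) K(1) s_def s01(2), of "g x"]
      have "norm (gz x) powr p \<le> (1 - s x) * norm (g x) powr p + t * C1"
        by (simp add: gz_def C1_def)
      then show ?thesis by (simp add: left_diff_distrib)
    qed
  qed (use gi(1) si in simp)
  also have "\<dots> = (\<integral>x. norm (g x) powr p \<partial>M) - (\<integral>x. s x * norm (g x) powr p \<partial>M) + t * C1 * measure M \<Omega>"
    using gi(1) si by simp
  finally have "(\<integral>x. s x * norm (g x) powr p \<partial>M) \<le> t * C1 * measure M \<Omega> - lam * (\<integral>x. m x * (z x powr p - w x powr p) \<partial>M)"
    using E unfolding zp by (simp add: algebra_simps)
  also have "\<dots> \<le> t * C1 * measure M \<Omega> + lam * (p * t * (\<integral>x. \<bar>m x\<bar> \<partial>M))"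
    using mult_left_mono[OF zlow lam_nonneg] by simp
  finally have fin: "(\<integral>x. s x * norm (g x) powr p \<partial>M) \<le> t * (C1 * measure M \<Omega> + lam * p * (\<integral>x. \<bar>m x\<bar> \<partial>M))"
    by (simp add: algebra_simps)
  have "t * ((p - 1) * (\<integral>x. \<Phi> x * norm ((\<sigma> (w x) / T (w x)) *\<^sub>R g x) powr p \<partial>M)) =
      (\<integral>x. t * ((p - 1) * (\<Phi> x * norm ((\<sigma> (w x) / T (w x)) *\<^sub>R g x) powr p)) \<partial>M)"
    by simp
  also have "\<dots> \<le> (\<integral>x. s x * norm (g x) powr p \<partial>M)"
  proof (rule integral_mono'[OF si])
    fix x
    have "norm ((\<sigma> (w x) / T (w x)) *\<^sub>R g x) powr p = (\<sigma> (w x) powr p * T (w x) powr (- p)) * norm (g x) powr p"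
      using \<sigma>(1)[of "w x"] Tpos[of "w x"] by (simp add: powr_mult powr_divide powr_minus_divide)
    moreover have "\<sigma> (w x) powr p \<le> \<sigma> (w x) powr 1" using \<sigma>[of "w x"] p_gt_1 by (intro powr_mono') auto
    then have "\<sigma> (w x) powr p * T (w x) powr (- p) \<le> \<sigma> (w x) * T (w x) powr (- p)"
      using \<sigma>(1)[of "w x"] by (intro mult_right_mono) auto
    ultimately have "norm ((\<sigma> (w x) / T (w x)) *\<^sub>R g x) powr p \<le> (\<sigma> (w x) * T (w x) powr (- p)) * norm (g x) powr p"
      by (simp add: mult_right_mono)
    then have "t * (p - 1) * \<Phi> x * norm ((\<sigma> (w x) / T (w x)) *\<^sub>R g x) powr p \<le>
        t * (p - 1) * \<Phi> x * ((\<sigma> (w x) * T (w x) powr (- p)) * norm (g x) powr p)"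
      using t p_gt_1 \<Phi>(2) by (intro mult_left_mono) auto
    then show "t * ((p - 1) * (\<Phi> x * norm ((\<sigma> (w x) / T (w x)) *\<^sub>R g x) powr p)) \<le> s x * norm (g x) powr p"
      by (simp add: s_def mult_ac)
    show "0 \<le> s x * norm (g x) powr p" using s01(1)[of x] by simp
  qed
  finally have "t * ((p - 1) * (\<integral>x. \<Phi> x * norm ((\<sigma> (w x) / T (w x)) *\<^sub>R g x) powr p \<partial>M)) \<le>
      t * (C1 * measure M \<Omega> + lam * p * (\<integral>x. \<bar>m x\<bar> \<partial>M))"
    using fin by linarith
  then have "(p - 1) * (\<integral>x. \<Phi> x * norm ((\<sigma> (w x) / T (w x)) *\<^sub>R g x) powr p \<partial>M) \<le>
      C1 * measure M \<Omega> + lam * p * (\<integral>x. \<bar>m x\<bar> \<partial>M)"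
    using t by simp
  then show "(p - 1) * (\<integral>x. \<Phi> x * norm ((logistic (w x / \<epsilon>) / T (w x)) *\<^sub>R g x) powr p \<partial>M) \<le>
      (p - 1) powr (1 - p) * 2 powr (p - 1) * K * measure M \<Omega> + lam * p * (\<integral>x. \<bar>m x\<bar> \<partial>M)"
    by (simp add: C1_def \<sigma>_def)
qed


text \<open>If \<open>w\<close> vanishes on a set \<open>Z\<close> of positive measure in the ball, then the Poincare inequality bounds the
  integral of \<open>ln (T w / T 0)\<close> uniformly in \<open>\<epsilon>\<close>, while this function tends to infinity
  wherever \<open>w\<close> is positive.\<close>

lemma null_energy_ball_dichotomy:
  assumes w: "null_energy w g" and r: "0 < r" "cball x0 (2 * r) \<subseteq> \<Omega>"
  shows "(AE x in M. x \<in> ball x0 r \<longrightarrow> w x = 0) \<or> (AE x in M. x \<in> ball x0 r \<longrightarrow> 0 < w x)"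
proof -
  define B where "B = ball x0 r"
  have W: "W0 w g" and w0: "0 \<le> w x" for x using w by (auto simp: null_energy_def)
  have wm[measurable]: "w \<in> borel_measurable M" using W0D(1)[OF W] Lp_measurable by blast
  have BO: "B \<subseteq> \<Omega>" using r by (auto simp: B_def)
  have Bs: "B \<in> sets lebesgue" by (simp add: B_def)
  have BM[measurable]: "B \<in> sets M" using BO Bs \<Omega>_sets by (simp add: sets_restrict_space_iff)
  have toL: "A \<in> sets lebesgue" if "A \<in> sets M" for A using that \<Omega>_sets by (simp add: sets_restrict_space_iff)
  define Z where "Z = {x \<in> space M. w x = 0} \<inter> B"
  have ZM: "Z \<in> sets M" unfolding Z_def by measurable
  have Z: "Z \<in> sets lebesgue" "Z \<subseteq> B" "\<And>x. x \<in> Z \<Longrightarrow> w x = 0"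
    using toL[OF ZM] by (auto simp: Z_def)
  have Zmeas: "measure lebesgue Z = measure M Z"
    using ZM \<Omega>_sets Z(2) BO by (subst measure_restrict_space) auto
  show ?thesis
  proof (cases "measure M Z = 0")
    case True
    then have "Z \<in> null_sets M" using ZM by (simp add: null_sets_def emeasure_eq_measure)
    then have "AE x in M. x \<notin> Z" by (rule AE_not_in)
    then have "AE x in M. x \<in> ball x0 r \<longrightarrow> 0 < w x"
    proof (rule AE_mp, intro AE_I2 impI)
      fix x assume "x \<in> space M" "x \<notin> Z" "x \<in> ball x0 r"
      then have "w x \<noteq> 0" by (simp add: Z_def B_def)
      then show "0 < w x" using w0[of x] by simp
    qed
    then show ?thesis ..
  next
    case False
    then have Zpos: "0 < measure lebesgue Z" using Zmeas measure_nonneg[of M Z] by linarith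
    define \<Phi> where "\<Phi> = ball_bump x0 (2 * r)"
    have \<Phi>: "\<Phi> \<in> test_functions \<Omega>" "0 \<le> \<Phi> x" "\<Phi> x \<le> 1" for x
      using ball_bump_test_function[OF r(2)] r(1) by (auto simp: \<Phi>_def ball_bump_nonneg ball_bump_le_one)
    obtain K where K: "0 \<le> K" "\<And>x. norm (grad \<Phi> x) powr p \<le> K * \<Phi> x powr (p - 1)"
      using ball_bump_grad_bound[of "2 * r" p x0] r(1) p_gt_1 unfolding \<Phi>_def by auto
    define c0 where "c0 = exp (- 1 / (3 * r\<^sup>2))"
    have c0: "0 < c0" by (simp add: c0_def)
    have \<Phi>c0: "c0 \<le> \<Phi> x" if "x \<in> B" for x
    proof -
      have "(norm (x - x0))\<^sup>2 \<le> r\<^sup>2"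
        using that by (intro power_mono) (auto simp: B_def dist_norm norm_minus_commute)
      then have l: "3 * r\<^sup>2 \<le> (2 * r)\<^sup>2 - (x - x0) \<bullet> (x - x0)"
        by (simp add: power2_norm_eq_inner power_mult_distrib)
      moreover have "0 < 3 * r\<^sup>2" using r(1) by simp
      ultimately have pos: "0 < (2 * r)\<^sup>2 - (x - x0) \<bullet> (x - x0)" by linarith
      have "1 / ((2 * r)\<^sup>2 - (x - x0) \<bullet> (x - x0)) \<le> 1 / (3 * r\<^sup>2)"
        using l \<open>0 < 3 * r\<^sup>2\<close> by (intro divide_left_mono mult_pos_pos pos) auto
      then show ?thesis using pos by (simp add: \<Phi>_def ball_bump_def flat_def c0_def)
    qed
    define C2 where "C2 = (p - 1) powr (1 - p) * 2 powr (p - 1) * K * measure M \<Omega> + lam * p * (\<integral>x. \<bar>m x\<bar> \<partial>M)"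
    \<comment> \<open>Bounds for the integrals of the gradient of \<open>ln (T w)\<close> and of \<open>ln (T w / T 0)\<close> over \<open>B\<close>, from
      \<open>norm y \<le> 1 + norm y\<^sup>p\<close> and the Poincare inequality.\<close>
    define C3 where "C3 = measure M \<Omega> + C2 / ((p - 1) * c0)"
    define C5 where "C5 = 2 * r * 2 ^ DIM('a) * measure lebesgue B * C3 / measure lebesgue Z"
    define T where "T \<epsilon> s = \<epsilon> + \<epsilon> * softplus (s / \<epsilon>)" for \<epsilon> s
    have bound: "integrable M (\<lambda>x. \<bar>ln (T \<epsilon> (w x)) - ln (T \<epsilon> 0)\<bar> * indicator B x)"
        "(\<integral>x. \<bar>ln (T \<epsilon> (w x)) - ln (T \<epsilon> 0)\<bar> * indicator B x \<partial>M) \<le> C5" if \<epsilon>: "0 < \<epsilon>" for \<epsilon>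
    proof -
      let ?v = "\<lambda>x. ln (T \<epsilon> (w x)) - ln (T \<epsilon> 0)" and ?h = "\<lambda>x. (logistic (w x / \<epsilon>) / T \<epsilon> (w x)) *\<^sub>R g x"
      have Wv: "W0 ?v ?h" unfolding T_def by (rule log_gradient_estimate(1)[OF w \<Phi> K \<epsilon>])
      have est: "(p - 1) * (\<integral>x. \<Phi> x * norm (?h x) powr p \<partial>M) \<le> C2"
        unfolding T_def C2_def by (rule log_gradient_estimate(2)[OF w \<Phi> K \<epsilon>])
      have hi: "integrable M (\<lambda>x. norm (?h x) powr p)" using Lp_powr_integrable[OF W0D(2)[OF Wv]] .
      have hm: "?h \<in> borel_measurable M" using Lp_measurable[OF W0D(2)[OF Wv]] .
      have \<Phi>m: "\<Phi> \<in> borel_measurable M" using Lp_measurable[OF test_function_Lp(1)[OF \<Phi>(1)]] .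
      have \<Phi>i: "integrable M (\<lambda>x. \<Phi> x * norm (?h x) powr p)"
      proof (rule Bochner_Integration.integrable_bound[OF hi])
        show "(\<lambda>x. \<Phi> x * norm (?h x) powr p) \<in> borel_measurable M" using hm \<Phi>m by measurable
        show "AE x in M. norm (\<Phi> x * norm (?h x) powr p) \<le> norm (norm (?h x) powr p)"
          using \<Phi>(2,3) by (intro AE_I2) (simp add: abs_mult mult_left_le_one_le)
      qed
      have "(\<integral>x. norm (?h x) * indicator B x \<partial>M) \<le> (\<integral>x. 1 + (\<Phi> x * norm (?h x) powr p) / c0 \<partial>M)"
      proof (rule integral_mono')
        show "integrable M (\<lambda>x. 1 + \<Phi> x * norm (?h x) powr p / c0)" using \<Phi>i by simp
        fix x
        show "norm (?h x) * indicator B x \<le> 1 + (\<Phi> x * norm (?h x) powr p) / c0"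
        proof (cases "x \<in> B")
          case True
          have "norm (?h x) \<le> 1 + norm (?h x) powr p"
          proof (cases "norm (?h x) \<le> 1")
            case False
            then have "norm (?h x) powr 1 \<le> norm (?h x) powr p" using p_gt_1 by (intro powr_mono) auto
            then show ?thesis by simp
          qed (simp add: add_increasing2)
          moreover have "c0 * norm (?h x) powr p \<le> \<Phi> x * norm (?h x) powr p"
            using \<Phi>c0[OF True] by (intro mult_right_mono) auto
          then have "norm (?h x) powr p \<le> (\<Phi> x * norm (?h x) powr p) / c0"
            using c0 by (simp add: pos_le_divide_eq mult.commute)
          ultimately show ?thesis using True by simp
        next
          case False
          then show ?thesis using \<Phi>(2) c0 by (simp add: add_nonneg_nonneg)
        qed
        show "0 \<le> 1 + \<Phi> x * norm (?h x) powr p / c0" using \<Phi>(2) c0 by (simp add: add_nonneg_nonneg)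
      qed
      also have "\<dots> = measure M \<Omega> + (\<integral>x. \<Phi> x * norm (?h x) powr p \<partial>M) / c0"
        using \<Phi>i by simp
      also have "\<dots> \<le> C3"
      proof -
        have "(\<integral>x. \<Phi> x * norm (?h x) powr p \<partial>M) \<le> C2 / (p - 1)"
          using est p_gt_1 by (subst pos_le_divide_eq) (auto simp: mult.commute)
        then have "(\<integral>x. \<Phi> x * norm (?h x) powr p \<partial>M) / c0 \<le> C2 / (p - 1) / c0"
          using c0 by (intro divide_right_mono) auto
        then show ?thesis unfolding C3_def by simp
      qed
      finally have hC: "(\<integral>x. norm (?h x) * indicator B x \<partial>M) \<le> C3" .
      have "measure lebesgue Z * (\<integral>x. \<bar>?v x\<bar> * indicator B x \<partial>M) \<le>
          2 * r * 2 ^ DIM('a) * measure lebesgue B * (\<integral>x. norm (?h x) * indicator B x \<partial>M)"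
        unfolding B_def
        by (rule W0_Poincare[OF Wv r(1)]) (use Z BO in \<open>auto simp: B_def\<close>)
      also have "\<dots> \<le> 2 * r * 2 ^ DIM('a) * measure lebesgue B * C3"
        using hC r(1) by (intro mult_left_mono) auto
      finally show "(\<integral>x. \<bar>?v x\<bar> * indicator B x \<partial>M) \<le> C5"
        using Zpos by (simp add: C5_def pos_le_divide_eq mult.commute)
      have "integrable M (\<lambda>x. \<bar>?v x\<bar>)" using Lp_integrable[OF W0D(1)[OF Wv]] by (rule integrable_abs)
      then show "integrable M (\<lambda>x. \<bar>?v x\<bar> * indicator B x)"
        using integrable_real_mult_indicator[OF BM] by blast
    qed
    have small: "AE x in M. x \<in> B \<longrightarrow> w x < \<delta>" if \<delta>: "0 < \<delta>" for \<delta>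
    proof -
      define A where "A = {x \<in> space M. \<delta> \<le> w x} \<inter> B"
      have AM: "A \<in> sets M" unfolding A_def by measurable
      have le: "real n * measure M A \<le> C5" for n
      proof -
        \<comment> \<open>For this \<open>\<epsilon>\<close> the logarithm is at least \<open>n\<close> wherever \<open>w \<ge> \<delta>\<close>.\<close>
        define \<epsilon> where "\<epsilon> = \<delta> / 2 * exp (- real n)"
        have \<epsilon>: "0 < \<epsilon>" using \<delta> by (simp add: \<epsilon>_def)
        have "real n * measure M A = (\<integral>x. real n * indicator A x \<partial>M)"
          using AM BO by (simp add: A_def Int_assoc Int_absorb2)
        also have "\<dots> \<le> (\<integral>x. \<bar>ln (T \<epsilon> (w x)) - ln (T \<epsilon> 0)\<bar> * indicator B x \<partial>M)"
        proof (rule integral_mono'[OF bound(1)[OF \<epsilon>]])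
          fix x
          show "real n * indicator A x \<le> \<bar>ln (T \<epsilon> (w x)) - ln (T \<epsilon> 0)\<bar> * indicator B x"
          proof (cases "x \<in> A")
            case True
            then have x: "\<delta> \<le> w x" "x \<in> B" by (auto simp: A_def)
            have "w x \<le> T \<epsilon> (w x)"
              using softplus_ge[of "w x / \<epsilon>"] \<epsilon> by (simp add: T_def field_simps)
            then have "ln \<delta> \<le> ln (T \<epsilon> (w x))" using x \<delta> by (subst ln_le_cancel_iff) auto
            moreover have "ln (T \<epsilon> 0) \<le> ln (2 * \<epsilon>)"
            proof (subst ln_le_cancel_iff)
              have "softplus 0 \<le> 1" using softplus_le[of 0] ln_2_less_1 by simp
              then show "T \<epsilon> 0 \<le> 2 * \<epsilon>" using \<epsilon> by (simp add: T_def)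
              show "0 < T \<epsilon> 0" using \<epsilon> softplus_pos[of 0] by (simp add: T_def add_pos_pos)
            qed (use \<epsilon> in simp)
            moreover have "ln (2 * \<epsilon>) = ln \<delta> - real n" using \<delta> by (simp add: \<epsilon>_def ln_mult)
            ultimately have "real n \<le> \<bar>ln (T \<epsilon> (w x)) - ln (T \<epsilon> 0)\<bar>" by linarith
            then show ?thesis using True x by simp
          qed simp
        qed simp
        also have "\<dots> \<le> C5" by (rule bound(2)[OF \<epsilon>])
        finally show ?thesis .
      qed
      have "measure M A = 0"
      proof (rule ccontr)
        assume "measure M A \<noteq> 0"
        then have pos: "0 < measure M A" using measure_nonneg[of M A] by linarith
        obtain n where "C5 / measure M A < real n" using reals_Archimedean2 by blast
        then show False using le[of n] pos by (simp add: divide_less_eq)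
      qed
      then have "A \<in> null_sets M" using AM by (simp add: null_sets_def emeasure_eq_measure)
      then have "AE x in M. x \<notin> A" by (rule AE_not_in)
      then show ?thesis
        by (rule AE_mp, intro AE_I2) (auto simp: A_def)
    qed
    have "AE x in M. \<forall>n. x \<in> B \<longrightarrow> w x < inverse (real (Suc n))"
      using small by (subst AE_all_countable) auto
    then have "AE x in M. x \<in> B \<longrightarrow> w x = 0"
    proof eventually_elim
      case (elim x)
      show ?case
      proof
        assume "x \<in> B"
        then have "w x < inverse (real (Suc n))" for n using elim by simp
        then have "\<not> 0 < w x" using reals_Archimedean[of "w x"] less_asym by metis
        then show "w x = 0" using w0[of x] by simp
      qed
    qed
    then show ?thesis by (simp add: B_def)
  qed
qed

text \<open>Each of the two alternatives of the dichotomy on balls holds on an open set; these sets cover \<open>\<Omega>\<close> and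
  are disjoint.\<close>

theorem strong_maximum_principle:
  assumes w: "null_energy w g" and conn: "connected \<Omega>"
  shows "(AE x in M. w x = 0) \<or> (AE x in M. 0 < w x)"
proof -
  define U where "U P = {x \<in> \<Omega>. \<exists>r>0. AE y in M. y \<in> ball x r \<longrightarrow> P (w y)}" for P :: "real \<Rightarrow> bool"
  have openU: "open (U P)" for P
    unfolding open_contains_ball
  proof
    fix x assume "x \<in> U P"
    then obtain r where r: "x \<in> \<Omega>" "0 < r" "AE y in M. y \<in> ball x r \<longrightarrow> P (w y)" by (auto simp: U_def)
    obtain e where e: "0 < e" "ball x e \<subseteq> \<Omega>" using open_\<Omega> r(1) open_contains_ball by blast
    have "ball x (min e (r / 2)) \<subseteq> U P"
    proof
      fix y assume y: "y \<in> ball x (min e (r / 2))"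
      have "ball y (r / 2) \<subseteq> ball x r"
      proof
        fix z assume "z \<in> ball y (r / 2)"
        then show "z \<in> ball x r" using y dist_triangle[of x z y] by auto
      qed
      then have "AE z in M. z \<in> ball y (r / 2) \<longrightarrow> P (w z)" using r(3) by (auto elim!: eventually_mono)
      moreover have "y \<in> \<Omega>" using y e(2) by auto
      ultimately show "y \<in> U P" using r(2) by (auto simp: U_def intro!: exI[of _ "r / 2"])
    qed
    then show "\<exists>e>0. ball x e \<subseteq> U P" using e(1) r(2) by (intro exI[of _ "min e (r / 2)"]) auto
  qed
  let ?U = "U (\<lambda>s. s = 0)" and ?V = "U (\<lambda>s. 0 < s)"
  have cover: "\<Omega> \<subseteq> ?U \<union> ?V"
  proof
    fix x assume x: "x \<in> \<Omega>"
    then obtain e where e: "0 < e" "cball x e \<subseteq> \<Omega>" using open_\<Omega> open_contains_cball by blast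
    have "(AE y in M. y \<in> ball x (e / 2) \<longrightarrow> w y = 0) \<or> (AE y in M. y \<in> ball x (e / 2) \<longrightarrow> 0 < w y)"
      by (rule null_energy_ball_dichotomy[OF w]) (use e in auto)
    moreover have "0 < e / 2" using e(1) by simp
    ultimately show "x \<in> ?U \<union> ?V" using x unfolding U_def by blast
  qed
  have disj: "?U \<inter> ?V = {}"
  proof (rule ccontr)
    assume "?U \<inter> ?V \<noteq> {}"
    then obtain x r1 r2 where x: "x \<in> \<Omega>" "0 < r1" "0 < r2"
        "AE y in M. y \<in> ball x r1 \<longrightarrow> w y = 0" "AE y in M. y \<in> ball x r2 \<longrightarrow> 0 < w y"
      by (auto simp: U_def)
    obtain e where e: "0 < e" "ball x e \<subseteq> \<Omega>" using open_\<Omega> x(1) open_contains_ball by blast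
    define \<rho> where "\<rho> = min e (min r1 r2)"
    have \<rho>: "0 < \<rho>" "ball x \<rho> \<subseteq> \<Omega>" using e x by (auto simp: \<rho>_def)
    have "AE y in M. y \<notin> ball x \<rho>" using x(4,5) by eventually_elim (auto simp: \<rho>_def)
    then have "AE y in lebesgue. y \<notin> ball x \<rho>"
      using \<rho>(2) by (subst (asm) AE_lebesgue_on_iff[OF \<Omega>_sets]) (auto elim!: eventually_mono)
    then have "ball x \<rho> \<in> null_sets lebesgue" by (simp add: AE_iff_null_sets)
    then have "measure lebesgue (ball x \<rho>) = 0" by (simp add: null_sets_def measure_def)
    then show False using content_ball_pos[OF \<rho>(1), of x] by simp
  qed
  have all: "AE x in M. P (w x)" if "\<Omega> \<subseteq> U P" for P
  proof -
    have "AE y in lebesgue. y \<in> \<Omega> \<longrightarrow> (y \<in> \<Omega> \<longrightarrow> P (w y))"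
    proof (rule AE_locally)
      fix x assume "x \<in> \<Omega>"
      then have "x \<in> U P" using that by (rule subsetD[rotated])
      then have "\<exists>r>0. AE y in M. y \<in> ball x r \<longrightarrow> P (w y)" unfolding U_def mem_Collect_eq by (rule conjunct2)
      then obtain r where r: "0 < r" "AE y in M. y \<in> ball x r \<longrightarrow> P (w y)" by (elim exE conjE)
      have "AE y in lebesgue. y \<in> ball x r \<longrightarrow> (y \<in> \<Omega> \<longrightarrow> P (w y))"
        using r(2)[unfolded AE_lebesgue_on_iff[OF \<Omega>_sets]] by eventually_elim blast
      with r(1) show "\<exists>r>0. AE y in lebesgue. y \<in> ball x r \<longrightarrow> (y \<in> \<Omega> \<longrightarrow> P (w y))"
        by (intro exI conjI)
    qed
    then show ?thesis unfolding AE_lebesgue_on_iff[OF \<Omega>_sets] by eventually_elim blast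
  qed
  have "?U \<inter> \<Omega> = {} \<or> ?V \<inter> \<Omega> = {}"
    using connectedD[OF conn openU openU] disj cover by blast
  then show ?thesis
  proof
    assume "?U \<inter> \<Omega> = {}"
    then have "\<Omega> \<subseteq> ?V" using cover by blast
    then show ?thesis using all by blast
  next
    assume "?V \<inter> \<Omega> = {}"
    then have "\<Omega> \<subseteq> ?U" using cover by blast
    then show ?thesis using all by blast
  qed
qed

end

section \<open>Growth of truncated moments\<close>

text \<open>In the application \<open>T k\<close> is the mass of \<open>f\<close> over \<open>{w > k}\<close> and \<open>H k\<close> is the integral of \<open>f w\<close> over
  \<open>{w \<le> k}\<close>, so that \<open>H k + k T k\<close> is the integral of \<open>f min(w, k)\<close>. If \<open>H\<close> is negligible, then most of this
  integral comes from the tail, and \<open>H k\<close> is small compared with \<open>k T k\<close>; hence \<open>T\<close> changes little from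
  one dyadic level to the next and decays more slowly than \<open>k\<^sup>-\<^sup>\<alpha>\<close>. But \<open>H k\<close> is also at most a constant
  times \<open>k\<^sup>1\<^sup>-\<^sup>\<alpha>\<close>, which makes the differences of \<open>T\<close> between dyadic levels, and hence \<open>T\<close>, decay at least
  like \<open>k\<^sup>-\<^sup>\<alpha>\<close>.\<close>

lemma tail_growth_contradiction:
  fixes H T :: "nat \<Rightarrow> real" and F \<alpha> h0 :: real
  assumes \<alpha>: "0 < \<alpha>" "\<alpha> < 1" and h0: "0 < h0" "\<And>k. k1 \<le> k \<Longrightarrow> h0 \<le> H k"
    and T: "\<And>k. 0 \<le> T k" "\<And>k. T k \<le> F" "T \<longlonglongrightarrow> 0"
    and HT: "\<And>k. real k * (T k - T (2 * k)) \<le> H (2 * k)"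
    and growth: "\<And>\<delta>. 0 < \<delta> \<Longrightarrow> \<exists>k0. \<forall>k\<ge>k0. H k \<le> \<delta> * (H k + real k * T k) powr (1 - \<alpha>)"
  shows False
proof -
  define c where "c = 2 powr \<alpha>"
  have c: "1 < c" "c < 2"
    using \<alpha> powr_less_mono[of 0 \<alpha> 2] powr_less_mono[of \<alpha> 1 2] by (auto simp: c_def)
  \<comment> \<open>A dyadic step divides \<open>k\<^sup>-\<^sup>\<alpha>\<close> by \<open>c\<close>, and will divide \<open>T\<close> by at most \<open>q < c\<close>.\<close>
  define q where "q = (1 + c) / 2"
  have q: "1 < q" "q < c" "q < 3 / 2" using c by (auto simp: q_def)
  define \<delta>' where "\<delta>' = (q - 1) / 4"
  have \<delta>': "0 < \<delta>'" "\<delta>' < 1 / 2" using q by (auto simp: \<delta>'_def)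
  define \<delta> where "\<delta> = \<delta>' * h0 powr \<alpha>"
  have \<delta>: "0 < \<delta>" using \<delta>' h0 by (simp add: \<delta>_def)
  obtain k0 where k0: "\<And>k. k0 \<le> k \<Longrightarrow> H k \<le> \<delta> * (H k + real k * T k) powr (1 - \<alpha>)"
    using growth[OF \<delta>] by blast
  define K where "K = max (max k0 k1) 1"
  have K: "K \<ge> 1" by (simp add: K_def)
  have Hpos: "h0 \<le> H k" if "K \<le> k" for k using that h0(2) by (simp add: K_def)
  have H1: "H k \<le> 2 * \<delta>' * (real k * T k)" if "K \<le> k" for k
  proof -
    define I where "I = H k + real k * T k"
    have kT: "0 \<le> real k * T k" using T(1)[of k] by simp
    have I: "h0 \<le> I" using Hpos[OF that] kT by (simp add: I_def)
    have "H k \<le> \<delta> * I powr (1 - \<alpha>)" using k0[of k] that by (simp add: I_def K_def)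
    also have "\<dots> = \<delta> * (I * I powr (- \<alpha>))"
      using I h0(1) by (simp add: powr_diff powr_minus_divide)
    also have "\<dots> \<le> \<delta> * (I * h0 powr (- \<alpha>))"
      using I h0(1) \<alpha> \<delta> by (intro mult_left_mono powr_mono2') auto
    also have "\<dots> = \<delta>' * I" using h0(1) by (simp add: \<delta>_def mult_ac flip: powr_add)
    finally have "(1 - \<delta>') * H k \<le> \<delta>' * (real k * T k)" by (simp add: I_def algebra_simps)
    moreover have "1 / 2 * H k \<le> (1 - \<delta>') * H k"
      using \<delta>' Hpos[OF that] h0(1) by (intro mult_right_mono) auto
    ultimately show ?thesis by simp
  qed
  have ratio: "T k \<le> q * T (2 * k)" if "K \<le> k" for k
  proof -
    have "real k * (T k - T (2 * k)) \<le> H (2 * k)" by (rule HT)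
    also have "\<dots> \<le> 2 * \<delta>' * (real (2 * k) * T (2 * k))" using that by (intro H1) simp
    also have "\<dots> = real k * (4 * \<delta>' * T (2 * k))" by simp
    finally have "T k - T (2 * k) \<le> 4 * \<delta>' * T (2 * k)" using K that by (subst (asm) mult_le_cancel_left_pos) auto
    then show ?thesis by (simp add: \<delta>'_def algebra_simps)
  qed
  have FK: "0 \<le> F" using T(1,2)[of 0] by linarith
  define D where "D = \<delta> * (4 * F) powr (1 - \<alpha>)"
  have decay: "T k - T (2 * k) \<le> D * real k powr (- \<alpha>)" if "K \<le> k" for k
  proof -
    have k: "0 < real k" using K that by simp
    have "H (2 * k) + real (2 * k) * T (2 * k) \<le> 2 * (real (2 * k) * T (2 * k))"
    proof -
      have "2 * \<delta>' * (real (2 * k) * T (2 * k)) \<le> 1 * (real (2 * k) * T (2 * k))"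
        using \<delta>' T(1) by (intro mult_right_mono) auto
      then show ?thesis using H1[of "2 * k"] that by simp
    qed
    also have "\<dots> \<le> 4 * F * real k" using mult_left_mono[OF T(2)[of "2 * k"], of "real k"] by (simp add: mult.commute)
    finally have I: "H (2 * k) + real (2 * k) * T (2 * k) \<le> 4 * F * real k" .
    have "0 \<le> H (2 * k) + real (2 * k) * T (2 * k)"
      using Hpos[of "2 * k"] h0(1) T(1)[of "2 * k"] that by (intro add_nonneg_nonneg mult_nonneg_nonneg) auto
    then have pw: "(H (2 * k) + real (2 * k) * T (2 * k)) powr (1 - \<alpha>) \<le> (4 * F * real k) powr (1 - \<alpha>)"
      using I \<alpha> by (intro powr_mono2) auto
    have "real k * (T k - T (2 * k)) \<le> H (2 * k)" by (rule HT)
    also have "\<dots> \<le> \<delta> * (H (2 * k) + real (2 * k) * T (2 * k)) powr (1 - \<alpha>)"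
      using k0[of "2 * k"] that by (simp add: K_def)
    also have "\<dots> \<le> \<delta> * (4 * F * real k) powr (1 - \<alpha>)" using pw \<delta> by (intro mult_left_mono) auto
    also have "\<dots> = real k * (D * real k powr (- \<alpha>))"
      using k FK by (simp add: D_def powr_mult powr_diff powr_minus_divide)
    finally show ?thesis using k by (subst (asm) mult_le_cancel_left_pos)
  qed
  define a where "a j = T (2 ^ j * K)" for j
  define r where "r = 1 / c"
  have r: "0 < r" "r < 1" using c by (auto simp: r_def)
  have ge: "K \<le> 2 ^ j * K" for j by simp
  have Suc_eq: "2 * (2 ^ j * K) = 2 ^ Suc j * K" for j by simp
  define D' where "D' = D * real K powr (- \<alpha>)"
  have step: "a j - a (Suc j) \<le> D' * r ^ j" for j
  proof -
    have "real (2 ^ j * K) powr (- \<alpha>) = real K powr (- \<alpha>) * r ^ j"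
    proof -
      have "(2 ^ j :: real) powr (- \<alpha>) = (2 powr (- \<alpha>)) ^ j"
        by (simp add: powr_powr powr_realpow[symmetric] mult.commute)
      also have "2 powr (- \<alpha>) = r" by (simp add: r_def c_def powr_minus_divide)
      finally show ?thesis by (simp add: powr_mult)
    qed
    then show ?thesis using decay[OF ge, of j] unfolding a_def Suc_eq by (simp add: D'_def)
  qed
  define C where "C = D' / (1 - r)"
  have Cr: "C * (1 - r) = D'" using r by (simp add: C_def)
  have a0: "a \<longlonglongrightarrow> 0"
  proof -
    have "strict_mono (\<lambda>j. 2 ^ j * K)" using K by (intro strict_monoI) simp
    from LIMSEQ_subseq_LIMSEQ[OF T(3) this] show ?thesis by (simp add: a_def[abs_def] o_def)
  qed
  have "a j - C * r ^ j \<le> 0" for j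
  proof (rule incseq_le)
    show "incseq (\<lambda>j. a j - C * r ^ j)"
    proof (rule incseq_SucI)
      fix j
      have "C * r ^ j - C * r ^ Suc j = (C * (1 - r)) * r ^ j" by (simp add: algebra_simps)
      then show "a j - C * r ^ j \<le> a (Suc j) - C * r ^ Suc j" using step[of j] unfolding Cr by linarith
    qed
    have "(\<lambda>j. a j - C * r ^ j) \<longlonglongrightarrow> 0 - C * 0"
      using r by (intro tendsto_diff a0 tendsto_mult tendsto_const LIMSEQ_power_zero) auto
    then show "(\<lambda>j. a j - C * r ^ j) \<longlonglongrightarrow> 0" by simp
  qed
  moreover have low: "a 0 \<le> q ^ j * a j" for j
  proof (induction j)
    case (Suc j)
    have "q ^ j * a j \<le> q ^ j * (q * a (Suc j))"
      using ratio[OF ge, of j] q unfolding a_def Suc_eq by (intro mult_left_mono) auto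
    then show ?case using Suc by (simp add: mult_ac)
  qed simp
  ultimately have "a 0 \<le> C * (q * r) ^ j" for j
  proof -
    have "q ^ j * a j \<le> q ^ j * (C * r ^ j)" using \<open>a j - C * r ^ j \<le> 0\<close> q by (intro mult_left_mono) auto
    then show ?thesis using low[of j] by (simp add: power_mult_distrib mult_ac)
  qed
  moreover have "(\<lambda>j. C * (q * r) ^ j) \<longlonglongrightarrow> C * 0"
    using q r c by (intro tendsto_mult tendsto_const LIMSEQ_power_zero) (simp add: r_def divide_less_eq)
  ultimately have "a 0 \<le> 0" using LIMSEQ_le_const[of "\<lambda>j. C * (q * r) ^ j" 0 "a 0"] by auto
  then have "T K \<le> 0" by (simp add: a_def)
  then have "T K = 0" using T(1)[of K] by simp
  then show False using H1[of K] Hpos[of K] h0(1) by simp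
qed

section \<open>Smooth truncations\<close>

text \<open>Both truncations \<open>v\<close> and \<open>h\<close> of \<open>w\<close> that the proof compares belong to this family: the exponents
  \<open>r = 1/2\<close> and \<open>r = q/2\<close> are tied by \<open>v\<^sup>q = w\<^sup>q\<^sup>-\<^sup>1 h\<close>, see \<open>trunc_powr\<close> below.\<close>

definition trunc :: "real \<Rightarrow> real \<Rightarrow> real \<Rightarrow> real" where
  "trunc r c s = s * (1 + (c * s)\<^sup>2) powr (- r)"

definition trunc' :: "real \<Rightarrow> real \<Rightarrow> real \<Rightarrow> real" where
  "trunc' r c s = (1 + (c * s)\<^sup>2) powr (- r) - 2 * r * (c * s)\<^sup>2 * (1 + (c * s)\<^sup>2) powr (- r - 1)"

lemma one_plus_square_pos: "0 < 1 + (x::real)\<^sup>2"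
  by (simp add: add_pos_nonneg)

lemma has_derivative_one_plus_square:
  "((\<lambda>s::real. 1 + (c * s)\<^sup>2) has_real_derivative 2 * c\<^sup>2 * s) (at s)"
  by (auto intro!: derivative_eq_intros simp: power2_eq_square)

lemma has_derivative_trunc: "(trunc r c has_real_derivative trunc' r c s) (at s)"
proof -
  have "((\<lambda>s. (1 + (c * s)\<^sup>2) powr (- r)) has_real_derivative
      - r * (1 + (c * s)\<^sup>2) powr (- r - of_nat 1) * (2 * c\<^sup>2 * s)) (at s)"
    by (rule DERIV_fun_powr[OF has_derivative_one_plus_square one_plus_square_pos])
  from DERIV_mult[OF DERIV_ident this] show ?thesis
    by (simp add: trunc_def[abs_def] trunc'_def power2_eq_square algebra_simps)
qed

lemma smooth_trunc': "smooth (trunc' r c)"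
proof
  fix k
  have sc: "continuously_differentiable k (\<lambda>s. a * s)" for a :: real and k
    by (rule continuously_differentiable_bounded_linear[OF bounded_linear_mult_right])
  have p: "continuously_differentiable k (\<lambda>s. (1 + (c * s)\<^sup>2) powr a)" for a
    using sc by (intro continuously_differentiable_powr[OF has_derivative_one_plus_square one_plus_square_pos]) blast
  have "continuously_differentiable k (\<lambda>s. (1 + (c * s)\<^sup>2) powr (- r) +
      ((- 2 * r) * ((c * s) * (c * s))) * (1 + (c * s)\<^sup>2) powr (- r - 1))"
    by (intro continuously_differentiable_add continuously_differentiable_mult p sc continuously_differentiable_const)
  then show "continuously_differentiable k (trunc' r c)"
    by (simp add: trunc'_def[abs_def] power2_eq_square)
qed

lemma one_plus_square_powr_le: "0 \<le> r \<Longrightarrow> (1 + (x::real)\<^sup>2) powr (- r) \<le> 1"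
  using powr_mono2'[of "- r" 1 "1 + x\<^sup>2"] by simp

lemma abs_trunc'_le: "0 \<le> r \<Longrightarrow> \<bar>trunc' r c s\<bar> \<le> 1 + 2 * r"
proof -
  assume r: "0 \<le> r"
  let ?y = "(c * s)\<^sup>2"
  have "?y * (1 + ?y) powr (- r - 1) \<le> (1 + ?y) * (1 + ?y) powr (- r - 1)" by (intro mult_right_mono) auto
  also have "\<dots> = (1 + ?y) powr (- r)"
    using one_plus_square_pos[of "c * s"] by (simp add: powr_diff)
  also have "\<dots> \<le> 1" using one_plus_square_powr_le[OF r] .
  finally have "?y * (1 + ?y) powr (- r - 1) \<le> 1" .
  then have "(2 * r) * (?y * (1 + ?y) powr (- r - 1)) \<le> (2 * r) * 1" using r by (intro mult_left_mono) auto
  moreover have "0 \<le> (2 * r) * (?y * (1 + ?y) powr (- r - 1))" using r by simp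
  moreover have "0 \<le> (1 + ?y) powr (- r)" by simp
  ultimately show ?thesis using one_plus_square_powr_le[OF r, of "c * s"]
    unfolding trunc'_def mult.assoc abs_le_iff by linarith
qed

lemma trunc_bounds:
  assumes "0 \<le> s" "0 \<le> r"
  shows "0 \<le> trunc r c s" "trunc r c s \<le> s"
  using assms one_plus_square_powr_le[OF assms(2), of "c * s"]
  by (auto simp: trunc_def mult_left_le)

lemma trunc_tendsto:
  assumes "c \<longlonglongrightarrow> 0"
  shows "(\<lambda>n. trunc r (c n) s) \<longlonglongrightarrow> s" "(\<lambda>n. trunc' r (c n) s) \<longlonglongrightarrow> 1"
proof -
  have 0: "(\<lambda>n. (c n * s)\<^sup>2) \<longlonglongrightarrow> 0"
    using tendsto_power[OF tendsto_mult_right[OF assms, of s], of 2] by (simp add: mult.commute)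
  have 1: "(\<lambda>n. (1 + (c n * s)\<^sup>2) powr a) \<longlonglongrightarrow> 1" for a
    using tendsto_powr[OF tendsto_add[OF tendsto_const 0, of 1] tendsto_const, of a] by simp
  from tendsto_mult[OF tendsto_const 1, of s] show "(\<lambda>n. trunc r (c n) s) \<longlonglongrightarrow> s" by (simp add: trunc_def)
  have "(\<lambda>n. (1 + (c n * s)\<^sup>2) powr (- r) - 2 * r * (c n * s)\<^sup>2 * (1 + (c n * s)\<^sup>2) powr (- r - 1)) \<longlonglongrightarrow> 1 - 2 * r * 0 * 1"
    by (intro tendsto_diff tendsto_mult tendsto_const 0 1)
  then show "(\<lambda>n. trunc' r (c n) s) \<longlonglongrightarrow> 1" by (simp add: trunc'_def)
qed

lemma trunc_half_le:
  assumes "0 \<le> s" "0 < k"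
  shows "trunc (1 / 2) (1 / k) s \<le> k"
proof -
  have "(s / k) \<le> (1 + (s / k)\<^sup>2) powr (1 / 2)"
    using assms by (simp add: powr_half_sqrt real_le_rsqrt)
  then have "s \<le> k * (1 + (s / k)\<^sup>2) powr (1 / 2)" using assms by (simp add: divide_le_eq mult.commute)
  then show ?thesis
    using one_plus_square_pos[of "s / k"] by (simp add: trunc_def powr_minus_divide divide_le_eq)
qed

lemma trunc_ge:
  assumes "0 \<le> s" "s \<le> k" "0 < k" "0 \<le> r"
  shows "2 powr (- r) * s \<le> trunc r (1 / k) s"
proof -
  have "(s / k)\<^sup>2 \<le> 1" using assms by (intro power_le_one) auto
  then have "2 powr (- r) \<le> (1 + (s / k)\<^sup>2) powr (- r)"
    using assms one_plus_square_pos[of "s / k"] by (intro powr_mono2') auto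
  then have "s * 2 powr (- r) \<le> s * (1 + (s / k)\<^sup>2) powr (- r)" using assms by (intro mult_left_mono) auto
  then show ?thesis by (simp add: trunc_def mult.commute)
qed

lemma trunc_powr:
  assumes "0 \<le> s" "0 < q"
  shows "trunc (1 / 2) c s powr q = s powr (q - 1) * trunc (q / 2) c s"
proof (cases "s = 0")
  case False
  then have "s > 0" using assms by simp
  then show ?thesis
    using one_plus_square_pos[of "c * s"] by (simp add: trunc_def powr_mult powr_powr powr_diff)
qed (simp add: trunc_def)

section \<open>Truncated moments\<close>

context bounded_open
begin

lemma integrable_mult_bounded:
  fixes f b :: "'a \<Rightarrow> real"
  assumes "integrable M f" "b \<in> borel_measurable M" "\<And>x. \<bar>b x\<bar> \<le> B"
  shows "integrable M (\<lambda>x. f x * b x)"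
proof (rule Bochner_Integration.integrable_bound[OF integrable_mult_right[OF assms(1), of B]])
  show "AE x in M. norm (f x * b x) \<le> norm (B * f x)"
  proof (rule AE_I2)
    fix x
    have "\<bar>b x\<bar> \<le> \<bar>B\<bar>" using assms(3)[of x] by simp
    then show "norm (f x * b x) \<le> norm (B * f x)" by (simp add: abs_mult mult.commute mult_right_mono)
  qed
qed (use assms in measurable)

end

locale truncated_moments = bounded_open \<Omega> p for \<Omega> :: "'a::euclidean_space set" and p +
  fixes f w :: "'a \<Rightarrow> real"
  assumes f_integrable: "integrable (lebesgue_on \<Omega>) f"
    and f_nonneg: "AE x in lebesgue_on \<Omega>. 0 \<le> f x"
    and f_nonzero: "\<not> (AE x in lebesgue_on \<Omega>. f x = 0)"
    and w_measurable[measurable]: "w \<in> borel_measurable (lebesgue_on \<Omega>)"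
    and w_nonneg: "0 \<le> w x"
    and w_pos: "AE x in lebesgue_on \<Omega>. 0 < w x"
begin

definition moment :: "nat \<Rightarrow> real" where
  "moment k = (\<integral>x. f x * (w x * indicator {..real k} (w x)) \<partial>M)"

definition tail :: "nat \<Rightarrow> real" where
  "tail k = (\<integral>x. f x * indicator {real k<..} (w x) \<partial>M)"

lemma moment_integrable: "integrable M (\<lambda>x. f x * (w x * indicator {..real k} (w x)))"
proof (rule integrable_mult_bounded[OF f_integrable])
  show "\<bar>w x * indicator {..real k} (w x)\<bar> \<le> real k" for x using w_nonneg[of x] by (auto simp: indicator_def)
qed measurable

lemma tail_integrable: "integrable M (\<lambda>x. f x * indicator {real k<..} (w x))"
proof (rule integrable_mult_bounded[OF f_integrable])
  show "\<bar>indicator {real k<..} (w x)\<bar> \<le> (1::real)" for x by (simp add: indicator_def)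
qed measurable

lemma tail_tendsto: "tail \<longlonglongrightarrow> 0"
proof -
  have "tail \<longlonglongrightarrow> (\<integral>x. 0 \<partial>M)"
    unfolding tail_def
  proof (rule integral_dominated_convergence[where w = "\<lambda>x. norm (f x)"])
    show "AE x in M. (\<lambda>k. f x * indicator {real k<..} (w x)) \<longlonglongrightarrow> 0"
    proof (rule AE_I2, rule tendsto_eventually)
      fix x
      obtain n where "w x \<le> real n" using real_arch_simple by blast
      then show "\<forall>\<^sub>F k in sequentially. f x * indicator {real k<..} (w x) = 0"
        by (auto simp: eventually_sequentially intro!: exI[of _ n])
    qed
  qed (use f_integrable in \<open>auto simp: indicator_def\<close>)
  then show ?thesis by simp
qed

lemma tail_bounds: "0 \<le> tail k" "tail k \<le> (\<integral>x. f x \<partial>M)"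
proof -
  show "0 \<le> tail k" unfolding tail_def
    by (rule integral_nonneg_AE) (use f_nonneg in \<open>auto elim!: eventually_mono\<close>)
  show "tail k \<le> (\<integral>x. f x \<partial>M)" unfolding tail_def
    by (rule integral_mono_AE[OF tail_integrable f_integrable]) (use f_nonneg in \<open>auto elim!: eventually_mono simp: indicator_def\<close>)
qed

lemma moment_mono:
  assumes "j \<le> k"
  shows "moment j \<le> moment k"
  unfolding moment_def
proof (rule integral_mono_AE[OF moment_integrable moment_integrable])
  show "AE x in M. f x * (w x * indicator {..real j} (w x)) \<le> f x * (w x * indicator {..real k} (w x))"
    using f_nonneg
  proof eventually_elim
    case (elim x)
    have "w x * indicator {..real j} (w x) \<le> w x * indicator {..real k} (w x)"
      using assms w_nonneg[of x] by (auto simp: indicator_def)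
    then show ?case using elim by (rule mult_left_mono)
  qed
qed

lemma tail_diff_le_moment: "real k * (tail k - tail (2 * k)) \<le> moment (2 * k)"
proof -
  have "real k * (tail k - tail (2 * k)) = (\<integral>x. real k * (f x * indicator {real k<..} (w x) - f x * indicator {real (2 * k)<..} (w x)) \<partial>M)"
    unfolding tail_def using tail_integrable[of k] tail_integrable[of "2 * k"] by simp
  also have "\<dots> \<le> moment (2 * k)" unfolding moment_def
  proof (rule integral_mono_AE[OF _ moment_integrable])
    show "integrable M (\<lambda>x. real k * (f x * indicator {real k<..} (w x) - f x * indicator {real (2 * k)<..} (w x)))"
      by (intro integrable_mult_right Bochner_Integration.integrable_diff tail_integrable)
    show "AE x in M. real k * (f x * indicator {real k<..} (w x) - f x * indicator {real (2 * k)<..} (w x))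
        \<le> f x * (w x * indicator {..real (2 * k)} (w x))"
      using f_nonneg
    proof eventually_elim
      case (elim x)
      have "real k * (indicator {real k<..} (w x) - indicator {real (2 * k)<..} (w x))
          \<le> w x * indicator {..real (2 * k)} (w x)"
        using w_nonneg[of x] by (auto simp: indicator_def)
      from mult_left_mono[OF this elim] show ?case by (simp add: algebra_simps)
    qed
  qed
  finally show ?thesis .
qed

lemma moment_pos: "\<exists>k. 0 < moment k"
proof (rule ccontr)
  assume "\<nexists>k. 0 < moment k"
  then have le: "moment k \<le> 0" for k using not_less by blast
  have n: "AE x in M. 0 \<le> f x * (w x * indicator {..real k} (w x))" for k
    using f_nonneg by eventually_elim (use w_nonneg in auto)
  have z: "AE x in M. f x * (w x * indicator {..real k} (w x)) = 0" for k
  proof -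
    have "moment k = 0" using le[of k] integral_nonneg_AE[OF n[of k]] by (simp add: moment_def)
    then show ?thesis using integral_nonneg_eq_0_iff_AE[OF moment_integrable n] by (simp add: moment_def)
  qed
  have "AE x in M. \<forall>k. f x * (w x * indicator {..real k} (w x)) = 0"
    by (intro iffD2[OF AE_all_countable] allI z)
  then have "AE x in M. f x = 0" using w_pos
  proof eventually_elim
    case (elim x)
    obtain n where "w x \<le> real n" using real_arch_simple by blast
    then show ?case using elim(1)[rule_format, of n] elim(2) by simp
  qed
  then show False using f_nonzero by blast
qed

lemma integral_le_moment_tail:
  assumes v: "v \<in> borel_measurable M" "\<And>x. 0 \<le> v x" "\<And>x. v x \<le> w x" "\<And>x. v x \<le> real k"
  shows "(\<integral>x. f x * v x \<partial>M) \<le> moment k + real k * tail k"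
proof -
  have "(\<integral>x. f x * v x \<partial>M) \<le>
      (\<integral>x. f x * (w x * indicator {..real k} (w x)) + real k * (f x * indicator {real k<..} (w x)) \<partial>M)"
  proof (rule integral_mono_AE)
    show "integrable M (\<lambda>x. f x * v x)"
      by (rule integrable_mult_bounded[OF f_integrable v(1), of "real k"]) (use v in auto)
    show "integrable M (\<lambda>x. f x * (w x * indicator {..real k} (w x)) + real k * (f x * indicator {real k<..} (w x)))"
      by (intro Bochner_Integration.integrable_add moment_integrable integrable_mult_right tail_integrable)
    show "AE x in M. f x * v x \<le> f x * (w x * indicator {..real k} (w x)) + real k * (f x * indicator {real k<..} (w x))"
      using f_nonneg
    proof eventually_elim
      case (elim x)
      have "v x \<le> w x * indicator {..real k} (w x) + real k * indicator {real k<..} (w x)"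
        using v(3,4)[of x] by (auto simp: indicator_def)
      from mult_left_mono[OF this elim] show ?case by (simp add: algebra_simps)
    qed
  qed
  also have "\<dots> = moment k + real k * tail k"
    unfolding moment_def tail_def using moment_integrable[of k] tail_integrable[of k] by simp
  finally show ?thesis .
qed

lemma moment_growth:
  assumes "0 < \<alpha>" "\<alpha> < 1"
  shows "\<exists>\<delta>>0. \<forall>k0. \<exists>k\<ge>k0. \<delta> * (moment k + real k * tail k) powr (1 - \<alpha>) < moment k"
proof (rule ccontr)
  assume "\<not> ?thesis"
  then have "\<exists>k0. \<forall>k\<ge>k0. moment k \<le> \<delta> * (moment k + real k * tail k) powr (1 - \<alpha>)" if "0 < \<delta>" for \<delta>
    using that not_less by metis
  moreover obtain k1 where "0 < moment k1" using moment_pos ..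
  ultimately show False
    using tail_growth_contradiction[OF assms _ moment_mono tail_bounds tail_tendsto tail_diff_le_moment]
    by blast
qed

end

section \<open>Positive functions of zero energy\<close>

context nonneg_energy
begin

text \<open>Testing with \<open>h\<close> gives \<open>\<eta> A(v) = F(h) + o(1)\<close>, since \<open>E(w) = 0\<close> and \<open>v\<^sup>q = w\<^sup>q\<^sup>-\<^sup>1 h\<close>. The right-hand side is bounded
  below by a multiple of the moment of \<open>f\<close>, so \<open>v\<close> is admissible in the hypothesis \<open>star\<close>; as \<open>E(v) \<rightarrow> 0\<close>,
  the moment would be negligible in the sense excluded by \<open>moment_growth\<close>.\<close>

lemma no_positive_null_energy:
  fixes f b :: "'a \<Rightarrow> real" and q \<eta> C :: real
  assumes w: "null_energy w g" and wpos: "AE x in M. 0 < w x"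
    and f: "integrable M f" "AE x in M. 0 \<le> f x" "\<not> (AE x in M. f x = 0)"
    and q: "1 < q" "q < p" and \<eta>: "0 \<le> \<eta>"
    and eq: "\<And>G G' L. \<lbrakk>\<And>s. (G has_real_derivative G' s) (at s); smooth G'; \<And>s. \<bar>G' s\<bar> \<le> L; G 0 = 0\<rbrakk> \<Longrightarrow>
      (\<integral>x. G' (w x) * norm (g x) powr p \<partial>M) =
        lam * (\<integral>x. m x * (w x powr (p - 1) * G (w x)) \<partial>M) +
        \<eta> * (\<integral>x. b x * (w x powr (q - 1) * G (w x)) \<partial>M) - (\<integral>x. f x * G (w x) \<partial>M)"
    and star: "\<And>v h. \<lbrakk>W0 v h; \<And>x. 0 \<le> v x; 0 < (\<integral>x. b x * v x powr q \<partial>M)\<rbrakk> \<Longrightarrow>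
      \<eta> * (\<integral>x. b x * v x powr q \<partial>M) \<le>
        C * (((\<integral>x. norm (h x) powr p \<partial>M) - lam * (\<integral>x. m x * v x powr p \<partial>M)) powr ((q - 1) / (p - 1)) *
          (\<integral>x. f x * v x \<partial>M) powr ((p - q) / (p - 1)))"
  shows False
proof -
  have W: "W0 w g" and w0: "0 \<le> w x" and wi: "integrable M (\<lambda>x. m x * w x powr p)"
    and E: "(\<integral>x. norm (g x) powr p \<partial>M) = lam * (\<integral>x. m x * w x powr p \<partial>M)" for x
    using w by (auto simp: null_energy_def)
  define \<alpha> where "\<alpha> = (q - 1) / (p - 1)"
  have \<alpha>: "0 < \<alpha>" "\<alpha> < 1" and \<alpha>': "(p - q) / (p - 1) = 1 - \<alpha>"
    using q by (auto simp: \<alpha>_def field_simps)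
  have [measurable]: "w \<in> borel_measurable M" "g \<in> borel_measurable M"
    using W0D[OF W] Lp_measurable by blast+
  have [measurable]: "m \<in> borel_measurable M" "f \<in> borel_measurable M" using m_integrable f(1) by auto
  have gi: "integrable M (\<lambda>x. norm (g x) powr p)" using Lp_powr_integrable[OF W0D(2)[OF W]] .
  define c where "c k = 1 / real k" for k :: nat
  have c0: "c \<longlonglongrightarrow> 0" unfolding c_def by (rule lim_1_over_n)
  define v where "v k x = trunc (1 / 2) (c k) (w x)" for k x
  define h where "h k x = trunc (q / 2) (c k) (w x)" for k x
  have trm: "(\<lambda>x. trunc r a (w x)) \<in> borel_measurable M" "(\<lambda>x. trunc' r a (w x)) \<in> borel_measurable M" for r a
    unfolding trunc_def trunc'_def by measurable
  note trm[measurable]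
  have vm[measurable]: "v k \<in> borel_measurable M" "h k \<in> borel_measurable M" for k
    using trm by (auto simp: v_def[abs_def] h_def[abs_def])
  have v: "0 \<le> v k x" "v k x \<le> w x" "h k x \<le> w x" "0 \<le> h k x" for k x
    using trunc_bounds[OF w0] q by (auto simp: v_def h_def)
  have Wv: "W0 (v k) (\<lambda>x. trunc' (1 / 2) (c k) (w x) *\<^sub>R g x)" for k
    unfolding v_def[abs_def]
    by (rule W0_compose[OF W has_derivative_trunc smooth_trunc' abs_trunc'_le]) (auto simp: trunc_def)
  define Ek where "Ek k = (\<integral>x. norm (trunc' (1 / 2) (c k) (w x) *\<^sub>R g x) powr p \<partial>M) - lam * (\<integral>x. m x * v k x powr p \<partial>M)" for k
  define Dk where "Dk k = (\<integral>x. trunc' (q / 2) (c k) (w x) * norm (g x) powr p \<partial>M)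
      - lam * (\<integral>x. m x * (w x powr (p - 1) * h k x) \<partial>M)" for k
  have E_nonneg: "0 \<le> Ek k" for k
    using energy_nonneg[OF Wv[of k]] v(1) by (simp add: Ek_def)
  have E0: "Ek \<longlonglongrightarrow> 0"
  proof -
    have "(\<lambda>k. \<integral>x. norm (trunc' (1 / 2) (c k) (w x) *\<^sub>R g x) powr p \<partial>M) \<longlonglongrightarrow> (\<integral>x. norm (1 *\<^sub>R g x) powr p \<partial>M)"
    proof (rule integral_dominated_convergence[where w = "\<lambda>x. 2 powr p * norm (g x) powr p"])
      show "AE x in M. (\<lambda>k. norm (trunc' (1 / 2) (c k) (w x) *\<^sub>R g x) powr p) \<longlonglongrightarrow> norm (1 *\<^sub>R g x) powr p"
        using p_gt_1 by (intro AE_I2 tendsto_powr' tendsto_norm tendsto_scaleR trunc_tendsto c0 tendsto_const) auto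
      show "AE x in M. norm (norm (trunc' (1 / 2) (c k) (w x) *\<^sub>R g x) powr p) \<le> 2 powr p * norm (g x) powr p" for k
      proof (rule AE_I2)
        fix x
        have "\<bar>trunc' (1 / 2) (c k) (w x)\<bar> * norm (g x) \<le> 2 * norm (g x)"
          using abs_trunc'_le[of "1 / 2" "c k" "w x"] by (intro mult_right_mono) auto
        then have "norm (trunc' (1 / 2) (c k) (w x) *\<^sub>R g x) powr p \<le> (2 * norm (g x)) powr p"
          using p_gt_1 by (intro powr_mono2) auto
        then show "norm (norm (trunc' (1 / 2) (c k) (w x) *\<^sub>R g x) powr p) \<le> 2 powr p * norm (g x) powr p"
          by (simp add: powr_mult)
      qed
    qed (use gi trm in simp_all)
    moreover have "(\<lambda>k. \<integral>x. m x * v k x powr p \<partial>M) \<longlonglongrightarrow> (\<integral>x. m x * w x powr p \<partial>M)"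
    proof (rule integral_dominated_convergence[where w = "\<lambda>x. norm (m x * w x powr p)"])
      show "AE x in M. (\<lambda>k. m x * v k x powr p) \<longlonglongrightarrow> m x * w x powr p"
        unfolding v_def using p_gt_1 trunc_bounds[OF w0]
        by (intro AE_I2 tendsto_mult tendsto_powr' trunc_tendsto c0 tendsto_const) auto
      show "AE x in M. norm (m x * v k x powr p) \<le> norm (m x * w x powr p)" for k
        using v p_gt_1 by (intro AE_I2) (auto simp: abs_mult intro!: mult_left_mono powr_mono2)
    qed (use wi in auto)
    ultimately have "Ek \<longlonglongrightarrow> (\<integral>x. norm (1 *\<^sub>R g x) powr p \<partial>M) - lam * (\<integral>x. m x * w x powr p \<partial>M)"
      unfolding Ek_def by (intro tendsto_diff tendsto_mult tendsto_const)
    then show ?thesis using E by simp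
  qed
  have D0: "Dk \<longlonglongrightarrow> 0"
  proof -
    have "(\<lambda>k. \<integral>x. trunc' (q / 2) (c k) (w x) * norm (g x) powr p \<partial>M) \<longlonglongrightarrow> (\<integral>x. 1 * norm (g x) powr p \<partial>M)"
    proof (rule integral_dominated_convergence[where w = "\<lambda>x. (1 + 2 * (q / 2)) * norm (g x) powr p"])
      show "AE x in M. (\<lambda>k. trunc' (q / 2) (c k) (w x) * norm (g x) powr p) \<longlonglongrightarrow> 1 * norm (g x) powr p"
        by (intro AE_I2 tendsto_mult trunc_tendsto c0 tendsto_const)
      show "AE x in M. norm (trunc' (q / 2) (c k) (w x) * norm (g x) powr p) \<le> (1 + 2 * (q / 2)) * norm (g x) powr p" for k
        using abs_trunc'_le[of "q / 2"] q by (intro AE_I2) (auto simp: abs_mult intro!: mult_right_mono)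
    qed (use gi trm in auto)
    moreover have "(\<lambda>k. \<integral>x. m x * (w x powr (p - 1) * h k x) \<partial>M) \<longlonglongrightarrow> (\<integral>x. m x * (w x powr (p - 1) * w x) \<partial>M)"
    proof (rule integral_dominated_convergence[where w = "\<lambda>x. norm (m x * w x powr p)"])
      show "AE x in M. (\<lambda>k. m x * (w x powr (p - 1) * h k x)) \<longlonglongrightarrow> m x * (w x powr (p - 1) * w x)"
        unfolding h_def by (intro AE_I2 tendsto_mult trunc_tendsto c0 tendsto_const)
      show "AE x in M. norm (m x * (w x powr (p - 1) * h k x)) \<le> norm (m x * w x powr p)" for k
      proof (rule AE_I2)
        fix x
        have "w x powr (p - 1) * h k x \<le> w x powr (p - 1) * w x" using v by (intro mult_left_mono) auto
        also have "\<dots> = w x powr p" using w0[of x] by (cases "w x = 0") (auto simp: powr_diff)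
        finally have "\<bar>m x\<bar> * (w x powr (p - 1) * h k x) \<le> \<bar>m x\<bar> * w x powr p" by (intro mult_left_mono) auto
        then show "norm (m x * (w x powr (p - 1) * h k x)) \<le> norm (m x * w x powr p)"
          using v(4)[of k x] by (simp add: abs_mult)
      qed
    qed (use wi in auto)
    moreover have "w x powr (p - 1) * w x = w x powr p" for x
      using w0[of x] by (cases "w x = 0") (auto simp: powr_diff)
    ultimately have "Dk \<longlonglongrightarrow> (\<integral>x. 1 * norm (g x) powr p \<partial>M) - lam * (\<integral>x. m x * w x powr p \<partial>M)"
      unfolding Dk_def by (intro tendsto_diff tendsto_mult tendsto_const) simp_all
    then show ?thesis using E by simp
  qed
  have D_eq: "Dk k = \<eta> * (\<integral>x. b x * v k x powr q \<partial>M) - (\<integral>x. f x * h k x \<partial>M)" for k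
  proof -
    have "(\<integral>x. trunc' (q / 2) (c k) (w x) * norm (g x) powr p \<partial>M) =
        lam * (\<integral>x. m x * (w x powr (p - 1) * trunc (q / 2) (c k) (w x)) \<partial>M) +
        \<eta> * (\<integral>x. b x * (w x powr (q - 1) * trunc (q / 2) (c k) (w x)) \<partial>M) - (\<integral>x. f x * trunc (q / 2) (c k) (w x) \<partial>M)"
      by (rule eq[OF has_derivative_trunc smooth_trunc' abs_trunc'_le]) (use q in \<open>auto simp: trunc_def\<close>)
    moreover have "w x powr (q - 1) * trunc (q / 2) (c k) (w x) = v k x powr q" for x
      using trunc_powr[OF w0] q by (simp add: v_def)
    ultimately show ?thesis by (simp add: Dk_def h_def)
  qed
  interpret truncated_moments \<Omega> p f w
    by unfold_locales (use f wpos w0 in auto)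
  define c1 where "c1 = 2 powr (- (q / 2))"
  have c1: "0 < c1" by (simp add: c1_def)
  have vb: "\<bar>v k x\<bar> \<le> real k" "\<bar>h k x\<bar> \<le> real k" if "1 \<le> k" for k x
  proof -
    have "v k x \<le> real k" using trunc_half_le[OF w0, of "real k" x] that by (simp add: v_def c_def)
    moreover have "h k x \<le> v k x"
    proof -
      have "(1 + (c k * w x)\<^sup>2) powr (- (q / 2)) \<le> (1 + (c k * w x)\<^sup>2) powr (- (1 / 2))"
        using q by (intro powr_mono) auto
      then show ?thesis using w0[of x] by (simp add: h_def v_def trunc_def mult_left_mono)
    qed
    ultimately show "\<bar>v k x\<bar> \<le> real k" "\<bar>h k x\<bar> \<le> real k" using v(1,4)[of k x] by auto
  qed
  have fi: "integrable M (\<lambda>x. f x * v k x)" "integrable M (\<lambda>x. f x * h k x)" if "1 \<le> k" for k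
    using integrable_mult_bounded[OF f(1) vm(1) vb(1)[OF that]] integrable_mult_bounded[OF f(1) vm(2) vb(2)[OF that]] .
  have Fh: "c1 * moment k \<le> (\<integral>x. f x * h k x \<partial>M)" if k: "1 \<le> k" for k
  proof -
    have "c1 * moment k = (\<integral>x. c1 * (f x * (w x * indicator {..real k} (w x))) \<partial>M)" by (simp add: moment_def)
    also have "\<dots> \<le> (\<integral>x. f x * h k x \<partial>M)"
    proof (rule integral_mono_AE[OF integrable_mult_right[OF moment_integrable] fi(2)[OF k]])
      show "AE x in M. c1 * (f x * (w x * indicator {..real k} (w x))) \<le> f x * h k x"
        using f(2)
      proof eventually_elim
        case (elim x)
        have "c1 * (w x * indicator {..real k} (w x)) \<le> h k x"
          using trunc_ge[OF w0, of x "real k" "q / 2"] k q v(4)[of k x]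
          by (auto simp: indicator_def c1_def h_def c_def)
        from mult_left_mono[OF this elim] show ?case by (simp add: mult_ac)
      qed
    qed
    finally show ?thesis .
  qed
  have Fv: "0 \<le> (\<integral>x. f x * v k x \<partial>M)" "(\<integral>x. f x * v k x \<partial>M) \<le> moment k + real k * tail k" if k: "1 \<le> k" for k
  proof -
    show "0 \<le> (\<integral>x. f x * v k x \<partial>M)"
      by (rule integral_nonneg_AE) (use f(2) v(1) in \<open>auto elim!: eventually_mono\<close>)
    show "(\<integral>x. f x * v k x \<partial>M) \<le> moment k + real k * tail k"
      by (rule integral_le_moment_tail[OF vm(1) v(1,2)]) (use vb(1)[OF k] abs_le_D1 in blast)
  qed
  obtain k1 where k1: "0 < moment k1" using moment_pos ..
  obtain \<delta> where \<delta>: "0 < \<delta>"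
      "\<And>k0. \<exists>k\<ge>k0. \<delta> * (moment k + real k * tail k) powr (1 - \<alpha>) < moment k"
    using moment_growth[OF \<alpha>] by blast
  have "\<forall>\<^sub>F k in sequentially. moment k \<le> \<delta> * (moment k + real k * tail k) powr (1 - \<alpha>)"
  proof -
    have "(\<lambda>k. C * Ek k powr \<alpha>) \<longlonglongrightarrow> C * 0"
      using \<alpha> E_nonneg
      by (intro tendsto_mult tendsto_const tendsto_zero_powrI[OF E0 tendsto_const]) auto
    then have "\<forall>\<^sub>F k in sequentially. C * Ek k powr \<alpha> < \<delta> * c1 / 2"
      by (rule order_tendstoD(2)) (use \<delta>(1) c1 in simp)
    moreover have "\<forall>\<^sub>F k in sequentially. - (c1 * moment k1 / 2) < Dk k"
      using D0 by (rule order_tendstoD(1)) (use c1 k1 in simp)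
    moreover have "\<forall>\<^sub>F k in sequentially. max k1 1 \<le> k" by (rule eventually_ge_at_top)
    ultimately show ?thesis
    proof eventually_elim
      case (elim k)
      have k: "1 \<le> k" "k1 \<le> k" using elim(3) by auto
      have "c1 * moment k1 \<le> c1 * moment k" using moment_mono[OF k(2)] c1 by simp
      moreover have "\<eta> * (\<integral>x. b x * v k x powr q \<partial>M) = (\<integral>x. f x * h k x \<partial>M) + Dk k" using D_eq[of k] by simp
      ultimately have low: "c1 * moment k / 2 \<le> \<eta> * (\<integral>x. b x * v k x powr q \<partial>M)"
        using Fh[OF k(1)] elim(2) by linarith
      have "0 < c1 * moment k" using c1 k1 moment_mono[OF k(2)] by (intro mult_pos_pos) auto
      then have "0 < \<eta> * (\<integral>x. b x * v k x powr q \<partial>M)" using low by linarith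
      then have "0 < (\<integral>x. b x * v k x powr q \<partial>M)" using \<eta> by (simp add: zero_less_mult_iff)
      from star[OF Wv v(1) this]
      have "\<eta> * (\<integral>x. b x * v k x powr q \<partial>M) \<le> C * (Ek k powr \<alpha> * (\<integral>x. f x * v k x \<partial>M) powr (1 - \<alpha>))"
        by (simp add: Ek_def \<alpha>_def[symmetric] \<alpha>')
      also have "\<dots> = (C * Ek k powr \<alpha>) * (\<integral>x. f x * v k x \<partial>M) powr (1 - \<alpha>)" by simp
      also have "\<dots> \<le> (\<delta> * c1 / 2) * (\<integral>x. f x * v k x \<partial>M) powr (1 - \<alpha>)"
        using elim(1) by (intro mult_right_mono) auto
      also have "\<dots> \<le> (\<delta> * c1 / 2) * (moment k + real k * tail k) powr (1 - \<alpha>)"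
        using Fv[OF k(1)] \<alpha> \<delta>(1) c1 by (intro mult_left_mono powr_mono2) auto
      finally have "(c1 / 2) * moment k \<le> (c1 / 2) * (\<delta> * (moment k + real k * tail k) powr (1 - \<alpha>))"
        using low by (simp add: mult_ac)
      then show ?case using c1 by (subst (asm) mult_le_cancel_left_pos) auto
    qed
  qed
  then show False using \<delta>(2) unfolding eventually_sequentially by (metis not_less)
qed

end

section \<open>Nonnegativity of solutions\<close>

text \<open>Young's inequality with the weights \<open>(q-1)/(p-1)\<close> and \<open>(p-q)/(p-1)\<close>, applied to \<open>X\<close> and \<open>Y\<close> divided by
  their weights; this fixes the constant in \<^const>\<open>eta_star\<close>.\<close>

lemma weighted_geometric_mean_le_sum:
  fixes X Y p q :: real
  assumes "1 < q" "q < p" "0 \<le> X" "0 \<le> Y"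
  shows "(p - 1) / ((p - q) powr ((p - q) / (p - 1)) * (q - 1) powr ((q - 1) / (p - 1))) *
    (X powr ((q - 1) / (p - 1)) * Y powr ((p - q) / (p - 1))) \<le> X + Y"
proof (cases "X = 0 \<or> Y = 0")
  case False
  define \<alpha> \<beta> where "\<alpha> = (q - 1) / (p - 1)" and "\<beta> = (p - q) / (p - 1)"
  have ab: "0 < \<alpha>" "0 < \<beta>" "\<alpha> + \<beta> = 1"
    using assms by (auto simp: \<alpha>_def \<beta>_def add_divide_distrib[symmetric])
  have XY: "0 < X" "0 < Y" using False assms by auto
  have "(X / \<alpha>) powr \<alpha> * (Y / \<beta>) powr \<beta> \<le> \<alpha> * (X / \<alpha>) + \<beta> * (Y / \<beta>)"
    using ab XY by (intro Youngs_inequality_0) auto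
  moreover have "(X / \<alpha>) powr \<alpha> * (Y / \<beta>) powr \<beta> =
      (p - 1) / ((p - q) powr \<beta> * (q - 1) powr \<alpha>) * (X powr \<alpha> * Y powr \<beta>)"
  proof -
    have "\<alpha> powr \<alpha> * \<beta> powr \<beta> = (p - q) powr \<beta> * (q - 1) powr \<alpha> / ((p - 1) powr \<alpha> * (p - 1) powr \<beta>)"
      using assms by (simp add: \<alpha>_def \<beta>_def powr_divide)
    also have "(p - 1) powr \<alpha> * (p - 1) powr \<beta> = p - 1"
      using ab assms by (simp flip: powr_add)
    finally have e: "\<alpha> powr \<alpha> * \<beta> powr \<beta> = (p - q) powr \<beta> * (q - 1) powr \<alpha> / (p - 1)" .
    have "(X / \<alpha>) powr \<alpha> * (Y / \<beta>) powr \<beta> = (X powr \<alpha> * Y powr \<beta>) / (\<alpha> powr \<alpha> * \<beta> powr \<beta>)"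
      using ab XY by (simp add: powr_divide)
    then show ?thesis unfolding e by simp
  qed
  ultimately show ?thesis using ab unfolding \<alpha>_def[symmetric] \<beta>_def[symmetric] by simp
qed (use assms in auto)

lemma Lebesgue_space_integrable:
  fixes f :: "'a::euclidean_space \<Rightarrow> real"
  assumes "finite_measure (lebesgue_on \<Omega>)" "f \<in> Lebesgue_space \<gamma> \<Omega>" "1 \<le> \<gamma>"
  shows "integrable (lebesgue_on \<Omega>) f"
proof -
  interpret finite_measure "lebesgue_on \<Omega>" by fact
  show ?thesis
  proof (rule Bochner_Integration.integrable_bound)
    show "integrable (lebesgue_on \<Omega>) (\<lambda>x. 1 + norm (f x) powr \<gamma>)"
      using assms(2) by (simp add: Lebesgue_space_def)
    show "AE x in lebesgue_on \<Omega>. norm (f x) \<le> norm (1 + norm (f x) powr \<gamma>)"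
    proof (rule AE_I2)
      fix x
      show "norm (f x) \<le> norm (1 + norm (f x) powr \<gamma>)"
      proof (cases "norm (f x) \<le> 1")
        case False
        then have "norm (f x) powr 1 \<le> norm (f x) powr \<gamma>" using assms(3) by (intro powr_mono) auto
        then show ?thesis by simp
      qed (simp add: add_increasing2)
    qed
  qed (use assms(2) in \<open>simp add: Lebesgue_space_def\<close>)
qed

context bounded_open
begin

lemma energy_nonneg_below_lambda1:
  assumes W: "W0 v g" and lam: "0 \<le> lam" "ereal lam \<le> lambda1 p \<Omega> m"
  shows "lam * (\<integral>x. m x * \<bar>v x\<bar> powr p \<partial>M) \<le> (\<integral>x. norm (g x) powr p \<partial>M)"
proof (cases "0 < (\<integral>x. m x * \<bar>v x\<bar> powr p \<partial>M)")
  case True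
  have "ereal lam \<le> ereal ((\<integral>x. norm (weak_gradient \<Omega> v x) powr p \<partial>M) / (\<integral>x. m x * \<bar>v x\<bar> powr p \<partial>M))"
    using lam(2) unfolding lambda1_def
    by (rule order_trans) (intro INF_lower, use W0_imp_Sobolev_space0[OF W] True in simp)
  then have "lam * (\<integral>x. m x * \<bar>v x\<bar> powr p \<partial>M) \<le> (\<integral>x. norm (weak_gradient \<Omega> v x) powr p \<partial>M)"
    using True by (simp add: pos_le_divide_eq)
  also have "\<dots> = (\<integral>x. norm (g x) powr p \<partial>M)" by (rule W0_weak_gradient_integral[OF W])
  finally show ?thesis .
next
  case False
  then have "lam * (\<integral>x. m x * \<bar>v x\<bar> powr p \<partial>M) \<le> 0" using lam(1) by (simp add: mult_nonneg_nonpos)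
  also have "0 \<le> (\<integral>x. norm (g x) powr p \<partial>M)" by simp
  finally show ?thesis .
qed

lemma below_eta_star:
  assumes lt: "ereal \<eta> < eta_star p q \<Omega> m f lam b" and q: "1 < q" "q < p"
    and W: "W0 v g" and v: "\<And>x. 0 \<le> v x" and pos: "0 < (\<integral>x. b x * v x powr q \<partial>M)"
  shows "\<eta> * (\<integral>x. b x * v x powr q \<partial>M) <
    (p - 1) / ((p - q) powr ((p - q) / (p - 1)) * (q - 1) powr ((q - 1) / (p - 1))) *
      (((\<integral>x. norm (g x) powr p \<partial>M) - lam * (\<integral>x. m x * v x powr p \<partial>M)) powr ((q - 1) / (p - 1)) *
       (\<integral>x. f x * v x \<partial>M) powr ((p - q) / (p - 1)))"
proof -
  let ?C = "(p - 1) / ((p - q) powr ((p - q) / (p - 1)) * (q - 1) powr ((q - 1) / (p - 1)))"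
  let ?N = "\<lambda>u. ((\<integral>x. norm (weak_gradient \<Omega> u x) powr p \<partial>M) - lam * (\<integral>x. m x * u x powr p \<partial>M)) powr ((q - 1) / (p - 1)) *
                     (\<integral>x. f x * u x \<partial>M) powr ((p - q) / (p - 1))"
  let ?A = "\<integral>x. b x * v x powr q \<partial>M"
  have \<Theta>: "v \<in> Theta p q \<Omega> b"
    using W0_imp_Sobolev_space0[OF W] v pos by (simp add: Theta_def)
  have C: "0 \<le> ?C" using q by simp
  have "ereal \<eta> < ereal ?C * (INF u \<in> Theta p q \<Omega> b. ereal (?N u / (\<integral>x. b x * u x powr q \<partial>M)))"
    using lt \<Theta> by (auto simp: eta_star_def split: if_splits)
  also have "\<dots> \<le> ereal ?C * ereal (?N v / ?A)"
    using C by (intro ereal_mult_left_mono INF_lower[OF \<Theta>]) simp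
  finally have "\<eta> < ?C * (?N v / ?A)" by simp
  then have "\<eta> * ?A < ?C * ?N v"
    using pos_less_divide_eq[OF pos, of \<eta> "?C * ?N v"] by (simp only: times_divide_eq_right)
  then show ?thesis by (simp only: W0_weak_gradient_integral[OF W])
qed

text \<open>On \<open>{u < 0}\<close> the gradients of \<open>u\<close> and \<open>w\<close> are opposite, and elsewhere the test function \<open>G(w)\<close> and its gradient
  vanish. In the lower order terms the two integrands agree at every point, so their integrals agree
  even where these are zero only because the integrand is not integrable.\<close>

lemma solution_tested_with_negative_part:
  assumes sol: "is_solution p q \<Omega> m a f lam \<eta> u"
  defines "w \<equiv> \<lambda>x. max (- u x) 0"
    and "g \<equiv> \<lambda>x. (if u x < 0 then - 1 else 0) *\<^sub>R weak_gradient \<Omega> u x"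
  shows "W0 w g"
    and "\<And>G G' L. \<lbrakk>\<And>s. (G has_real_derivative G' s) (at s); smooth G'; \<And>s. \<bar>G' s\<bar> \<le> L; G 0 = 0\<rbrakk> \<Longrightarrow>
      (\<integral>x. G' (w x) * norm (g x) powr p \<partial>M) =
        lam * (\<integral>x. m x * (w x powr (p - 1) * G (w x)) \<partial>M) +
        \<eta> * (\<integral>x. a x * (w x powr (q - 1) * G (w x)) \<partial>M) - (\<integral>x. f x * G (w x) \<partial>M)"
proof -
  have u0: "u \<in> Sobolev_space0 p \<Omega>" using sol by (simp add: is_solution_def)
  note Wu = Sobolev_space0_imp_W0[OF u0]
  show W: "W0 w g" unfolding w_def g_def by (rule W0_neg_part[OF Wu])
  fix G G' :: "real \<Rightarrow> real" and L :: real
  assume G: "\<And>s. (G has_real_derivative G' s) (at s)" "smooth G'" "\<And>s. \<bar>G' s\<bar> \<le> L" "G 0 = 0"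
  have W\<xi>: "W0 (\<lambda>x. G (w x)) (\<lambda>x. G' (w x) *\<^sub>R g x)" by (rule W0_compose[OF W G])
  have [measurable]: "weak_gradient \<Omega> u \<in> borel_measurable M" "weak_gradient \<Omega> (\<lambda>x. G (w x)) \<in> borel_measurable M"
      "g \<in> borel_measurable M" "w \<in> borel_measurable M"
    using W0D[OF Wu] W0_weak_gradient(2)[OF W\<xi>] W0D[OF W] Lp_measurable by blast+
  have [measurable]: "G' \<in> borel_measurable borel"
    using borel_measurable_continuous_onI[OF smooth_continuous[OF G(2)]] .
  have "(\<integral>x. norm (weak_gradient \<Omega> u x) powr (p - 2) * (weak_gradient \<Omega> u x \<bullet> weak_gradient \<Omega> (\<lambda>x. G (w x)) x) \<partial>M) =
      (\<integral>x. - (G' (w x) * norm (g x) powr p) \<partial>M)"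
  proof (rule integral_cong_AE)
    show "AE x in M. norm (weak_gradient \<Omega> u x) powr (p - 2) * (weak_gradient \<Omega> u x \<bullet> weak_gradient \<Omega> (\<lambda>x. G (w x)) x) =
        - (G' (w x) * norm (g x) powr p)"
      using W0_weak_gradient(1)[OF W\<xi>]
    proof eventually_elim
      case (elim x)
      show ?case
      proof (cases "u x < 0 \<and> weak_gradient \<Omega> u x \<noteq> 0")
        case True
        have "norm (weak_gradient \<Omega> u x) powr (p - 2) * (norm (weak_gradient \<Omega> u x))\<^sup>2 = norm (weak_gradient \<Omega> u x) powr p"
          using True by (simp add: powr_diff powr_numeral)
        then show ?thesis using True unfolding elim by (simp add: g_def power2_norm_eq_inner mult.left_commute)
      next
        case False
        then have "g x = 0" by (auto simp: g_def)
        then show ?thesis using elim by simp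
      qed
    qed
  qed measurable
  moreover have pw: "\<bar>u x\<bar> powr (r - 2) * u x * G (w x) = - (w x powr (r - 1) * G (w x))" for x r
  proof (cases "u x < 0")
    case True
    then have "\<bar>u x\<bar> powr (r - 2) * u x = - (w x powr (r - 1))"
      by (simp add: w_def powr_diff field_simps power2_eq_square powr_numeral)
    then show ?thesis by simp
  qed (simp add: w_def G(4))
  have pw': "k x * \<bar>u x\<bar> powr (r - 2) * u x * G (w x) = - (k x * (w x powr (r - 1) * G (w x)))" for k :: "'a \<Rightarrow> real" and x r
    using pw[of x r] by (simp add: mult.assoc)
  moreover have "(\<integral>x. norm (weak_gradient \<Omega> u x) powr (p - 2) * (weak_gradient \<Omega> u x \<bullet> weak_gradient \<Omega> (\<lambda>x. G (w x)) x) \<partial>M) =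
        lam * (\<integral>x. m x * \<bar>u x\<bar> powr (p - 2) * u x * G (w x) \<partial>M) +
        \<eta> * (\<integral>x. a x * \<bar>u x\<bar> powr (q - 2) * u x * G (w x) \<partial>M) + (\<integral>x. f x * G (w x) \<partial>M)"
    using sol W0_imp_Sobolev_space0[OF W\<xi>] unfolding is_solution_def by blast
  ultimately show "(\<integral>x. G' (w x) * norm (g x) powr p \<partial>M) =
        lam * (\<integral>x. m x * (w x powr (p - 1) * G (w x)) \<partial>M) +
        \<eta> * (\<integral>x. a x * (w x powr (q - 1) * G (w x)) \<partial>M) - (\<integral>x. f x * G (w x) \<partial>M)"
    by simp
qed

end

theorem proposition2p14:
  fixes \<Omega> :: "'a::euclidean_space set"
    and p q \<gamma> lam \<eta> :: real
    and m a f u :: "'a \<Rightarrow> real"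
  assumes "open \<Omega>" and "connected \<Omega>" and "bounded \<Omega>" and "\<Omega> \<noteq> {}"
    and "1 < q" and "q < p"
    and "if real DIM('a) \<ge> p then \<gamma> > real DIM('a) / p else \<gamma> = 1"
    and "m \<in> Lebesgue_space \<gamma> \<Omega>" and "a \<in> Lebesgue_space \<gamma> \<Omega>" and "f \<in> Lebesgue_space \<gamma> \<Omega>"
    and "\<not> (AE x in lebesgue_on \<Omega>. max (m x) 0 = 0)"
    and "\<not> (AE x in lebesgue_on \<Omega>. a x = 0)"
    and "\<not> (AE x in lebesgue_on \<Omega>. f x = 0)"
    and "AE x in lebesgue_on \<Omega>. f x \<ge> 0"
    and "0 \<le> lam" and "ereal lam \<le> lambda1 p \<Omega> m"
    and "(- eta_star p q \<Omega> m f lam (\<lambda>x. - a x) < ereal \<eta> \<and> \<eta> \<le> 0) \<or>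
         (0 \<le> \<eta> \<and> ereal \<eta> < eta_star p q \<Omega> m f lam a)"
    and "is_solution p q \<Omega> m a f lam \<eta> u"
  shows "AE x in lebesgue_on \<Omega>. u x \<ge> 0"
proof -
  note q = \<open>1 < q\<close> \<open>q < p\<close>
  interpret bounded_open \<Omega> p using assms by unfold_locales auto
  have \<gamma>: "1 \<le> \<gamma>"
  proof (cases "real DIM('a) \<ge> p")
    case True
    then have "1 \<le> real DIM('a) / p" using p_gt_1 by simp
    then show ?thesis using True assms(7) by simp
  qed (use assms(7) in simp)
  have fi: "integrable M f"
    by (rule Lebesgue_space_integrable[OF finite_measure_axioms \<open>f \<in> Lebesgue_space \<gamma> \<Omega>\<close> \<gamma>])
  interpret nonneg_energy \<Omega> p m lam
  proof unfold_locales
    show "integrable M m"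
      by (rule Lebesgue_space_integrable[OF finite_measure_axioms \<open>m \<in> Lebesgue_space \<gamma> \<Omega>\<close> \<gamma>])
    show "lam * (\<integral>x. m x * \<bar>v x\<bar> powr p \<partial>M) \<le> (\<integral>x. norm (g x) powr p \<partial>M)" if "W0 v g" for v g
      by (rule energy_nonneg_below_lambda1[OF that \<open>0 \<le> lam\<close> \<open>ereal lam \<le> lambda1 p \<Omega> m\<close>])
  qed fact
  define w where "w x = max (- u x) 0" for x
  define g where "g x = (if u x < 0 then - 1 else 0) *\<^sub>R weak_gradient \<Omega> u x" for x
  have w0: "0 \<le> w x" for x by (simp add: w_def)
  note tested = solution_tested_with_negative_part[OF \<open>is_solution p q \<Omega> m a f lam \<eta> u\<close>,
      folded w_def g_def]
  note W = tested(1)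
  obtain \<eta>' b where \<eta>': "0 \<le> \<eta>'" "ereal \<eta>' < eta_star p q \<Omega> m f lam b"
    and ab: "\<And>x. \<eta> * a x = \<eta>' * b x" and ab_int: "\<And>h. \<eta> * (\<integral>x. a x * h x \<partial>M) = \<eta>' * (\<integral>x. b x * h x \<partial>M)"
  proof -
    consider "- eta_star p q \<Omega> m f lam (\<lambda>x. - a x) < ereal \<eta>" "\<eta> \<le> 0"
      | "0 \<le> \<eta>" "ereal \<eta> < eta_star p q \<Omega> m f lam a"
      using assms(17) by blast
    then show ?thesis
    proof cases
      case 1
      then have "ereal (- \<eta>) < eta_star p q \<Omega> m f lam (\<lambda>x. - a x)"
        by (metis ereal_minus_less_minus ereal_uminus_uminus uminus_ereal.simps(1))
      then show ?thesis using 1 by (intro that[of "- \<eta>" "\<lambda>x. - a x"]) auto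
    next
      case 2
      then show ?thesis by (intro that[of \<eta> a]) auto
    qed
  qed
  define C where "C = (p - 1) / ((p - q) powr ((p - q) / (p - 1)) * (q - 1) powr ((q - 1) / (p - 1)))"
  define E F A where "E = (\<integral>x. norm (g x) powr p \<partial>M) - lam * (\<integral>x. m x * w x powr p \<partial>M)"
    and "F = (\<integral>x. f x * w x \<partial>M)" and "A = (\<integral>x. b x * w x powr q \<partial>M)"
  have E_nonneg: "0 \<le> E" using energy_nonneg[OF W] w0 by (simp add: E_def)
  have F_nonneg: "0 \<le> F" unfolding F_def
    by (rule integral_nonneg_AE) (use assms(14) w0 in \<open>auto elim!: eventually_mono\<close>)
  have identity: "E = \<eta>' * A - F"
  proof -
    have pw: "w x powr (r - 1) * w x = w x powr r" for x r
      using w0[of x] by (cases "w x = 0") (auto simp: powr_diff)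
    have "(\<integral>x. 1 * norm (g x) powr p \<partial>M) =
        lam * (\<integral>x. m x * (w x powr (p - 1) * w x) \<partial>M) +
        \<eta> * (\<integral>x. a x * (w x powr (q - 1) * w x) \<partial>M) - (\<integral>x. f x * w x \<partial>M)"
      by (rule tested(2)[of "\<lambda>s. s" "\<lambda>s. 1" 1]) (auto simp: continuously_differentiable_const)
    then show ?thesis unfolding pw ab_int E_def F_def A_def by simp
  qed
  have E0: "E = 0"
  proof (cases "0 < \<eta>' * A")
    case True
    then have "0 < A" using \<eta>'(1) by (simp add: zero_less_mult_iff)
    then have "\<eta>' * A < C * (E powr ((q - 1) / (p - 1)) * F powr ((p - q) / (p - 1)))"
      unfolding A_def C_def E_def F_def by (rule below_eta_star[OF \<eta>'(2) q W w0])
    also have "\<dots> \<le> E + F" unfolding C_def by (rule weighted_geometric_mean_le_sum[OF q E_nonneg F_nonneg])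
    finally show ?thesis using identity by simp
  qed (use identity E_nonneg F_nonneg in linarith)
  \<comment> \<open>If \<open>m w\<^sup>p\<close> is not integrable, its integral is zero by convention, and zero energy means that the
    gradient vanishes.\<close>
  have "AE x in M. w x = 0"
  proof (cases "integrable M (\<lambda>x. m x * w x powr p)")
    case False
    then have "(\<integral>x. norm (g x) powr p \<partial>M) = 0" using E0 by (simp add: E_def not_integrable_integral_eq)
    then have "AE x in M. norm (g x) powr p = 0"
      using integral_nonneg_eq_0_iff_AE[OF Lp_powr_integrable[OF W0D(2)[OF W]]] by simp
    then have "AE x in M. g x = 0" by eventually_elim simp
    then show ?thesis by (rule W0_gradient_zero[OF W])
  next
    case True
    then have n: "null_energy w g" using W w0 E0 by (simp add: null_energy_def E_def)
    have "\<not> (AE x in M. 0 < w x)"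
    proof
      assume "AE x in M. 0 < w x"
      then show False
      proof (rule no_positive_null_energy[OF n _ fi assms(14,13) q \<eta>'(1), of b C])
        show "(\<integral>x. G' (w x) * norm (g x) powr p \<partial>M) =
            lam * (\<integral>x. m x * (w x powr (p - 1) * G (w x)) \<partial>M) +
            \<eta>' * (\<integral>x. b x * (w x powr (q - 1) * G (w x)) \<partial>M) - (\<integral>x. f x * G (w x) \<partial>M)"
          if "\<And>s. (G has_real_derivative G' s) (at s)" "smooth G'" "\<And>s. \<bar>G' s\<bar> \<le> L" "G 0 = 0" for G G' L
          using tested(2)[OF that] unfolding ab_int .
        show "\<eta>' * (\<integral>x. b x * v x powr q \<partial>M) \<le>
            C * (((\<integral>x. norm (h x) powr p \<partial>M) - lam * (\<integral>x. m x * v x powr p \<partial>M)) powr ((q - 1) / (p - 1)) *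
              (\<integral>x. f x * v x \<partial>M) powr ((p - q) / (p - 1)))"
          if "W0 v h" "\<And>x. 0 \<le> v x" "0 < (\<integral>x. b x * v x powr q \<partial>M)" for v h
          using below_eta_star[OF \<eta>'(2) q that] unfolding C_def by (rule less_imp_le)
      qed
    qed
    then show ?thesis using strong_maximum_principle[OF n \<open>connected \<Omega>\<close>] by blast
  qed
  then show ?thesis by eventually_elim (simp add: w_def max_def split: if_splits)
qed

end
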